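(* Let $(\mathcal X,d,\mu)$ be an RD-space with $\mu(\mathcal X)=\infty$ and doubling exponent $n$. Let $\epsilon_1\in(0,1]$, $\epsilon_2,\epsilon_3>0$, $\epsilon\in(0,\epsilon_1\wedge\epsilon_2)$, and let $\{S_k\}_{k\in\mathbb Z}$ be an $(\epsilon_1,\epsilon_2,\epsilon_3)$-AOTI. Let $p\in(n/(n+\epsilon),1]$ and $\beta,\gamma\in(n(1/p-1),\epsilon)$. Then for any $f\in(\mathcal G_0^\epsilon(\beta,\gamma))'$, $f\in H^p(\mathcal X)$ if and only if $\|S^+(f)\|_{L^p(\mathcal X)}<\infty$; moreover, for all $f\in H^p(\mathcal X)$, $\|f\|_{H^p(\mathcal X)}\sim\|S^+(f)\|_{L^p(\mathcal X)}$, i.e. there is a constant $C\ge1$ independent of $f$ with $C^{-1}\|S^+(f)\|_{L^p(\mathcal X)}\le\|f\|_{H^p(\mathcal X)}\le C\|S^+(f)\|_{L^p(\mathcal X)}$.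
   Context: A triple $(\mathcal X,d,\mu)$, with $(\mathcal X,d)$ a metric space and $\mu$ a Borel regular measure such that every ball $B(x,r)=\{y:d(x,y)<r\}$ has finite positive measure, is a space of homogeneous type if there exist $C_1\ge1$ and $n>0$ with $\mu(B(x,\lambda r))\le C_1\lambda^n\mu(B(x,r))$ for all $x\in\mathcal X$, $\lambda\ge1$, $r>0$ ($n$ is called the doubling exponent). It is an RD-space if moreover there exist $C_2>1$, $C_3>1$ with $\mu(B(x,C_2r))\ge C_3\mu(B(x,r))$ for all $x\in\mathcal X$ and $0<r<\operatorname{diam}(\mathcal X)$. Write $V_r(x)=\mu(B(x,r))$, $V(x,y)=\mu(B(x,d(x,y)))$, $a\wedge b=\min\{a,b\}$. AOTI: for $\epsilon_1\in(0,1]$, $\epsilon_2,\epsilon_3>0$, an $(\epsilon_1,\epsilon_2,\epsilon_3)$-AOTI is a sequence $\{S_k\}_{k\in\mathbb Z}$ of bounded linear integral operators on $L^2(\mathcal X)$ whose kernels $S_k(x,y)$ are measurable and satisfy, for some $C_4>0$ and all $k\in\mathbb Z$, $x,x',y,y'\in\mathcal X$: (i) $|S_k(x,y)|\le C_4\frac{1}{V_{2^{-k}}(x)+V(x,y)}\big[\frac{2^{-k}}{2^{-k}+d(x,y)}\big]^{\epsilon_2}$; (ii) $|S_k(x,y)-S_k(x',y)|\le C_4\big[\frac{d(x,x')}{2^{-k}+d(x,y)}\big]^{\epsilon_1}\frac{1}{V_{2^{-k}}(x)+V(x,y)}\big[\frac{2^{-k}}{2^{-k}+d(x,y)}\big]^{\epsilon_2}$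 whenever $d(x,x')\le[2^{-k}+d(x,y)]/2$; (iii) (ii) also holds with $x$ and $y$ interchanged; (iv) $|[S_k(x,y)-S_k(x,y')]-[S_k(x',y)-S_k(x',y')]|\le C_4\big[\frac{d(x,x')}{2^{-k}+d(x,y)}\big]^{\epsilon_1}\big[\frac{d(y,y')}{2^{-k}+d(x,y)}\big]^{\epsilon_1}\frac{1}{V_{2^{-k}}(x)+V(x,y)}\big[\frac{2^{-k}}{2^{-k}+d(x,y)}\big]^{\epsilon_3}$ whenever $d(x,x')\le[2^{-k}+d(x,y)]/3$ and $d(y,y')\le[2^{-k}+d(x,y)]/3$; (v) $\int_{\mathcal X}S_k(x,z)\,d\mu(z)=1=\int_{\mathcal X}S_k(z,y)\,d\mu(z)$ for all $x,y$. Test functions: for $x\in\mathcal X$, $r>0$, $\beta\in(0,1]$, $\gamma>0$, $\mathcal G(x,r,\beta,\gamma)$ is the set of functions $f$ for which there is $C\ge0$ with (a) $|f(y)|\le C\frac{1}{V_r(x)+V(x,y)}\big(\frac{r}{r+d(x,y)}\big)^\gamma$ for all $y$, and (b) $|f(z)-f(y)|\le C\big(\frac{d(y,z)}{r+d(x,y)}\big)^\beta\frac{1}{V_r(x)+V(x,y)}\big(\frac{r}{r+d(x,y)}\big)^\gamma$ whenever $d(y,z)\le[r+d(x,y)]/2$; $\|f\|_{\mathcal G(x,r,\beta,\gamma)}$ is the infimum of such $C$. Fix $x_1\in\mathcal X$. For $\epsilon\in(0,1]$ and $\beta,\gamma\in(0,\epsilon]$, $\mathcal G_0^\epsilon(\beta,\gamma)$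 is the completion (closure) of $\mathcal G(x_1,1,\epsilon,\epsilon)$ in $\mathcal G(x_1,1,\beta,\gamma)$, with the same norm, and $(\mathcal G_0^\epsilon(\beta,\gamma))'$ is its space of continuous linear functionals. For $f$ in this dual, $S_k(f)(x)=\langle f,S_k(x,\cdot)\rangle$. Maximal functions: for $f\in(\mathcal G_0^\epsilon(\beta,\gamma))'$, the radial maximal function is $S^+(f)(x)=\sup_{k\in\mathbb Z}|S_k(f)(x)|$, and the grand maximal function is $G(f)(x)=\sup\{|\langle f,\varphi\rangle|:\varphi\in\mathcal G_0^\epsilon(\beta,\gamma),\ \|\varphi\|_{\mathcal G(x,r,\beta,\gamma)}\le1\text{ for some }r>0\}$. The Hardy space $H^p(\mathcal X)$ is the set of $f\in(\mathcal G_0^\epsilon(\beta,\gamma))'$ with $\|f\|_{H^p(\mathcal X)}=\|G(f)\|_{L^p(\mathcal X)}<\infty$. *)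

theory Defs
  imports "HOL-Analysis.Analysis" "HOL-Probability.Probability"
begin

definition hom_measure :: "'a::metric_space measure \<Rightarrow> bool" where
  "hom_measure M \<longleftrightarrow> sets M = sets borel \<and> space M = UNIV \<and>
     (\<forall>x r. r > 0 \<longrightarrow> 0 < emeasure M (ball x r) \<and> emeasure M (ball x r) < \<infinity>)"

definition Vr :: "'a::metric_space measure \<Rightarrow> real \<Rightarrow> 'a \<Rightarrow> real" where
  "Vr M r x = measure M (ball x r)"

definition Vxy :: "'a::metric_space measure \<Rightarrow> 'a \<Rightarrow> 'a \<Rightarrow> real" where
  "Vxy M x y = measure M (ball x (dist x y))"

definition doubling_with :: "'a::metric_space measure \<Rightarrow> real \<Rightarrow> real \<Rightarrow> bool" where
  "doubling_with M C1 n \<longleftrightarrow> C1 \<ge> 1 \<and> n > 0 \<and>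
     (\<forall>x lam r. lam \<ge> 1 \<longrightarrow> r > 0 \<longrightarrow>
        measure M (ball x (lam * r)) \<le> C1 * lam powr n * measure M (ball x r))"

definition homogeneous_type :: "'a::metric_space measure \<Rightarrow> real \<Rightarrow> bool" where
  "homogeneous_type M n \<longleftrightarrow> hom_measure M \<and> (\<exists>C1. doubling_with M C1 n)"

definition diamX :: "'a::metric_space itself \<Rightarrow> ereal" where
  "diamX _ = (SUP p \<in> (UNIV :: ('a \<times> 'a) set). ereal (dist (fst p) (snd p)))"

definition rd_space :: "'a::metric_space measure \<Rightarrow> real \<Rightarrow> bool" where
  "rd_space M n \<longleftrightarrow> homogeneous_type M n \<and>
     (\<exists>C2 C3. C2 > 1 \<and> C3 > 1 \<and>
        (\<forall>x r. 0 < r \<longrightarrow> ereal r < diamX TYPE('a) \<longrightarrow>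
           measure M (ball x (C2 * r)) \<ge> C3 * measure M (ball x r)))"

definition dk :: "int \<Rightarrow> real" where
  "dk k = 2 powr (- real_of_int k)"

definition l2_bounded_integral_op :: "'a::metric_space measure \<Rightarrow> ('a \<Rightarrow> 'a \<Rightarrow> real) \<Rightarrow> bool" where
  "l2_bounded_integral_op M K \<longleftrightarrow>
     (\<lambda>(x,y). K x y) \<in> borel_measurable (M \<Otimes>\<^sub>M M) \<and>
     (\<exists>C. \<forall>f. f \<in> borel_measurable M \<and> integrable M (\<lambda>y. (f y)\<^sup>2) \<longrightarrow>
        (AE x in M. integrable M (\<lambda>y. K x y * f y)) \<and>
        (\<lambda>x. \<integral>y. K x y * f y \<partial>M) \<in> borel_measurable M \<and>
        (\<integral>\<^sup>+x. ennreal ((\<integral>y. K x y * f y \<partial>M)\<^sup>2) \<partial>M)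
          \<le> ennreal (C\<^sup>2 * (\<integral>y. (f y)\<^sup>2 \<partial>M)))"

definition AOTI :: "'a::metric_space measure \<Rightarrow> real \<Rightarrow> real \<Rightarrow> real \<Rightarrow> (int \<Rightarrow> 'a \<Rightarrow> 'a \<Rightarrow> real) \<Rightarrow> bool" where
  "AOTI M e1 e2 e3 S \<longleftrightarrow>
     (\<forall>k. l2_bounded_integral_op M (S k)) \<and>
     (\<exists>C4>0. \<forall>k x x' y y'.
        \<bar>S k x y\<bar> \<le> C4 * (1 / (Vr M (dk k) x + Vxy M x y)) * (dk k / (dk k + dist x y)) powr e2
      \<and> (dist x x' \<le> (dk k + dist x y) / 2 \<longrightarrow>
          \<bar>S k x y - S k x' y\<bar> \<le> C4 * (dist x x' / (dk k + dist x y)) powr e1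
             * (1 / (Vr M (dk k) x + Vxy M x y)) * (dk k / (dk k + dist x y)) powr e2)
      \<and> (dist y y' \<le> (dk k + dist x y) / 2 \<longrightarrow>
          \<bar>S k x y - S k x y'\<bar> \<le> C4 * (dist y y' / (dk k + dist y x)) powr e1
             * (1 / (Vr M (dk k) y + Vxy M y x)) * (dk k / (dk k + dist y x)) powr e2)
      \<and> (dist x x' \<le> (dk k + dist x y) / 3 \<longrightarrow> dist y y' \<le> (dk k + dist x y) / 3 \<longrightarrow>
          \<bar>(S k x y - S k x y') - (S k x' y - S k x' y')\<bar>
            \<le> C4 * (dist x x' / (dk k + dist x y)) powr e1 * (dist y y' / (dk k + dist x y)) powr e1
               * (1 / (Vr M (dk k) x + Vxy M x y)) * (dk k / (dk k + dist x y)) powr e3)) \<and>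
     (\<forall>k x. (\<integral>z. S k x z \<partial>M) = 1) \<and>
     (\<forall>k y. (\<integral>z. S k z y \<partial>M) = 1)"

definition G_bound :: "'a::metric_space measure \<Rightarrow> 'a \<Rightarrow> real \<Rightarrow> real \<Rightarrow> real \<Rightarrow> ('a \<Rightarrow> real) \<Rightarrow> real \<Rightarrow> bool" where
  "G_bound M x r \<beta> \<gamma> f C \<longleftrightarrow> C \<ge> 0 \<and>
     (\<forall>y. \<bar>f y\<bar> \<le> C * (1 / (Vr M r x + Vxy M x y)) * (r / (r + dist x y)) powr \<gamma>) \<and>
     (\<forall>y z. dist y z \<le> (r + dist x y) / 2 \<longrightarrow>
        \<bar>f z - f y\<bar> \<le> C * (dist y z / (r + dist x y)) powr \<beta>
           * (1 / (Vr M r x + Vxy M x y)) * (r / (r + dist x y)) powr \<gamma>)"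

definition G_set :: "'a::metric_space measure \<Rightarrow> 'a \<Rightarrow> real \<Rightarrow> real \<Rightarrow> real \<Rightarrow> ('a \<Rightarrow> real) set" where
  "G_set M x r \<beta> \<gamma> = {f. \<exists>C. G_bound M x r \<beta> \<gamma> f C}"

definition G_norm :: "'a::metric_space measure \<Rightarrow> 'a \<Rightarrow> real \<Rightarrow> real \<Rightarrow> real \<Rightarrow> ('a \<Rightarrow> real) \<Rightarrow> real" where
  "G_norm M x r \<beta> \<gamma> f = Inf {C. G_bound M x r \<beta> \<gamma> f C}"

definition G0 :: "'a::metric_space measure \<Rightarrow> 'a \<Rightarrow> real \<Rightarrow> real \<Rightarrow> real \<Rightarrow> ('a \<Rightarrow> real) set" where
  "G0 M x1 \<epsilon> \<beta> \<gamma> = {f \<in> G_set M x1 1 \<beta> \<gamma>.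
      \<forall>\<delta>>0. \<exists>g \<in> G_set M x1 1 \<epsilon> \<epsilon>. G_norm M x1 1 \<beta> \<gamma> (\<lambda>y. f y - g y) < \<delta>}"

text \<open>Continuous linear functionals on G_0^eps(beta,gamma) (only their values on
  G_0^eps(beta,gamma) matter).\<close>
definition G0_dual :: "'a::metric_space measure \<Rightarrow> 'a \<Rightarrow> real \<Rightarrow> real \<Rightarrow> real \<Rightarrow> (('a \<Rightarrow> real) \<Rightarrow> real) set" where
  "G0_dual M x1 \<epsilon> \<beta> \<gamma> = {L.
     (\<forall>\<phi> \<in> G0 M x1 \<epsilon> \<beta> \<gamma>. \<forall>\<psi> \<in> G0 M x1 \<epsilon> \<beta> \<gamma>. \<forall>a b.
        L (\<lambda>y. a * \<phi> y + b * \<psi> y) = a * L \<phi> + b * L \<psi>) \<and>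
     (\<exists>C. \<forall>\<phi> \<in> G0 M x1 \<epsilon> \<beta> \<gamma>. \<bar>L \<phi>\<bar> \<le> C * G_norm M x1 1 \<beta> \<gamma> \<phi>)}"

definition radial_max :: "(int \<Rightarrow> 'a \<Rightarrow> 'a \<Rightarrow> real) \<Rightarrow> (('a \<Rightarrow> real) \<Rightarrow> real) \<Rightarrow> 'a \<Rightarrow> ennreal" where
  "radial_max S f x = (SUP k. ennreal \<bar>f (S k x)\<bar>)"

definition grand_max :: "'a::metric_space measure \<Rightarrow> 'a \<Rightarrow> real \<Rightarrow> real \<Rightarrow> real \<Rightarrow> (('a \<Rightarrow> real) \<Rightarrow> real) \<Rightarrow> 'a \<Rightarrow> ennreal" where
  "grand_max M x1 \<epsilon> \<beta> \<gamma> f x =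
     (SUP \<phi> \<in> {\<phi> \<in> G0 M x1 \<epsilon> \<beta> \<gamma>. \<exists>r>0. \<phi> \<in> G_set M x r \<beta> \<gamma> \<and> G_norm M x r \<beta> \<gamma> \<phi> \<le> 1}.
        ennreal \<bar>f \<phi>\<bar>)"

definition enn_powr :: "ennreal \<Rightarrow> real \<Rightarrow> ennreal" where
  "enn_powr a q = (if a = \<infinity> then \<infinity> else ennreal (enn2real a powr q))"

definition Lp_enn :: "'a measure \<Rightarrow> real \<Rightarrow> ('a \<Rightarrow> ennreal) \<Rightarrow> ennreal" where
  "Lp_enn M p g = enn_powr (\<integral>\<^sup>+x. enn_powr (g x) p \<partial>M) (1 / p)"

definition hardy_norm :: "'a::metric_space measure \<Rightarrow> 'a \<Rightarrow> real \<Rightarrow> real \<Rightarrow> real \<Rightarrow> real \<Rightarrow> (('a \<Rightarrow> real) \<Rightarrow> real) \<Rightarrow> ennreal" where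
  "hardy_norm M x1 \<epsilon> \<beta> \<gamma> p f = Lp_enn M p (grand_max M x1 \<epsilon> \<beta> \<gamma> f)"

definition hardy_space :: "'a::metric_space measure \<Rightarrow> 'a \<Rightarrow> real \<Rightarrow> real \<Rightarrow> real \<Rightarrow> real \<Rightarrow> (('a \<Rightarrow> real) \<Rightarrow> real) set" where
  "hardy_space M x1 \<epsilon> \<beta> \<gamma> p = {f \<in> G0_dual M x1 \<epsilon> \<beta> \<gamma>. hardy_norm M x1 \<epsilon> \<beta> \<gamma> p f < \<infinity>}"

end

(*
  A test function phi at scale R around x0 is expanded as a sum of T_j psi_j,
  where T_j psi(y) = int psi(z) S_{k_j}(z,y) dmu(z), 2^{-k_j} ~ theta^j R, psi_0 = phi and
  psi_{j+1} = psi_j - T_j psi_j up to a cutoff.  Each T_j is bounded on the classes G(x0,R,beta,eps) uniformly in j,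
  so the norm of psi_j grows at most like A^j, while psi_j is pointwise of size
  (A theta^beta)^j: for theta small the loss A^j is harmless.  Pairing with f turns T_j psi_j into
  an integral of psi_j against S_{k_j} f.  This replaces a Calderon reproducing formula.

  To reach p < 1 one writes |S_k f| = |S_k f|^q |S_k f|^{1-q} with q < p and bounds the second
  factor by a finite supremum N of |f(phi)| over normalised phi at scales R >= r around x0, weighted by
  (R/r)^{-gamma}.  The far tails of T_j psi_j are cut off and are small multiples of N.  The outcome is
  N <= C H N^{1-q} + N/2, hence N <= C H^{1/q}, where H is the Hardy-Littlewood maximal function
  at x0 of the q-th power of the radial maximal function, and H is bounded on L^{p/q}.
*)
theory Submission
  imports Defs
begin

section \<open>Bumps and test functions in doubling spaces\<close>

text \<open>The exponents are tied together as follows. Passing a row of \<open>S k\<close> from its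
  own scale s to a larger scale R costs (R/s)^(n+\<beta>): n for the volume and \<beta> for the
  regularity, which is measured relative to the scale. Raised to the power 1-q, this has to lose
  against the gain \<theta>^\<beta> per iteration, so (n+\<beta>)(1-q) < \<beta>, that is q >
  n/(n+\<beta>). Such a q below p exists because \<beta> > n(1/p-1). The iteration uses decay
  \<epsilon> although the functional is continuous for decay \<gamma> < \<epsilon>: tails cut off at
  relative radius \<Lambda> then cost \<Lambda>^(\<gamma>-\<epsilon>), which is small. Likewise,
  pointwise smallness of the remainders says nothing about the functional; interpolation with their
  regularity \<epsilon> > \<beta> does. Decay \<gamma> is recovered afterwards by a dyadic
  decomposition, and the completion by density. Absorbing N/2 requires N to be finite. This comes
  from the continuity of the functional, with a bound depending on x and r that does not enter the
  result.\<close>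

text \<open>The weight \<open>bump\<close> is comparable to the weight of the paper, since
  \<open>V\<^sub>r(x) + V(x,y)\<close> is comparable to the measure of the ball of radius \<open>r + d(x,y)\<close> around \<open>x\<close>.\<close>

definition bump :: "'a::metric_space measure \<Rightarrow> 'a \<Rightarrow> real \<Rightarrow> real \<Rightarrow> 'a \<Rightarrow> real" where
  "bump M x r \<gamma> y = (r / (r + dist x y)) powr \<gamma> / measure M (ball x (r + dist x y))"

definition test_bound ::
    "'a::metric_space measure \<Rightarrow> 'a \<Rightarrow> real \<Rightarrow> real \<Rightarrow> real \<Rightarrow> ('a \<Rightarrow> real) \<Rightarrow> real \<Rightarrow> bool" where
  "test_bound M x r \<beta> \<gamma> f B \<longleftrightarrow>
     (\<forall>y. \<bar>f y\<bar> \<le> B * bump M x r \<gamma> y) \<and>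
     (\<forall>y z. dist y z \<le> (r + dist x y) / 2 \<longrightarrow>
        \<bar>f y - f z\<bar> \<le> B * (dist y z / (r + dist x y)) powr \<beta> * bump M x r \<gamma> y)"

lemma test_boundI:
  assumes "\<And>y. \<bar>f y\<bar> \<le> B * bump M x r \<gamma> y"
    and "\<And>y z. dist y z \<le> (r + dist x y) / 2 \<Longrightarrow>
        \<bar>f y - f z\<bar> \<le> B * (dist y z / (r + dist x y)) powr \<beta> * bump M x r \<gamma> y"
  shows "test_bound M x r \<beta> \<gamma> f B"
  using assms unfolding test_bound_def by blast

lemma test_boundD1: "test_bound M x r \<beta> \<gamma> f B \<Longrightarrow> \<bar>f y\<bar> \<le> B * bump M x r \<gamma> y"
  unfolding test_bound_def by blast

lemma test_boundD2:
  "test_bound M x r \<beta> \<gamma> f B \<Longrightarrow> dist y z \<le> (r + dist x y) / 2 \<Longrightarrow>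
   \<bar>f y - f z\<bar> \<le> B * (dist y z / (r + dist x y)) powr \<beta> * bump M x r \<gamma> y"
  unfolding test_bound_def by blast

lemma mult_ge_one: "1 \<le> a \<Longrightarrow> 1 \<le> b \<Longrightarrow> 1 \<le> a * (b::real)"
  using mult_mono[of 1 a 1 b] by simp

lemma add_dist_pos: "r > 0 \<Longrightarrow> r + dist x y > 0"
  by (simp add: add_pos_nonneg)

section \<open>Volumes of balls and the comparison of bumps\<close>

locale doubling_measure =
  fixes M :: "'a::metric_space measure" and C1 n :: real
  assumes hom: "hom_measure M" and dbl: "doubling_with M C1 n"
begin

abbreviation V :: "'a \<Rightarrow> real \<Rightarrow> real" where "V x r \<equiv> measure M (ball x r)"

lemma C1_ge: "C1 \<ge> 1" and n_pos: "n > 0"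
  using dbl unfolding doubling_with_def by auto

lemma sets_M[measurable_cong]: "sets M = sets borel" and space_M[simp]: "space M = UNIV"
  using hom unfolding hom_measure_def by auto

lemma ball_sets[measurable]: "ball x r \<in> sets M" by (simp add: sets_M)

lemma cont_measurable: "continuous_on UNIV (f :: 'a \<Rightarrow> 'b::metric_space) \<Longrightarrow> f \<in> borel_measurable M"
  using borel_measurable_continuous_onI measurable_cong_sets[OF sets_M refl] by blast

lemma ball_finite: "emeasure M (ball x r) < \<infinity>"
proof (cases "r > 0")
  case True then show ?thesis using hom unfolding hom_measure_def by auto
next
  case False then have "ball x r = {}" by auto
  then show ?thesis by (simp only: emeasure_empty) simp
qed

lemma emeasure_ball: "emeasure M (ball x r) = ennreal (V x r)"
  using ball_finite[of x r] by (simp add: emeasure_eq_ennreal_measure less_top)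

lemma V_pos: "r > 0 \<Longrightarrow> V x r > 0"
  using hom unfolding hom_measure_def by (metis emeasure_ball ennreal_less_zero_iff ennreal_0)

lemma V_mono: "ball x r \<subseteq> ball y t \<Longrightarrow> V x r \<le> V y t"
  by (rule measure_mono_fmeasurable)
     (use ball_finite in \<open>auto simp: fmeasurable_def\<close>)

lemma V_mono_r: "r \<le> t \<Longrightarrow> V x r \<le> V x t"
  by (rule V_mono) auto

lemma V_doubling:
  assumes "0 < s" "s \<le> t" shows "V x t \<le> C1 * (t / s) powr n * V x s"
proof -
  have "V x ((t/s) * s) \<le> C1 * (t / s) powr n * V x s"
    using dbl assms unfolding doubling_with_def
    by (metis le_divide_eq_1_pos)
  then show ?thesis using assms by simp
qed

lemma V_change:
  assumes "0 < s" "t + dist x y \<le> c * s" "1 \<le> c"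
  shows "V x t \<le> C1 * c powr n * V y s"
proof -
  have "V x t \<le> V y (c * s)"
  proof (rule V_mono, rule subsetI)
    fix z assume "z \<in> ball x t"
    then show "z \<in> ball y (c * s)" using dist_triangle[of y z x] assms(2)
      by (auto simp: dist_commute)
  qed
  also have "\<dots> \<le> C1 * (c * s / s) powr n * V y s"
    using assms by (intro V_doubling) auto
  finally show ?thesis using assms by simp
qed

lemma Vinv_change:
  assumes "0 < s" "0 < t" "t + dist x y \<le> c * s" "1 \<le> c"
  shows "1 / V y s \<le> C1 * c powr n / V x t"
  using V_change[OF assms(1,3,4)] V_pos[OF assms(1), of y] V_pos[OF assms(2), of x]
  by (simp add: field_simps)

lemma bump_pos: "r > 0 \<Longrightarrow> bump M x r \<gamma> y > 0"
  unfolding bump_def using add_dist_pos[of r x y] by (auto intro!: divide_pos_pos V_pos)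

lemma bump_nonneg: "r > 0 \<Longrightarrow> bump M x r \<gamma> y \<ge> 0"
  using bump_pos less_imp_le by blast

lemma bump_anti:
  assumes "r > 0" "\<gamma>' \<le> \<gamma>" shows "bump M x r \<gamma> y \<le> bump M x r \<gamma>' y"
  unfolding bump_def using assms add_dist_pos[of r x y]
  by (intro divide_right_mono powr_mono') (auto simp: divide_le_eq_1)

lemma bump_mult_powr:
  assumes "r > 0" shows "(r / (r + dist x y)) powr \<delta> * bump M x r \<gamma> y = bump M x r (\<gamma> + \<delta>) y"
  unfolding bump_def by (simp add: powr_add)

lemma bump_le_center: "r > 0 \<Longrightarrow> \<gamma> \<ge> 0 \<Longrightarrow> bump M x r \<gamma> y \<le> 1 / V x r"
  unfolding bump_def using add_dist_pos[of r x y]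
  by (intro frac_le V_mono_r powr_le1 V_pos) (auto simp: divide_le_eq_1)

text \<open>All comparisons of bumps reduce to two inequalities: one between the radii, including
  the displacement of the centre, which costs \<open>C1 * c powr n\<close> through the volumes, and
  one between the ratios of scale to distance, which costs \<open>b powr \<gamma>\<close>.\<close>

lemma bump_compare:
  assumes "r > 0" "s > 0" "\<gamma> \<ge> 0" "c \<ge> 1" "b \<ge> 0"
    and V: "(s + dist x y) + dist x x' \<le> c * (r + dist x' y')"
    and d: "r * (s + dist x y) \<le> b * (s * (r + dist x' y'))"
  shows "bump M x' r \<gamma> y' \<le> b powr \<gamma> * (C1 * c powr n) * bump M x s \<gamma> y"
proof -
  have p: "s + dist x y > 0" "r + dist x' y' > 0" using assms by (auto simp: add_pos_nonneg)
  have "r / (r + dist x' y') \<le> b * (s / (s + dist x y))"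
    using p d by (simp add: field_simps)
  then have "(r / (r + dist x' y')) powr \<gamma> \<le> (b * (s / (s + dist x y))) powr \<gamma>"
    using assms p by (intro powr_mono2) (auto intro!: divide_nonneg_nonneg)
  also have "\<dots> = b powr \<gamma> * (s / (s + dist x y)) powr \<gamma>"
    by (rule powr_mult)
  finally have 1: "(r / (r + dist x' y')) powr \<gamma> \<le> b powr \<gamma> * (s / (s + dist x y)) powr \<gamma>" .
  have 2: "1 / V x' (r + dist x' y') \<le> C1 * c powr n / V x (s + dist x y)"
    using p V assms by (intro Vinv_change) auto
  have "bump M x' r \<gamma> y' = (r / (r + dist x' y')) powr \<gamma> * (1 / V x' (r + dist x' y'))"
    by (simp add: bump_def)
  also have "\<dots> \<le> (b powr \<gamma> * (s / (s + dist x y)) powr \<gamma>) * (C1 * c powr n / V x (s + dist x y))"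
    by (intro mult_mono 1 2) auto
  also have "\<dots> = b powr \<gamma> * (C1 * c powr n) * bump M x s \<gamma> y" by (simp add: bump_def)
  finally show ?thesis .
qed

text \<open>The constant of \<open>bump_compare\<close> for \<open>b = c = 4\<close>. It covers
  moving the point by half the natural radius, moving the centre by the scale, and exchanging point
  and centre.\<close>

definition Kb :: "real \<Rightarrow> real" where "Kb \<gamma> = 4 powr \<gamma> * (C1 * 4 powr n)"

lemma Kb_ge: "\<gamma> \<ge> 0 \<Longrightarrow> Kb \<gamma> \<ge> 1"
  unfolding Kb_def using n_pos C1_ge
  by (intro mult_ge_one ge_one_powr_ge_zero) auto

lemma bump_near:
  assumes "r > 0" "\<gamma> \<ge> 0" "dist y z \<le> (r + dist x y) / 2"
  shows "bump M x r \<gamma> z \<le> Kb \<gamma> * bump M x r \<gamma> y"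
proof -
  have "dist x y \<le> dist x z + dist y z" using dist_triangle[of x y z] by (simp add: dist_commute)
  then have *: "r + dist x y \<le> 4 * (r + dist x z)" using assms zero_le_dist[of x z] by argo
  show ?thesis unfolding Kb_def
    by (rule bump_compare) (use assms * in \<open>auto intro: mult_left_mono\<close>)
qed

lemma bump_center:
  assumes "r > 0" "\<gamma> \<ge> 0" "dist x x' \<le> r"
  shows "bump M x' r \<gamma> y \<le> Kb \<gamma> * bump M x r \<gamma> y"
proof -
  have "dist x y \<le> dist x x' + dist x' y" by (rule dist_triangle)
  then have *: "(r + dist x y) + dist x x' \<le> 4 * (r + dist x' y)" "r + dist x y \<le> 4 * (r + dist x' y)"
    using assms zero_le_dist[of x' y] by argo+
  show ?thesis unfolding Kb_def
    by (rule bump_compare) (use assms * in \<open>auto intro: mult_left_mono\<close>)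
qed

lemma bump_swap:
  assumes "r > 0" "\<gamma> \<ge> 0"
  shows "bump M x r \<gamma> y \<le> Kb \<gamma> * bump M y r \<gamma> x"
proof -
  have *: "(r + dist y x) + dist y x \<le> 4 * (r + dist x y)" "r + dist y x \<le> 4 * (r + dist x y)"
    using assms zero_le_dist[of x y] unfolding dist_commute[of y x] by argo+
  show ?thesis unfolding Kb_def
    by (rule bump_compare) (use assms * in \<open>auto intro: mult_left_mono\<close>)
qed

text \<open>Enlarging the scale improves the decay factor, so \<open>b = 1\<close> and the volumes
  alone cost \<open>(r / s) powr n\<close>. Shrinking it, in \<open>bump_scale_down\<close>, costs a
  power of the decay exponent and nothing for the volumes, since the ball in the denominator
  shrinks. This asymmetry fixes the weights used later.\<close>

lemma bump_scale_up:
  assumes "0 < s" "s \<le> r" "\<gamma> \<ge> 0"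
  shows "bump M x s \<gamma> y \<le> C1 * (r / s) powr n * bump M x r \<gamma> y"
proof -
  have "s * dist x y \<le> r * dist x y" using assms by (intro mult_right_mono) auto
  then have "(r + dist x y) \<le> r / s * (s + dist x y)" "s * (r + dist x y) \<le> r * (s + dist x y)"
    using assms by (auto simp: field_simps)
  then have "bump M x s \<gamma> y \<le> 1 powr \<gamma> * (C1 * (r / s) powr n) * bump M x r \<gamma> y"
    using assms by (intro bump_compare) auto
  then show ?thesis by simp
qed

lemma bump_scale_down:
  assumes "0 < r" "r \<le> R" "0 \<le> \<gamma>'" "\<gamma>' \<le> \<gamma>"
  shows "bump M x R \<gamma> y \<le> (R / r) powr \<gamma>' * bump M x r \<gamma>' y"
proof -
  have p: "r + dist x y > 0" "R + dist x y > 0" using assms by (auto simp: add_pos_nonneg)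
  have "bump M x R \<gamma> y \<le> bump M x R \<gamma>' y" using assms by (intro bump_anti) auto
  also have "\<dots> \<le> (R / r * (r / (r + dist x y))) powr \<gamma>' / V x (r + dist x y)"
    unfolding bump_def using assms p
    by (intro frac_le powr_mono2 V_mono_r V_pos) (auto simp: field_simps)
  also have "\<dots> = (R / r) powr \<gamma>' * bump M x r \<gamma>' y"
    using assms p unfolding bump_def by (subst powr_mult) auto
  finally show ?thesis .
qed

section \<open>Calculus of test bounds: sums, weakening, changes of scale and centre\<close>

lemma test_bound_nonneg: "r > 0 \<Longrightarrow> test_bound M x r \<beta> \<gamma> f B \<Longrightarrow> B \<ge> 0"
  using test_boundD1[of M x r \<beta> \<gamma> f B x] bump_pos[of r x \<gamma> x]
  by (metis abs_ge_zero order_trans zero_le_mult_iff not_less less_le_not_le)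

lemma test_bound_mono:
  assumes "r > 0" "test_bound M x r \<beta> \<gamma> f B" "B \<le> B'"
  shows "test_bound M x r \<beta> \<gamma> f B'"
proof (rule test_boundI)
  fix y show "\<bar>f y\<bar> \<le> B' * bump M x r \<gamma> y"
    using test_boundD1[OF assms(2), of y] mult_right_mono[OF assms(3) bump_nonneg[OF assms(1), of x \<gamma> y]]
    by linarith
next
  fix y z assume "dist y z \<le> (r + dist x y) / 2"
  from test_boundD2[OF assms(2) this]
  show "\<bar>f y - f z\<bar> \<le> B' * (dist y z / (r + dist x y)) powr \<beta> * bump M x r \<gamma> y"
    by (rule order_trans) (intro mult_right_mono assms bump_nonneg, auto)
qed

lemma test_bound_scale:
  assumes "test_bound M x r \<beta> \<gamma> f B"
  shows "test_bound M x r \<beta> \<gamma> (\<lambda>y. c * f y) (\<bar>c\<bar> * B)"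
proof (rule test_boundI)
  fix y show "\<bar>c * f y\<bar> \<le> \<bar>c\<bar> * B * bump M x r \<gamma> y"
    using mult_left_mono[OF test_boundD1[OF assms, of y], of "\<bar>c\<bar>"] by (simp add: abs_mult mult.assoc)
next
  fix y z assume "dist y z \<le> (r + dist x y) / 2"
  from mult_left_mono[OF test_boundD2[OF assms this], of "\<bar>c\<bar>"]
  show "\<bar>c * f y - c * f z\<bar> \<le> \<bar>c\<bar> * B * (dist y z / (r + dist x y)) powr \<beta> * bump M x r \<gamma> y"
    by (simp add: abs_mult[symmetric] right_diff_distrib mult.assoc)
qed

lemma test_bound_add:
  assumes "test_bound M x r \<beta> \<gamma> f B" "test_bound M x r \<beta> \<gamma> g B'"
  shows "test_bound M x r \<beta> \<gamma> (\<lambda>y. f y + g y) (B + B')"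
proof (rule test_boundI)
  fix y show "\<bar>f y + g y\<bar> \<le> (B + B') * bump M x r \<gamma> y"
    using test_boundD1[OF assms(1), of y] test_boundD1[OF assms(2), of y] by (simp add: distrib_right)
next
  fix y z assume "dist y z \<le> (r + dist x y) / 2"
  from test_boundD2[OF assms(1) this] test_boundD2[OF assms(2) this]
  show "\<bar>f y + g y - (f z + g z)\<bar> \<le> (B + B') * (dist y z / (r + dist x y)) powr \<beta> * bump M x r \<gamma> y"
    by (simp add: distrib_right)
qed

lemma test_bound_minus:
  "test_bound M x r \<beta> \<gamma> f B \<Longrightarrow> test_bound M x r \<beta> \<gamma> (\<lambda>y. - f y) B"
  using test_bound_scale[of x r \<beta> \<gamma> f B "-1"] by simp

lemma test_bound_diff:
  assumes "test_bound M x r \<beta> \<gamma> f B" "test_bound M x r \<beta> \<gamma> g B'"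
  shows "test_bound M x r \<beta> \<gamma> (\<lambda>y. f y - g y) (B + B')"
  using test_bound_add[OF assms(1) test_bound_minus[OF assms(2)]] by simp

lemma test_bound_weaken:
  assumes "r > 0" "\<beta>' \<le> \<beta>" "\<gamma>' \<le> \<gamma>" "test_bound M x r \<beta> \<gamma> f B"
  shows "test_bound M x r \<beta>' \<gamma>' f B"
proof -
  note B = test_bound_nonneg[OF assms(1,4)]
  show ?thesis
  proof (rule test_boundI)
    fix y show "\<bar>f y\<bar> \<le> B * bump M x r \<gamma>' y"
      using test_boundD1[OF assms(4), of y] mult_left_mono[OF bump_anti[OF assms(1,3), of x y] B] by linarith
  next
    fix y z assume d: "dist y z \<le> (r + dist x y) / 2"
    have "(dist y z / (r + dist x y)) powr \<beta> \<le> (dist y z / (r + dist x y)) powr \<beta>'"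
      using d assms add_dist_pos[OF assms(1), of x y] by (intro powr_mono' divide_nonneg_nonneg) (auto simp: divide_le_eq_1 not_less)
    then have "B * (dist y z / (r + dist x y)) powr \<beta> * bump M x r \<gamma> y
       \<le> B * (dist y z / (r + dist x y)) powr \<beta>' * bump M x r \<gamma>' y"
      using B assms by (intro mult_mono bump_anti bump_nonneg mult_nonneg_nonneg) auto
    with test_boundD2[OF assms(4) d]
    show "\<bar>f y - f z\<bar> \<le> B * (dist y z / (r + dist x y)) powr \<beta>' * bump M x r \<gamma>' y" by linarith
  qed
qed

lemma size_diff:
  assumes "r > 0" "\<gamma> \<ge> 0" "A \<ge> 0" "\<And>y. \<bar>f y\<bar> \<le> A * bump M x r \<gamma> y" "dist y z \<le> (r + dist x y) / 2"
  shows "\<bar>f y - f z\<bar> \<le> (1 + Kb \<gamma>) * A * bump M x r \<gamma> y"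
proof -
  have "A * bump M x r \<gamma> z \<le> A * (Kb \<gamma> * bump M x r \<gamma> y)"
    using assms by (intro mult_left_mono bump_near) auto
  then have "\<bar>f y\<bar> + \<bar>f z\<bar> \<le> A * bump M x r \<gamma> y + A * (Kb \<gamma> * bump M x r \<gamma> y)"
    using assms(4)[of y] assms(4)[of z] by linarith
  then show ?thesis by (simp add: algebra_simps)
qed

text \<open>Changing the scale or the centre shrinks the range of \<open>dist y z\<close> on which
  regularity is inherited by a factor \<open>c\<close>. On the rest of the range
  \<open>2 * c * (dist y z / (r + dist x y))\<close> is at least 1, so the trivial bound by the
  sizes at both points already has the required form.\<close>

lemma test_bound_extend:
  assumes r: "r > 0" "\<gamma> \<ge> 0" "\<beta> \<ge> 0" "c \<ge> 1" "A \<ge> 0" "B \<ge> 0"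
    and size: "\<And>y. \<bar>f y\<bar> \<le> A * bump M x r \<gamma> y"
    and reg: "\<And>y z. dist y z \<le> (r + dist x y) / (2 * c) \<Longrightarrow>
        \<bar>f y - f z\<bar> \<le> B * (dist y z / (r + dist x y)) powr \<beta> * bump M x r \<gamma> y"
  shows "test_bound M x r \<beta> \<gamma> f (B + (1 + Kb \<gamma>) * (2 * c) powr \<beta> * A)"
proof -
  have c1: "1 \<le> (2 * c) powr \<beta>" using r by (intro ge_one_powr_ge_zero) auto
  have K1: "1 \<le> Kb \<gamma>" using Kb_ge r by auto
  have "1 * A \<le> (1 + Kb \<gamma>) * (2 * c) powr \<beta> * A"
    using c1 K1 r by (intro mult_right_mono mult_ge_one) auto
  then have A_le: "A \<le> B + (1 + Kb \<gamma>) * (2 * c) powr \<beta> * A" using r by simp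
  show ?thesis
  proof (rule test_boundI)
    fix y show "\<bar>f y\<bar> \<le> (B + (1 + Kb \<gamma>) * (2 * c) powr \<beta> * A) * bump M x r \<gamma> y"
      using size[of y] mult_right_mono[OF A_le bump_nonneg[OF r(1)], of x \<gamma> y] by linarith
  next
    fix y z assume d: "dist y z \<le> (r + dist x y) / 2"
    have p: "r + dist x y > 0" using r by (simp add: add_pos_nonneg)
    have b0: "bump M x r \<gamma> y \<ge> 0" using bump_nonneg r by auto
    let ?q = "(dist y z / (r + dist x y)) powr \<beta>"
    have e: "(B + (1 + Kb \<gamma>) * (2 * c) powr \<beta> * A) * ?q * bump M x r \<gamma> y =
       B * ?q * bump M x r \<gamma> y + (1 + Kb \<gamma>) * A * ((2 * c) powr \<beta> * ?q) * bump M x r \<gamma> y"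
      by (simp add: algebra_simps)
    show "\<bar>f y - f z\<bar> \<le> (B + (1 + Kb \<gamma>) * (2 * c) powr \<beta> * A) * ?q * bump M x r \<gamma> y"
    proof (cases "dist y z \<le> (r + dist x y) / (2 * c)")
      case True
      have "0 \<le> (1 + Kb \<gamma>) * A * ((2 * c) powr \<beta> * ?q) * bump M x r \<gamma> y"
        using K1 r b0 by (intro mult_nonneg_nonneg) auto
      then show ?thesis using reg[OF True] unfolding e by linarith
    next
      case False
      then have "1 \<le> 2 * c * (dist y z / (r + dist x y))" using p r by (simp add: field_simps)
      then have "1 \<le> (2 * c * (dist y z / (r + dist x y))) powr \<beta>" using r by (intro ge_one_powr_ge_zero) auto
      also have "\<dots> = (2 * c) powr \<beta> * ?q" by (rule powr_mult)
      finally have 1: "1 \<le> (2 * c) powr \<beta> * ?q" .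
      have "\<bar>f y - f z\<bar> \<le> (1 + Kb \<gamma>) * A * bump M x r \<gamma> y"
        by (rule size_diff[OF r(1,2,5) size d])
      also have "\<dots> = (1 + Kb \<gamma>) * A * 1 * bump M x r \<gamma> y" by simp
      also have "\<dots> \<le> (1 + Kb \<gamma>) * A * ((2 * c) powr \<beta> * ?q) * bump M x r \<gamma> y"
        using K1 r b0 by (intro mult_right_mono mult_left_mono 1) auto
      also have "\<dots> \<le> B * ?q * bump M x r \<gamma> y + \<dots>" using r b0 by simp
      finally show ?thesis unfolding e .
    qed
  qed
qed

text \<open>The factor \<open>(r / s) powr n\<close> comes from the volumes and
  \<open>(r / s) powr \<beta>\<close> from measuring the same distance relative to the larger
  radius. The range of distances shrinks by \<open>r / s\<close> and is restored by
  \<open>test_bound_extend\<close>.\<close>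

lemma test_bound_scale_up:
  assumes "0 < s" "s \<le> r" "0 \<le> \<beta>" "0 \<le> \<gamma>" "test_bound M x s \<beta> \<gamma> f B"
  shows "test_bound M x r \<beta> \<gamma> f (C1 * (1 + (1 + Kb \<gamma>) * 2 powr \<beta>) * (r / s) powr (n + \<beta>) * B)"
proof -
  note B = test_bound_nonneg[OF assms(1,5)]
  define c where "c = r / s"
  have c: "c \<ge> 1" "r = c * s" using assms by (auto simp: c_def)
  have r: "r > 0" using assms by auto
  have up: "bump M x s \<gamma> y \<le> C1 * c powr n * bump M x r \<gamma> y" for y
    using bump_scale_up[OF assms(1,2,4)] by (simp add: c_def)
  have "test_bound M x r \<beta> \<gamma> f ((C1 * c powr n * c powr \<beta> * B) + (1 + Kb \<gamma>) * (2 * c) powr \<beta> * (C1 * c powr n * B))"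
  proof (rule test_bound_extend)
    show "r > 0" "\<gamma> \<ge> 0" "\<beta> \<ge> 0" "c \<ge> 1" "0 \<le> C1 * c powr n * B" "0 \<le> C1 * c powr n * c powr \<beta> * B"
      using assms c r B C1_ge by auto
    fix y show "\<bar>f y\<bar> \<le> C1 * c powr n * B * bump M x r \<gamma> y"
      using test_boundD1[OF assms(5), of y] mult_left_mono[OF up[of y] B] by (simp add: mult_ac)
  next
    fix y z assume d: "dist y z \<le> (r + dist x y) / (2 * c)"
    have ps: "s + dist x y > 0" "r + dist x y > 0" using assms r by (auto simp: add_pos_nonneg)
    have le: "r + dist x y \<le> c * (s + dist x y)" 
      using c mult_right_mono[OF c(1) zero_le_dist[of x y]] by (simp add: distrib_left)
    then have "(r + dist x y) / c \<le> s + dist x y" using c by (simp add: field_simps)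
    then have d2: "dist y z \<le> (s + dist x y) / 2" using d by simp
    have "dist y z / (s + dist x y) \<le> c * (dist y z / (r + dist x y))"
      using le ps mult_left_mono[OF le zero_le_dist[of y z]] by (simp add: field_simps)
    then have "(dist y z / (s + dist x y)) powr \<beta> \<le> (c * (dist y z / (r + dist x y))) powr \<beta>"
      using assms ps by (intro powr_mono2) auto
    also have "\<dots> = c powr \<beta> * (dist y z / (r + dist x y)) powr \<beta>"
      by (rule powr_mult)
    finally have q: "(dist y z / (s + dist x y)) powr \<beta> \<le> c powr \<beta> * (dist y z / (r + dist x y)) powr \<beta>" .
    have "\<bar>f y - f z\<bar> \<le> B * (dist y z / (s + dist x y)) powr \<beta> * bump M x s \<gamma> y"
      by (rule test_boundD2[OF assms(5) d2])
    also have "\<dots> \<le> B * (c powr \<beta> * (dist y z / (r + dist x y)) powr \<beta>) * (C1 * c powr n * bump M x r \<gamma> y)"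
      using B assms by (intro mult_mono q up bump_nonneg) auto
    finally show "\<bar>f y - f z\<bar> \<le> C1 * c powr n * c powr \<beta> * B * (dist y z / (r + dist x y)) powr \<beta> * bump M x r \<gamma> y"
      by (simp add: mult_ac)
  qed
  moreover have "(2 * c) powr \<beta> = 2 powr \<beta> * c powr \<beta>" by (rule powr_mult)
  ultimately show ?thesis by (simp add: c_def[symmetric] powr_add algebra_simps)
qed

lemma test_bound_center:
  assumes "0 < r" "0 \<le> \<beta>" "0 \<le> \<gamma>" "dist x x' \<le> r" "test_bound M x' r \<beta> \<gamma> f B"
  shows "test_bound M x r \<beta> \<gamma> f (2 powr \<beta> * Kb \<gamma> * (1 + (1 + Kb \<gamma>) * 2 powr \<beta>) * B)"
proof -
  note B = test_bound_nonneg[OF assms(1,5)]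
  note up = bump_center[OF assms(1,3,4)]
  have K: "Kb \<gamma> \<ge> 1" using Kb_ge assms by auto
  have ge1: "1 \<le> (2::real) powr \<beta>" using assms by (intro ge_one_powr_ge_zero) auto
  have "test_bound M x r \<beta> \<gamma> f (2 powr \<beta> * Kb \<gamma> * B + (1 + Kb \<gamma>) * (2 * 2) powr \<beta> * (Kb \<gamma> * B))"
  proof (rule test_bound_extend)
    show "r > 0" "\<gamma> \<ge> 0" "\<beta> \<ge> 0" "(2::real) \<ge> 1" "0 \<le> Kb \<gamma> * B" "0 \<le> 2 powr \<beta> * Kb \<gamma> * B"
      using assms K B by auto
    fix y show "\<bar>f y\<bar> \<le> Kb \<gamma> * B * bump M x r \<gamma> y"
      using test_boundD1[OF assms(5), of y] mult_left_mono[OF up[of y] B] by (simp add: mult_ac)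
  next
    fix y z assume d: "dist y z \<le> (r + dist x y) / (2 * 2)"
    have ps: "r + dist x' y > 0" "r + dist x y > 0" using assms by (auto simp: add_pos_nonneg)
    have le: "r + dist x y \<le> 2 * (r + dist x' y)" 
      using dist_triangle[of x y x'] assms zero_le_dist[of x' y] by argo
    then have d2: "dist y z \<le> (r + dist x' y) / 2" using d by simp
    have "dist y z / (r + dist x' y) \<le> 2 * (dist y z / (r + dist x y))"
      using le ps mult_left_mono[OF le zero_le_dist[of y z]] by (simp add: field_simps)
    then have "(dist y z / (r + dist x' y)) powr \<beta> \<le> (2 * (dist y z / (r + dist x y))) powr \<beta>"
      using assms ps by (intro powr_mono2) auto
    also have "\<dots> = 2 powr \<beta> * (dist y z / (r + dist x y)) powr \<beta>"
      by (rule powr_mult)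
    finally have q: "(dist y z / (r + dist x' y)) powr \<beta> \<le> 2 powr \<beta> * (dist y z / (r + dist x y)) powr \<beta>" .
    have "\<bar>f y - f z\<bar> \<le> B * (dist y z / (r + dist x' y)) powr \<beta> * bump M x' r \<gamma> y"
      by (rule test_boundD2[OF assms(5) d2])
    also have "\<dots> \<le> B * (2 powr \<beta> * (dist y z / (r + dist x y)) powr \<beta>) * (Kb \<gamma> * bump M x r \<gamma> y)"
      using B assms by (intro mult_mono q up bump_nonneg) auto
    finally show "\<bar>f y - f z\<bar> \<le> 2 powr \<beta> * Kb \<gamma> * B * (dist y z / (r + dist x y)) powr \<beta> * bump M x r \<gamma> y"
      by (simp add: mult_ac)
  qed
  moreover have "(2 * 2::real) powr \<beta> = 2 powr \<beta> * 2 powr \<beta>" by (rule powr_mult)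
  ultimately show ?thesis by (simp add: algebra_simps)
qed

text \<open>The regularity quotient grows when the scale shrinks, so the loss is that of the bump
  alone, with the decay exponent \<gamma>' that is kept.\<close>

lemma test_bound_scale_down:
  assumes "0 < r" "r \<le> R" "0 \<le> \<beta>" "0 \<le> \<gamma>'" "\<gamma>' \<le> \<gamma>" "test_bound M x R \<beta> \<gamma> f B"
  shows "test_bound M x r \<beta> \<gamma>' f ((R / r) powr \<gamma>' * B)"
proof -
  have R: "R > 0" using assms by auto
  note B = test_bound_nonneg[OF R assms(6)]
  note dn = bump_scale_down[OF assms(1,2,4,5)]
  show ?thesis
  proof (rule test_boundI)
    fix y show "\<bar>f y\<bar> \<le> (R / r) powr \<gamma>' * B * bump M x r \<gamma>' y"
      using test_boundD1[OF assms(6), of y] mult_left_mono[OF dn[of x y] B] by (simp add: mult_ac)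
  next
    fix y z assume d: "dist y z \<le> (r + dist x y) / 2"
    have q: "(dist y z / (R + dist x y)) powr \<beta> \<le> (dist y z / (r + dist x y)) powr \<beta>"
      using assms by (intro powr_mono2 frac_le) (auto simp: add_pos_nonneg)
    have d2: "dist y z \<le> (R + dist x y) / 2" using d assms by simp
    have "\<bar>f y - f z\<bar> \<le> B * (dist y z / (R + dist x y)) powr \<beta> * bump M x R \<gamma> y"
      by (rule test_boundD2[OF assms(6) d2])
    also have "\<dots> \<le> B * (dist y z / (r + dist x y)) powr \<beta> * ((R / r) powr \<gamma>' * bump M x r \<gamma>' y)"
      using B R by (intro mult_mono q dn bump_nonneg) auto
    finally show "\<bar>f y - f z\<bar> \<le> (R / r) powr \<gamma>' * B * (dist y z / (r + dist x y)) powr \<beta> * bump M x r \<gamma>' y"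
      by (simp add: mult_ac)
  qed
qed

lemma test_bound_change:
  assumes "0 < r" "0 < r'" "0 \<le> \<beta>" "0 \<le> \<gamma>"
  shows "\<exists>C>0. \<forall>f B. test_bound M x' r' \<beta> \<gamma> f B \<longrightarrow> test_bound M x r \<beta> \<gamma> f (C * B)"
proof -
  \<comment> \<open>\<rho> dominates both scales and the distance of the centres: scale up to
    \<rho>, move the centre there, then scale down.\<close>
  define \<rho> where "\<rho> = max (max r r') (dist x x')"
  have \<rho>: "\<rho> \<ge> r" "\<rho> \<ge> r'" "dist x x' \<le> \<rho>" "\<rho> > 0" using assms by (auto simp: \<rho>_def)
  have K: "Kb \<gamma> \<ge> 1" using Kb_ge assms by auto
  define C where "C = (\<rho> / r) powr \<gamma> * ((2 powr \<beta> * Kb \<gamma> * (1 + (1 + Kb \<gamma>) * 2 powr \<beta>)) * (C1 * (1 + (1 + Kb \<gamma>) * 2 powr \<beta>) * (\<rho> / r') powr (n + \<beta>)))"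
  have "C > 0" unfolding C_def using K \<rho> assms C1_ge
    by (intro mult_pos_pos add_pos_nonneg) auto
  moreover have "test_bound M x r \<beta> \<gamma> f (C * B)" if "test_bound M x' r' \<beta> \<gamma> f B" for f B
    using test_bound_scale_down[OF assms(1) \<rho>(1) assms(3,4) order_refl
      test_bound_center[OF \<rho>(4) assms(3,4) \<rho>(3) test_bound_scale_up[OF assms(2) \<rho>(2) assms(3,4) that]]]
    by (simp add: C_def mult_ac)
  ultimately show ?thesis by blast
qed

lemma min_le_powr:
  assumes "0 \<le> u" "u \<le> a" "u \<le> b" "0 \<le> t" "t \<le> (1::real)" shows "u \<le> a powr (1 - t) * b powr t"
proof (cases "u = 0")
  case False
  then have "u = u powr (1 - t) * u powr t" using assms by (simp flip: powr_add)
  also have "\<dots> \<le> a powr (1 - t) * b powr t" using assms by (intro mult_mono powr_mono2) auto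
  finally show ?thesis .
qed simp

text \<open>Both bounds hold for the same difference, hence so does their geometric mean with
  weights \<open>1 - \<beta>' / \<beta>\<close> and \<open>\<beta>' / \<beta>\<close>, in which the
  distance carries the exponent \<beta>'. A small size thus makes the norm of lower regularity small
  even when the norm of regularity \<beta> is large.\<close>

lemma test_bound_interp:
  assumes r: "r > 0" "\<gamma> \<ge> 0" "0 < \<beta>'" "\<beta>' \<le> \<beta>" "A \<ge> 0"
    and f: "test_bound M x r \<beta> \<gamma> f B" and size: "\<And>y. \<bar>f y\<bar> \<le> A * bump M x r \<gamma> y"
  shows "test_bound M x r \<beta>' \<gamma> f (A + ((1 + Kb \<gamma>) * A) powr (1 - \<beta>' / \<beta>) * B powr (\<beta>' / \<beta>))"
proof -
  note B = test_bound_nonneg[OF r(1) f]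
  have K: "Kb \<gamma> \<ge> 1" using Kb_ge r by auto
  let ?A = "(1 + Kb \<gamma>) * A" and ?t = "\<beta>' / \<beta>"
  have t: "0 \<le> ?t" "?t \<le> 1" "\<beta> * ?t = \<beta>'" using r by (auto simp: field_simps)
  show ?thesis
  proof (rule test_boundI)
    fix y
    have "0 \<le> ?A powr (1 - ?t) * B powr ?t * bump M x r \<gamma> y" using bump_nonneg r by auto
    then show "\<bar>f y\<bar> \<le> (A + ?A powr (1 - ?t) * B powr ?t) * bump M x r \<gamma> y"
      using size[of y] by (simp add: distrib_right)
  next
    fix y z assume d: "dist y z \<le> (r + dist x y) / 2"
    let ?w = "bump M x r \<gamma> y" and ?q = "dist y z / (r + dist x y)"
    have w: "?w > 0" using bump_pos r by auto
    have q: "?q \<ge> 0" using r by auto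
    have "\<bar>f y - f z\<bar> \<le> (?A * ?w) powr (1 - ?t) * (B * ?q powr \<beta> * ?w) powr ?t"
      by (rule min_le_powr[OF _ size_diff[OF r(1,2,5) size d] test_boundD2[OF f d] t(1,2)]) auto
    also have "(?A * ?w) powr (1 - ?t) = ?A powr (1 - ?t) * ?w powr (1 - ?t)"
      by (rule powr_mult)
    also have "(B * ?q powr \<beta> * ?w) powr ?t = B powr ?t * (?q powr \<beta>) powr ?t * ?w powr ?t"
      using B w by (simp add: powr_mult)
    also have "(?q powr \<beta>) powr ?t = ?q powr \<beta>'" by (simp only: powr_powr t(3))
    also have "?A powr (1 - ?t) * ?w powr (1 - ?t) * (B powr ?t * ?q powr \<beta>' * ?w powr ?t)
       = ?A powr (1 - ?t) * B powr ?t * ?q powr \<beta>' * (?w powr (1 - ?t) * ?w powr ?t)" by (simp only: mult_ac)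
    also have "?w powr (1 - ?t) * ?w powr ?t = ?w" using w by (simp flip: powr_add)
    also have "?A powr (1 - ?t) * B powr ?t * ?q powr \<beta>' * ?w \<le> (A + ?A powr (1 - ?t) * B powr ?t) * ?q powr \<beta>' * ?w"
      using w r by (intro mult_right_mono) auto
    finally show "\<bar>f y - f z\<bar> \<le> (A + ?A powr (1 - ?t) * B powr ?t) * ?q powr \<beta>' * ?w" .
  qed
qed

lemma test_bound_continuous:
  assumes r: "r > 0" "\<beta> > 0" and f: "test_bound M x r \<beta> \<gamma> f B"
  shows "continuous_on UNIV f"
  unfolding continuous_on_def
proof
  fix y :: 'a
  have p: "r + dist x y > 0" using r by (simp add: add_pos_nonneg)
  have lim: "((\<lambda>z. B * (dist y z / (r + dist x y)) powr \<beta> * bump M x r \<gamma> y) \<longlongrightarrow> B * (dist y y / (r + dist x y)) powr \<beta> * bump M x r \<gamma> y) (at y)"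
    using r p by (intro tendsto_intros tendsto_powr') auto
  have "eventually (\<lambda>z. z \<in> ball y ((r + dist x y) / 2)) (at y)"
    using p eventually_at_ball[of "(r + dist x y) / 2" y UNIV] by auto
  then have ev: "eventually (\<lambda>z. norm (f z - f y) \<le> B * (dist y z / (r + dist x y)) powr \<beta> * bump M x r \<gamma> y) (at y)"
    by eventually_elim (use test_boundD2[OF f, of y] in \<open>simp add: abs_minus_commute\<close>)
  have "((\<lambda>z. f z - f y) \<longlongrightarrow> 0) (at y)"
    by (rule Lim_null_comparison[OF ev]) (use lim r in simp)
  then show "(f \<longlongrightarrow> f y) (at y within UNIV)" by (simp add: LIM_zero_iff)
qed

end

section \<open>Cutoffs and integrals of bumps\<close>

text \<open>Lipschitz at the scale of test functions centred at \<open>z\<close> with radius \<rho>.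
  The centre is a parameter because one cutoff is multiplied with test functions centred at other
  points than its own.\<close>

definition multiplier :: "('a::metric_space \<Rightarrow> real) \<Rightarrow> 'a \<Rightarrow> real \<Rightarrow> bool" where
  "multiplier \<eta> z \<rho> \<longleftrightarrow> (\<forall>y. 0 \<le> \<eta> y \<and> \<eta> y \<le> 1) \<and>
     (\<forall>y y'. dist y y' \<le> (\<rho> + dist z y) / 2 \<longrightarrow> \<bar>\<eta> y - \<eta> y'\<bar> \<le> 8 * (dist y y' / (\<rho> + dist z y)))"

lemma multiplier_mono:
  assumes "multiplier \<eta> z \<rho>'" "0 < \<rho>" "\<rho> \<le> \<rho>'"
  shows "multiplier \<eta> z \<rho>"
  unfolding multiplier_def
proof (intro conjI allI impI)
  fix y y' assume d: "dist y y' \<le> (\<rho> + dist z y) / 2"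
  then have "dist y y' \<le> (\<rho>' + dist z y) / 2" using assms by simp
  then have "\<bar>\<eta> y - \<eta> y'\<bar> \<le> 8 * (dist y y' / (\<rho>' + dist z y))" using assms unfolding multiplier_def by blast
  also have "\<dots> \<le> 8 * (dist y y' / (\<rho> + dist z y))"
    using assms add_dist_pos[of \<rho> z y] by (intro mult_left_mono frac_le) auto
  finally show "\<bar>\<eta> y - \<eta> y'\<bar> \<le> 8 * (dist y y' / (\<rho> + dist z y))" .
qed (use assms in \<open>auto simp: multiplier_def\<close>)

definition cutoff :: "'a::metric_space \<Rightarrow> real \<Rightarrow> 'a \<Rightarrow> real" where
  "cutoff x \<rho> y = max 0 (min 1 (2 - dist x y / \<rho>))"

lemma cutoff_eq_1: "\<rho> > 0 \<Longrightarrow> dist x y \<le> \<rho> \<Longrightarrow> cutoff x \<rho> y = 1"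
  and cutoff_eq_0: "\<rho> > 0 \<Longrightarrow> 2 * \<rho> \<le> dist x y \<Longrightarrow> cutoff x \<rho> y = 0"
  and cutoff_bounds: "0 \<le> cutoff x \<rho> y" "cutoff x \<rho> y \<le> 1"
  by (auto simp: cutoff_def max_def min_def field_simps)

lemma cutoff_lipschitz:
  assumes "\<rho> > 0" shows "\<bar>cutoff x \<rho> y - cutoff x \<rho> y'\<bar> \<le> dist y y' / \<rho>"
proof -
  have "\<bar>dist x y - dist x y'\<bar> \<le> dist y y'"
    using dist_triangle[of x y y'] dist_triangle[of x y' y] by (simp add: dist_commute abs_le_iff)
  then have "\<bar>dist x y / \<rho> - dist x y' / \<rho>\<bar> \<le> dist y y' / \<rho>"
    using assms by (simp add: diff_divide_distrib[symmetric] divide_right_mono)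
  then show ?thesis unfolding cutoff_def by linarith
qed

lemma cutoff_multiplier:
  assumes "\<rho> > 0" "dist x z \<le> \<rho>"
  shows "multiplier (cutoff x \<rho>) z \<rho>" "multiplier (\<lambda>y. 1 - cutoff x \<rho> y) z \<rho>"
proof -
  have *: "\<bar>cutoff x \<rho> y - cutoff x \<rho> y'\<bar> \<le> 8 * (dist y y' / (\<rho> + dist z y))"
    if d: "dist y y' \<le> (\<rho> + dist z y) / 2" for y y'
  proof (cases "2 * \<rho> \<le> dist x y \<and> 2 * \<rho> \<le> dist x y'")
    case True then show ?thesis using assms add_dist_pos[of \<rho> z y] by (simp add: cutoff_eq_0)
  next
    case False
    have "dist z y \<le> dist x z + dist x y" using dist_triangle[of z y x] by (simp add: dist_commute)
    moreover have "dist x y \<le> dist x y' + dist y y'" using dist_triangle[of x y y'] by (simp add: dist_commute)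
    \<comment> \<open>One of the two points has distance below \<open>2 * \<rho>\<close> from
      \<open>x\<close>. With the bound on \<open>dist y y'\<close> this forces
      \<open>dist z y \<le> 7 * \<rho>\<close>, the source of the constant 8.\<close>
    ultimately have "\<rho> + dist z y \<le> 8 * \<rho>" using False d assms zero_le_dist[of z y] by argo
    then have "dist y y' * (\<rho> + dist z y) \<le> dist y y' * (8 * \<rho>)" by (intro mult_left_mono) auto
    then have "dist y y' / \<rho> \<le> 8 * (dist y y' / (\<rho> + dist z y))"
      using assms add_dist_pos[of \<rho> z y] by (simp add: field_simps)
    with cutoff_lipschitz[OF assms(1), of x y y'] show ?thesis by linarith
  qed
  show "multiplier (cutoff x \<rho>) z \<rho>" unfolding multiplier_def using * cutoff_bounds by auto
  have "\<bar>(1 - cutoff x \<rho> y) - (1 - cutoff x \<rho> y')\<bar> = \<bar>cutoff x \<rho> y - cutoff x \<rho> y'\<bar>" for y y' by simp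
  then show "multiplier (\<lambda>y. 1 - cutoff x \<rho> y) z \<rho>" unfolding multiplier_def
    using * cutoff_bounds[of x \<rho>] by simp
qed

lemma le_powr_self: "0 \<le> a \<Longrightarrow> a \<le> 1 \<Longrightarrow> \<beta> \<le> 1 \<Longrightarrow> a \<le> a powr (\<beta>::real)"
  using powr_mono'[of \<beta> 1 a] by simp

section \<open>Products of test functions with cutoffs\<close>

context doubling_measure
begin

text \<open>Product rule: the bound 1 of the multiplier and its Lipschitz constant 8 add up to 9. A
  Lipschitz quotient at most 1 is below its own power \<beta>, which is where
  \<open>\<beta> \<le> 1\<close> enters.\<close>

lemma test_bound_mult:
  assumes r: "0 < r" "r \<le> \<rho>" "\<beta> \<le> 1" and f: "test_bound M z r \<beta> \<gamma> f B" and \<eta>: "multiplier \<eta> z \<rho>"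
  shows "test_bound M z r \<beta> \<gamma> (\<lambda>y. \<eta> y * f y) (9 * B)"
proof (rule test_boundI)
  note B = test_bound_nonneg[OF r(1) f]
  fix y
  have b: "0 \<le> \<eta> y" "\<eta> y \<le> 1" for y using \<eta> by (auto simp: multiplier_def)
  have "\<bar>\<eta> y * f y\<bar> \<le> 1 * \<bar>f y\<bar>" unfolding abs_mult using b by (intro mult_right_mono) auto
  also have "\<dots> \<le> B * bump M z r \<gamma> y" using test_boundD1[OF f] by simp
  also have "\<dots> \<le> 9 * B * bump M z r \<gamma> y" using B bump_nonneg[OF r(1), of z \<gamma> y] by (intro mult_right_mono) auto
  finally show "\<bar>\<eta> y * f y\<bar> \<le> 9 * B * bump M z r \<gamma> y" .
  fix y' assume d: "dist y y' \<le> (r + dist z y) / 2"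
  let ?w = "bump M z r \<gamma> y" and ?q = "dist y y' / (r + dist z y)"
  have p: "r + dist z y > 0" using r add_dist_pos by auto
  have q: "0 \<le> ?q" "?q \<le> 1" using d p by (auto simp: divide_le_eq_1)
  have "dist y y' \<le> (\<rho> + dist z y) / 2" using d r by simp
  then have "\<bar>\<eta> y - \<eta> y'\<bar> \<le> 8 * (dist y y' / (\<rho> + dist z y))" using \<eta> by (simp add: multiplier_def)
  also have "\<dots> \<le> 8 * ?q" using r p by (intro mult_left_mono frac_le) auto
  also have "\<dots> \<le> 8 * ?q powr \<beta>" using le_powr_self[OF q r(3)] by simp
  finally have 1: "\<bar>\<eta> y - \<eta> y'\<bar> \<le> 8 * ?q powr \<beta>" .
  have "\<eta> y * f y - \<eta> y' * f y' = \<eta> y' * (f y - f y') + (\<eta> y - \<eta> y') * f y" by algebra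
  then have "\<bar>\<eta> y * f y - \<eta> y' * f y'\<bar> \<le> \<eta> y' * \<bar>f y - f y'\<bar> + \<bar>\<eta> y - \<eta> y'\<bar> * \<bar>f y\<bar>"
    using b[of y'] by (metis abs_mult abs_of_nonneg abs_triangle_ineq)
  also have "\<dots> \<le> 1 * (B * ?q powr \<beta> * ?w) + (8 * ?q powr \<beta>) * (B * ?w)"
    using b[of y'] test_boundD2[OF f d] test_boundD1[OF f, of y] 1
    by (intro add_mono mult_mono) auto
  also have "\<dots> = 9 * B * ?q powr \<beta> * ?w" by algebra
  finally show "\<bar>\<eta> y * f y - \<eta> y' * f y'\<bar> \<le> 9 * B * ?q powr \<beta> * ?w" .
qed

text \<open>A product that vanishes within \<rho> of \<open>z\<close> lives where
  \<open>r + dist z y\<close> and \<open>\<rho> + dist z y\<close> are comparable, and there the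
  bump of scale \<open>r\<close> is of order \<open>(r / \<rho>) powr \<gamma>\<close> times the
  bump of scale \<rho>. A tail is therefore a test function of the larger scale with a small
  norm.\<close>

lemma test_bound_mult_tail:
  assumes r: "0 < r" "r \<le> \<rho>" "0 \<le> \<beta>" "\<beta> \<le> 1" "0 \<le> \<gamma>"
    and f: "test_bound M z r \<beta> \<gamma> f B" and \<eta>: "multiplier \<eta> z \<rho>"
    and zero: "\<And>y. dist z y \<le> \<rho> \<Longrightarrow> \<eta> y = 0"
  shows "test_bound M z \<rho> \<beta> \<gamma> (\<lambda>y. \<eta> y * f y) (9 * Kb \<gamma> * (4 + 8 * (1 + Kb \<gamma>)) * (r / \<rho>) powr \<gamma> * B)"
proof -
  note B = test_bound_nonneg[OF r(1) f]
  have \<rho>: "\<rho> > 0" using r by auto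
  have K: "Kb \<gamma> \<ge> 1" using Kb_ge r by auto
  have f': "test_bound M z r \<beta> \<gamma> (\<lambda>y. \<eta> y * f y) (9 * B)"
    by (rule test_bound_mult[OF r(1,2,4) f \<eta>])
  have up: "bump M z r \<gamma> y \<le> Kb \<gamma> * (r / \<rho>) powr \<gamma> * bump M z \<rho> \<gamma> y" if "\<rho> / 2 \<le> dist z y" for y
  proof -
    have le: "\<rho> + dist z y \<le> 4 * (r + dist z y)" using that r by simp
    have "bump M z r \<gamma> y \<le> (4 * (r / \<rho>)) powr \<gamma> * (C1 * 4 powr n) * bump M z \<rho> \<gamma> y"
      using r \<rho> le mult_left_mono[OF le, of r] by (intro bump_compare) auto
    also have "(4 * (r / \<rho>)) powr \<gamma> = 4 powr \<gamma> * (r / \<rho>) powr \<gamma>" by (rule powr_mult)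
    finally show ?thesis by (simp add: Kb_def mult_ac)
  qed
  define A where "A = 9 * Kb \<gamma> * (r / \<rho>) powr \<gamma> * B"
  have A: "A \<ge> 0" unfolding A_def using K B by auto
  have "test_bound M z \<rho> \<beta> \<gamma> (\<lambda>y. \<eta> y * f y) (4 * A + (1 + Kb \<gamma>) * (2 * 4) powr \<beta> * A)"
  proof (rule test_bound_extend)
    fix y show "\<bar>\<eta> y * f y\<bar> \<le> A * bump M z \<rho> \<gamma> y"
    proof (cases "dist z y \<le> \<rho>")
      case True then show ?thesis using zero A bump_nonneg[OF \<rho>] by simp
    next
      case False
      then have "\<rho> / 2 \<le> dist z y" using \<rho> by simp
      from mult_left_mono[OF up[OF this], of "9 * B"] test_boundD1[OF f', of y] B
      show ?thesis by (simp add: A_def mult_ac)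
    qed
  next
    fix y y' assume d: "dist y y' \<le> (\<rho> + dist z y) / (2 * 4)"
    show "\<bar>\<eta> y * f y - \<eta> y' * f y'\<bar> \<le> 4 * A * (dist y y' / (\<rho> + dist z y)) powr \<beta> * bump M z \<rho> \<gamma> y"
    \<comment> \<open>For \<open>y\<close> within \<open>\<rho> / 2\<close> of \<open>z\<close>, the
      restricted range of distances keeps \<open>y'\<close> within \<rho>, so the product vanishes
      at both points.\<close>
    proof (cases "\<rho> / 2 \<le> dist z y")
      case True
      then have le: "\<rho> + dist z y \<le> 4 * (r + dist z y)" using r by simp
      then have d2: "dist y y' \<le> (r + dist z y) / 2" using d by simp
      have ps: "r + dist z y > 0" "\<rho> + dist z y > 0" using r \<rho> by (auto simp: add_dist_pos)
      have "dist y y' / (r + dist z y) \<le> 4 * (dist y y' / (\<rho> + dist z y))"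
        using ps mult_left_mono[OF le zero_le_dist[of y y']] by (simp add: field_simps)
      then have "(dist y y' / (r + dist z y)) powr \<beta> \<le> (4 * (dist y y' / (\<rho> + dist z y))) powr \<beta>"
        using r ps by (intro powr_mono2) auto
      also have "\<dots> = 4 powr \<beta> * (dist y y' / (\<rho> + dist z y)) powr \<beta>" by (rule powr_mult)
      also have "\<dots> \<le> 4 powr 1 * (dist y y' / (\<rho> + dist z y)) powr \<beta>"
        using r by (intro mult_right_mono powr_mono) auto
      finally have q: "(dist y y' / (r + dist z y)) powr \<beta> \<le> 4 * (dist y y' / (\<rho> + dist z y)) powr \<beta>" by simp
      have "\<bar>\<eta> y * f y - \<eta> y' * f y'\<bar> \<le> 9 * B * (dist y y' / (r + dist z y)) powr \<beta> * bump M z r \<gamma> y"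
        by (rule test_boundD2[OF f' d2])
      also have "\<dots> \<le> 9 * B * (4 * (dist y y' / (\<rho> + dist z y)) powr \<beta>) * (Kb \<gamma> * (r / \<rho>) powr \<gamma> * bump M z \<rho> \<gamma> y)"
        using B r True by (intro mult_mono q up bump_nonneg) auto
      finally show ?thesis by (simp add: A_def mult_ac)
    next
      case False
      have "dist z y' \<le> dist z y + dist y y'" by (rule dist_triangle)
      then have "dist z y \<le> \<rho>" "dist z y' \<le> \<rho>" using False d \<rho> by argo+
      then show ?thesis using zero A bump_nonneg[OF \<rho>] by simp
    qed
  qed (use r \<rho> A in auto)
  moreover have "4 * A + (1 + Kb \<gamma>) * (2 * 4) powr \<beta> * A \<le> 4 * A + (1 + Kb \<gamma>) * 8 powr 1 * A"
    using r K A by (intro add_left_mono mult_right_mono mult_left_mono) (auto intro: order_trans[OF powr_mono[of \<beta> 1 8]])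
  ultimately have "test_bound M z \<rho> \<beta> \<gamma> (\<lambda>y. \<eta> y * f y) (4 * A + (1 + Kb \<gamma>) * 8 powr 1 * A)"
    using test_bound_mono \<rho> by blast
  then show ?thesis by (simp add: A_def algebra_simps)
qed

text \<open>On a bounded support the factor \<open>\<rho> / (\<rho> + dist x y)\<close> is bounded
  below, so the decay exponent can be raised at a fixed cost. If one of two points is within
  \<open>4 * \<rho>\<close> and they satisfy the distance condition, then \<open>y\<close> is within
  \<open>9 * \<rho>\<close>, whence the base 10.\<close>

lemma test_bound_compact:
  assumes r: "0 < \<rho>" "0 \<le> \<gamma>" "\<gamma> \<le> \<gamma>'"
    and f: "test_bound M x \<rho> \<beta> \<gamma> f B" and supp: "\<And>y. 4 * \<rho> < dist x y \<Longrightarrow> f y = 0"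
  shows "test_bound M x \<rho> \<beta> \<gamma>' f (10 powr (\<gamma>' - \<gamma>) * B)"
proof -
  note B = test_bound_nonneg[OF r(1) f]
  have up: "bump M x \<rho> \<gamma> y \<le> 10 powr (\<gamma>' - \<gamma>) * bump M x \<rho> \<gamma>' y" if "dist x y \<le> 9 * \<rho>" for y
  proof -
    have p: "\<rho> + dist x y > 0" using r add_dist_pos by auto
    have "1 \<le> 10 * (\<rho> / (\<rho> + dist x y))" using that p by (simp add: field_simps)
    then have "1 \<le> (10 * (\<rho> / (\<rho> + dist x y))) powr (\<gamma>' - \<gamma>)" using r by (intro ge_one_powr_ge_zero) auto
    also have "\<dots> = 10 powr (\<gamma>' - \<gamma>) * (\<rho> / (\<rho> + dist x y)) powr (\<gamma>' - \<gamma>)" by (rule powr_mult)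
    finally have "1 * bump M x \<rho> \<gamma> y \<le> 10 powr (\<gamma>' - \<gamma>) * (\<rho> / (\<rho> + dist x y)) powr (\<gamma>' - \<gamma>) * bump M x \<rho> \<gamma> y"
      using bump_nonneg[OF r(1)] by (intro mult_right_mono) auto
    also have "\<dots> = 10 powr (\<gamma>' - \<gamma>) * bump M x \<rho> \<gamma>' y"
      using bump_mult_powr[OF r(1), of x y "\<gamma>' - \<gamma>" \<gamma>] by (simp add: mult.assoc)
    finally show ?thesis by simp
  qed
  show ?thesis
  proof (rule test_boundI)
    fix y show "\<bar>f y\<bar> \<le> 10 powr (\<gamma>' - \<gamma>) * B * bump M x \<rho> \<gamma>' y"
    proof (cases "4 * \<rho> < dist x y")
      case True then show ?thesis using supp B bump_nonneg[OF r(1)] by simp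
    next
      case False
      then have "dist x y \<le> 9 * \<rho>" using r by simp
      from mult_left_mono[OF up[OF this] B] test_boundD1[OF f, of y] show ?thesis by (simp add: mult_ac)
    qed
  next
    fix y y' assume d: "dist y y' \<le> (\<rho> + dist x y) / 2"
    show "\<bar>f y - f y'\<bar> \<le> 10 powr (\<gamma>' - \<gamma>) * B * (dist y y' / (\<rho> + dist x y)) powr \<beta> * bump M x \<rho> \<gamma>' y"
    proof (cases "4 * \<rho> < dist x y \<and> 4 * \<rho> < dist x y'")
      case True then show ?thesis using supp B bump_nonneg[OF r(1)] by simp
    next
      case False
      have "dist x y \<le> dist x y' + dist y y'" using dist_triangle[of x y y'] by (simp add: dist_commute)
      then have "dist x y \<le> 9 * \<rho>" using False d r by argo
      from mult_left_mono[OF up[OF this], of "B * (dist y y' / (\<rho> + dist x y)) powr \<beta>"] test_boundD2[OF f d] B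
      show ?thesis by (simp add: mult_ac)
    qed
  qed
qed

section \<open>Integration against bumps\<close>

lemma bump_measurable[measurable]: "bump M x r \<gamma> \<in> borel_measurable M"
proof -
  have 1: "(\<lambda>y. dist x y) \<in> borel_measurable M" by (intro cont_measurable continuous_intros)
  have "mono (\<lambda>t. V x t)" by (intro monoI V_mono_r)
  then have [measurable]: "(\<lambda>t. V x t) \<in> borel_measurable borel" by (rule borel_measurable_mono)
  show ?thesis unfolding bump_def using 1 by measurable
qed

definition Kint :: "real \<Rightarrow> real" where
  "Kint \<gamma> = 2 powr \<gamma> * (C1 * 2 powr n) / (1 - 2 powr (- \<gamma>))"

lemma Kint_pos: "\<gamma> > 0 \<Longrightarrow> Kint \<gamma> > 0"
proof -
  assume "\<gamma> > 0"
  then have "2 powr (-\<gamma>) < (1::real)" using powr_less_mono[of "-\<gamma>" 0 2] by simp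
  then show ?thesis unfolding Kint_def using C1_ge by simp
qed

lemma bump_le_dyadic_sum:
  assumes "r > 0" "\<gamma> > 0"
  shows "\<exists>l. bump M x r \<gamma> y \<le> 2 powr \<gamma> * (C1 * 2 powr n) * (2 powr (- \<gamma>)) ^ l / V x (2 ^ l * r) \<and> dist x y < 2 ^ l * r"
proof -
  have ex: "\<exists>l. dist x y < 2 ^ l * r"
    using real_arch_pow[of 2 "dist x y / r"] assms by (auto simp: field_simps)
  define l where "l = (LEAST l. dist x y < 2 ^ l * r)"
  have l: "dist x y < 2 ^ l * r" unfolding l_def by (rule LeastI_ex[OF ex])
  have ge: "2 ^ l * r \<le> 2 * (r + dist x y)"
  proof (cases l)
    case 0 then show ?thesis using assms by simp
  next
    case (Suc k)
    then have "\<not> dist x y < 2 ^ k * r" unfolding l_def by (metis not_less_Least lessI)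
    then show ?thesis using Suc assms by simp
  qed
  have p: "r + dist x y > 0" using assms add_dist_pos by auto
  have "r / (r + dist x y) \<le> 2 * (1 / 2 ^ l)" using ge p by (simp add: field_simps)
  then have "(r / (r + dist x y)) powr \<gamma> \<le> (2 * (1 / 2 ^ l)) powr \<gamma>"
    using assms p by (intro powr_mono2) auto
  also have "\<dots> = 2 powr \<gamma> * (1 / 2 ^ l) powr \<gamma>" by (rule powr_mult)
  also have "(1 / 2 ^ l) powr \<gamma> = (2 powr (- \<gamma>)) ^ l"
    by (simp add: powr_realpow[symmetric] powr_powr powr_minus_divide powr_divide mult.commute)
  finally have 1: "(r / (r + dist x y)) powr \<gamma> \<le> 2 powr \<gamma> * (2 powr (- \<gamma>)) ^ l" .
  have 2: "1 / V x (r + dist x y) \<le> C1 * 2 powr n / V x (2 ^ l * r)"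
    using p ge assms by (intro Vinv_change) auto
  have "bump M x r \<gamma> y = (r / (r + dist x y)) powr \<gamma> * (1 / V x (r + dist x y))" by (simp add: bump_def)
  also have "\<dots> \<le> (2 powr \<gamma> * (2 powr (- \<gamma>)) ^ l) * (C1 * 2 powr n / V x (2 ^ l * r))"
    by (intro mult_mono 1 2) auto
  finally show ?thesis using l by (intro exI[of _ l]) (simp add: mult_ac)
qed

text \<open>A bump is dominated by a combination, with geometric weights, of normalised indicators
  of the balls of radius \<open>2 ^ l * r\<close>, so its integral against \<open>h\<close> is
  controlled by the averages of \<open>h\<close> over balls around \<open>x\<close>. For
  \<open>h = 1\<close> this gives the integrability of bumps with a bound independent of
  \<open>x\<close> and \<open>r\<close>.\<close>

lemma nn_integral_bump_le:
  fixes h :: "'a \<Rightarrow> ennreal"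
  assumes r: "r > 0" "\<gamma> > 0" and [measurable]: "h \<in> borel_measurable M"
    and H: "\<And>\<rho>. \<rho> > 0 \<Longrightarrow> (\<integral>\<^sup>+z. h z * indicator (ball x \<rho>) z \<partial>M) \<le> ennreal (V x \<rho>) * H"
  shows "(\<integral>\<^sup>+y. ennreal (bump M x r \<gamma> y) * h y \<partial>M) \<le> ennreal (Kint \<gamma>) * H"
proof -
  define c where "c = 2 powr \<gamma> * (C1 * 2 powr n)"
  define q :: real where "q = 2 powr (- \<gamma>)"
  have c: "c > 0" unfolding c_def using C1_ge by simp
  have q: "0 < q" "q < 1" unfolding q_def using r powr_less_mono[of "-\<gamma>" 0 2] by auto
  define a where "a l = c * q ^ l / V x (2 ^ l * r)" for l :: nat
  have Vp: "V x (2 ^ l * r) > 0" for l using r by (intro V_pos) auto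
  have a: "a l \<ge> 0" for l unfolding a_def using c q by auto
  have pt: "ennreal (bump M x r \<gamma> y) * h y \<le> (\<Sum>l. ennreal (a l) * (h y * indicator (ball x (2 ^ l * r)) y))" for y
  proof -
    obtain l where l: "bump M x r \<gamma> y \<le> a l" "dist x y < 2 ^ l * r"
      using bump_le_dyadic_sum[OF r, of x y] by (auto simp: a_def c_def q_def)
    then have "ennreal (bump M x r \<gamma> y) * h y \<le> ennreal (a l) * (h y * indicator (ball x (2 ^ l * r)) y)"
      by (auto intro!: mult_right_mono ennreal_leI)
    also have "\<dots> = (\<Sum>l\<in>{l}. ennreal (a l) * (h y * indicator (ball x (2 ^ l * r)) y))" by simp
    also have "\<dots> \<le> (\<Sum>l. ennreal (a l) * (h y * indicator (ball x (2 ^ l * r)) y))"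
      by (intro sum_le_suminf) auto
    finally show ?thesis .
  qed
  have "(\<integral>\<^sup>+y. ennreal (bump M x r \<gamma> y) * h y \<partial>M)
     \<le> (\<integral>\<^sup>+y. (\<Sum>l. ennreal (a l) * (h y * indicator (ball x (2 ^ l * r)) y)) \<partial>M)"
    by (intro nn_integral_mono pt)
  also have "\<dots> = (\<Sum>l. ennreal (a l) * (\<integral>\<^sup>+y. h y * indicator (ball x (2 ^ l * r)) y \<partial>M))"
    by (subst nn_integral_suminf) (auto simp: nn_integral_cmult)
  also have "\<dots> \<le> (\<Sum>l. ennreal (a l) * (ennreal (V x (2 ^ l * r)) * H))"
    using r by (intro suminf_le mult_left_mono H) auto
  also have "\<dots> = (\<Sum>l. ennreal (c * q ^ l) * H)"
    using a Vp by (simp add: mult.assoc[symmetric] ennreal_mult'[symmetric] a_def less_imp_neq[OF Vp, symmetric])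
  also have "\<dots> = (\<Sum>l. ennreal (c * q ^ l)) * H" by (rule ennreal_suminf_multc)
  also have "(\<Sum>l. ennreal (c * q ^ l)) = ennreal (\<Sum>l. c * q ^ l)"
    using c q by (intro suminf_ennreal2 summable_mult summable_geometric) auto
  also have "(\<Sum>l. c * q ^ l) = Kint \<gamma>"
    using q by (simp add: suminf_mult suminf_geometric Kint_def c_def q_def)
  finally show ?thesis .
qed

lemma bump_integral:
  assumes "r > 0" "\<gamma> > 0"
  shows "integrable M (bump M x r \<gamma>)" "(\<integral>y. bump M x r \<gamma> y \<partial>M) \<le> Kint \<gamma>"
proof -
  have 1: "(\<integral>\<^sup>+y. ennreal (bump M x r \<gamma> y) * 1 \<partial>M) \<le> ennreal (Kint \<gamma>) * 1"
    using assms by (intro nn_integral_bump_le) (auto simp: emeasure_ball)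
  then have "(\<integral>\<^sup>+y. ennreal (norm (bump M x r \<gamma> y)) \<partial>M) < \<infinity>"
    using bump_nonneg[OF assms(1)] by (simp add: le_less_trans[OF _ ennreal_less_top])
  then show i: "integrable M (bump M x r \<gamma>)" by (intro integrableI_bounded) auto
  have "ennreal (\<integral>y. bump M x r \<gamma> y \<partial>M) = (\<integral>\<^sup>+y. ennreal (bump M x r \<gamma> y) \<partial>M)"
    using bump_nonneg[OF assms(1)] by (intro nn_integral_eq_integral[OF i, symmetric]) auto
  with 1 show "(\<integral>y. bump M x r \<gamma> y \<partial>M) \<le> Kint \<gamma>"
    using Kint_pos[OF assms(2)] by (simp flip: ennreal_le_iff)
qed

lemma integral_abs_le:
  fixes f g :: "'a \<Rightarrow> real"
  assumes "integrable M g" "f \<in> borel_measurable M" "\<And>z. \<bar>f z\<bar> \<le> g z"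
  shows "integrable M f" "\<bar>\<integral>z. f z \<partial>M\<bar> \<le> (\<integral>z. g z \<partial>M)"
proof -
  show i: "integrable M f"
    using assms by (intro Bochner_Integration.integrable_bound[OF assms(1)]) (auto intro: order_trans[OF assms(3) abs_ge_self])
  have "\<bar>\<integral>z. f z \<partial>M\<bar> \<le> (\<integral>z. \<bar>f z\<bar> \<partial>M)" using integral_norm_bound[of M f] by simp
  also have "\<dots> \<le> (\<integral>z. g z \<partial>M)" using assms i by (intro integral_mono) auto
  finally show "\<bar>\<integral>z. f z \<partial>M\<bar> \<le> (\<integral>z. g z \<partial>M)" .
qed

lemma test_bound_integrable:
  assumes "r > 0" "\<beta> > 0" "\<gamma> > 0" "test_bound M x r \<beta> \<gamma> f B"
  shows "integrable M f" "(\<integral>z. \<bar>f z\<bar> \<partial>M) \<le> B * Kint \<gamma>"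
proof -
  note B = test_bound_nonneg[OF assms(1,4)]
  have i: "integrable M (\<lambda>z. B * bump M x r \<gamma> z)" using bump_integral[OF assms(1,3)] by simp
  have m: "f \<in> borel_measurable M" using cont_measurable test_bound_continuous assms by blast
  show "integrable M f" by (rule integral_abs_le[OF i m]) (rule test_boundD1[OF assms(4)])
  have "\<bar>\<integral>z. \<bar>f z\<bar> \<partial>M\<bar> \<le> (\<integral>z. B * bump M x r \<gamma> z \<partial>M)"
    by (rule integral_abs_le[OF i]) (use m test_boundD1[OF assms(4)] in auto)
  also have "\<dots> \<le> B * Kint \<gamma>" using B bump_integral[OF assms(1,3)] by (auto intro: mult_left_mono)
  finally show "(\<integral>z. \<bar>f z\<bar> \<partial>M) \<le> B * Kint \<gamma>" by simp
qed

text \<open>Size and regularity are bounds on linear expressions in \<open>F z\<close>, so they pass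
  under the integral with the total mass of \<psi>. They are asked for where \<psi> does not vanish,
  so constants that are uniform on bounded sets serve for a boundedly supported \<psi>.\<close>

lemma test_bound_integral:
  assumes r: "r > 0" and i: "integrable M \<psi>" and c: "c \<ge> 0"
    and m: "\<And>y. (\<lambda>z. F z y) \<in> borel_measurable M"
    and F: "\<And>z. \<psi> z \<noteq> 0 \<Longrightarrow> test_bound M x r \<beta> \<gamma> (F z) c"
  shows "test_bound M x r \<beta> \<gamma> (\<lambda>y. \<integral>z. \<psi> z * F z y \<partial>M) (c * (\<integral>z. \<bar>\<psi> z\<bar> \<partial>M))"
    and "integrable M (\<lambda>z. \<psi> z * F z y)"
proof -
  note [measurable] = m borel_measurable_integrable[OF i]
  have pt: "\<bar>\<psi> z * F z y\<bar> \<le> c * bump M x r \<gamma> y * \<bar>\<psi> z\<bar>" for z y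
  proof (cases "\<psi> z = 0")
    case False
    from mult_left_mono[OF test_boundD1[OF F[OF False], of y], of "\<bar>\<psi> z\<bar>"]
    show ?thesis by (simp add: abs_mult mult_ac)
  qed simp
  have I: "integrable M (\<lambda>z. \<psi> z * F z y)" for y
    by (rule integral_abs_le[OF _ _ pt]) (use i in auto)
  then show "integrable M (\<lambda>z. \<psi> z * F z y)" .
  show "test_bound M x r \<beta> \<gamma> (\<lambda>y. \<integral>z. \<psi> z * F z y \<partial>M) (c * (\<integral>z. \<bar>\<psi> z\<bar> \<partial>M))"
  proof (rule test_boundI)
    fix y
    have "\<bar>\<integral>z. \<psi> z * F z y \<partial>M\<bar> \<le> (\<integral>z. c * bump M x r \<gamma> y * \<bar>\<psi> z\<bar> \<partial>M)"
      by (rule integral_abs_le(2)[OF _ _ pt]) (use i in auto)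
    then show "\<bar>\<integral>z. \<psi> z * F z y \<partial>M\<bar> \<le> c * (\<integral>z. \<bar>\<psi> z\<bar> \<partial>M) * bump M x r \<gamma> y"
      by (simp add: mult_ac)
  next
    fix y y' assume d: "dist y y' \<le> (r + dist x y) / 2"
    have pt2: "\<bar>\<psi> z * F z y - \<psi> z * F z y'\<bar>
        \<le> c * (dist y y' / (r + dist x y)) powr \<beta> * bump M x r \<gamma> y * \<bar>\<psi> z\<bar>" for z
    proof (cases "\<psi> z = 0")
      case False
      from mult_left_mono[OF test_boundD2[OF F[OF False] d], of "\<bar>\<psi> z\<bar>"]
      show ?thesis by (simp add: abs_mult[symmetric] right_diff_distrib mult_ac)
    qed simp
    have "\<bar>\<integral>z. \<psi> z * F z y - \<psi> z * F z y' \<partial>M\<bar> \<le> (\<integral>z. c * (dist y y' / (r + dist x y)) powr \<beta> * bump M x r \<gamma> y * \<bar>\<psi> z\<bar> \<partial>M)"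
      by (rule integral_abs_le(2)[OF _ _ pt2]) (use i in auto)
    then show "\<bar>(\<integral>z. \<psi> z * F z y \<partial>M) - (\<integral>z. \<psi> z * F z y' \<partial>M)\<bar>
       \<le> c * (\<integral>z. \<bar>\<psi> z\<bar> \<partial>M) * (dist y y' / (r + dist x y)) powr \<beta> * bump M x r \<gamma> y"
      using I by (simp add: mult_ac)
  qed
qed

end

section \<open>The averaging operators of an approximation of the identity\<close>

lemma dk_pos: "dk k > 0" by (simp add: dk_def)

text \<open>The kernel bounds restated with bumps: \<open>row\<close> treats \<open>S k z\<close> as
  a test function around \<open>z\<close>, \<open>reg1\<close> is regularity in the first variable,
  and the normalization is in that variable, over which \<open>T\<close> integrates; hence
  \<open>T\<close> preserves constants.\<close>

locale approx_identity = doubling_measure M C1 n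
  for M :: "'a::metric_space measure" and C1 n :: real +
  fixes S :: "int \<Rightarrow> 'a \<Rightarrow> 'a \<Rightarrow> real" and e1 e2 Ck :: real
  assumes e1: "0 < e1" "e1 \<le> 1" and e2: "0 < e2"
    and row: "test_bound M z (dk k) e1 e2 (S k z) Ck"
    and reg1: "dist z z' \<le> (dk k + dist z y) / 2 \<Longrightarrow>
       \<bar>S k z y - S k z' y\<bar> \<le> Ck * (dist z z' / (dk k + dist z y)) powr e1 * bump M z (dk k) e2 y"
    and normalized: "(\<integral>z. S k z y \<partial>M) = 1"
begin

definition T :: "int \<Rightarrow> ('a \<Rightarrow> real) \<Rightarrow> 'a \<Rightarrow> real" where
  "T k \<psi> y = (\<integral>z. \<psi> z * S k z y \<partial>M)"

lemma Ck_nonneg: "Ck \<ge> 0"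
  using test_bound_nonneg[OF dk_pos row] .

lemma S_measurable[measurable]: "(\<lambda>z. S k z y) \<in> borel_measurable M"
proof (rule cont_measurable, unfold continuous_on_def, rule ballI)
  fix z :: 'a
  have p: "dk k + dist z y > 0" using dk_pos by (rule add_dist_pos)
  have lim: "((\<lambda>z'. Ck * (dist z z' / (dk k + dist z y)) powr e1 * bump M z (dk k) e2 y)
      \<longlongrightarrow> Ck * (dist z z / (dk k + dist z y)) powr e1 * bump M z (dk k) e2 y) (at z)"
    using e1 p by (intro tendsto_intros tendsto_powr') auto
  have "eventually (\<lambda>z'. z' \<in> ball z ((dk k + dist z y) / 2)) (at z)"
    using p eventually_at_ball[of "(dk k + dist z y) / 2" z UNIV] by auto
  then have ev: "eventually (\<lambda>z'. norm (S k z' y - S k z y) \<le> Ck * (dist z z' / (dk k + dist z y)) powr e1 * bump M z (dk k) e2 y) (at z)"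
    by eventually_elim (use reg1[of z _ k y] in \<open>simp add: abs_minus_commute\<close>)
  have "((\<lambda>z'. S k z' y - S k z y) \<longlongrightarrow> 0) (at z)"
    by (rule Lim_null_comparison[OF ev]) (use lim e1 in simp)
  then show "((\<lambda>z. S k z y) \<longlongrightarrow> S k z y) (at z within UNIV)" by (simp add: LIM_zero_iff)
qed

definition C2 :: real where "C2 = Ck * Kb e2"

lemma C2_nonneg: "C2 \<ge> 0"
  unfolding C2_def using Ck_nonneg Kb_ge[of e2] e2 by auto

text \<open>The bump of the row is exchanged for a bump around \<open>y\<close>, because
  \<open>z\<close> is the variable of integration in \<open>T\<close>.\<close>

lemma S_size: "\<bar>S k z y\<bar> \<le> C2 * bump M y (dk k) e2 z"
proof -
  have "\<bar>S k z y\<bar> \<le> Ck * bump M z (dk k) e2 y" by (rule test_boundD1[OF row])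
  also have "\<dots> \<le> Ck * (Kb e2 * bump M y (dk k) e2 z)"
    using Ck_nonneg e2 dk_pos by (intro mult_left_mono bump_swap) auto
  finally show ?thesis by (simp add: C2_def mult_ac)
qed

lemma S_reg2:
  assumes d: "dist y y' \<le> (dk k + dist z y) / 2" and "\<beta> \<le> e1"
  shows "\<bar>S k z y - S k z y'\<bar> \<le> C2 * (dist y y' / (dk k + dist z y)) powr \<beta> * bump M y (dk k) e2 z"
proof -
  have p: "dk k + dist z y > 0" using dk_pos by (rule add_dist_pos)
  have "\<bar>S k z y - S k z y'\<bar> \<le> Ck * (dist y y' / (dk k + dist z y)) powr e1 * bump M z (dk k) e2 y"
    by (rule test_boundD2[OF row d])
  also have "\<dots> \<le> Ck * (dist y y' / (dk k + dist z y)) powr \<beta> * (Kb e2 * bump M y (dk k) e2 z)"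
    using Ck_nonneg e2 dk_pos bump_nonneg[OF dk_pos] d p assms(2)
    by (intro mult_mono bump_swap mult_nonneg_nonneg powr_mono') (auto simp: divide_le_eq_1)
  finally show ?thesis by (simp add: C2_def mult_ac)
qed

lemma S_integrable: "integrable M (\<lambda>z. S k z y)"
  by (rule integral_abs_le[OF _ _ S_size]) (use bump_integral[OF dk_pos e2] in auto)

lemma T_integrable:
  assumes "r > 0" "\<beta> > 0" "\<gamma> \<ge> 0" "test_bound M x r \<beta> \<gamma> \<psi> B"
  shows "integrable M (\<lambda>z. \<psi> z * S k z y)"
proof (rule integral_abs_le)
  note B = test_bound_nonneg[OF assms(1,4)]
  show "integrable M (\<lambda>z. B * (1 / V x r) * (C2 * bump M y (dk k) e2 z))"
    using bump_integral[OF dk_pos e2] by auto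
  have [measurable]: "\<psi> \<in> borel_measurable M"
    using cont_measurable test_bound_continuous assms by blast
  show "(\<lambda>z. \<psi> z * S k z y) \<in> borel_measurable M" by measurable
  fix z
  have "\<bar>\<psi> z\<bar> \<le> B * bump M x r \<gamma> z" by (rule test_boundD1[OF assms(4)])
  also have "\<dots> \<le> B * (1 / V x r)" using B assms bump_le_center by (intro mult_left_mono) auto
  finally show "\<bar>\<psi> z * S k z y\<bar> \<le> B * (1 / V x r) * (C2 * bump M y (dk k) e2 z)"
    unfolding abs_mult using S_size B V_pos[OF assms(1), of x] by (intro mult_mono) auto
qed

definition F0 :: real where "F0 = 4 powr e2 * (C1 * 8 powr n)"

lemma F0_pos: "F0 > 0" unfolding F0_def using C1_ge by simp

text \<open>With \<open>D = r + dist x y\<close>, the decay is at most a constant times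
  \<open>(s / D) powr e2\<close>, and this factors as
  \<open>(s / r) powr e2 * (r / D) powr e2\<close>. The first factor is kept as the gain
  \<open>(s / r) powr \<beta>\<close>, the second supplies the decay of the bump at
  \<open>y\<close>.\<close>

lemma bump_far:
  assumes s: "0 < s" "s \<le> r" "0 \<le> \<beta>" "0 \<le> \<gamma>" "\<beta> \<le> e2" "\<gamma> \<le> e2"
    and far: "(r + dist x y) / 4 \<le> dist z y"
  shows "bump M y s e2 z \<le> F0 * (s / r) powr \<beta> * bump M x r \<gamma> y"
proof -
  let ?D = "r + dist x y"
  have p: "?D > 0" "s + dist y z > 0" using s add_dist_pos[of r x y] add_dist_pos[of s y z] by auto
  have far': "?D \<le> 4 * (s + dist y z)" using far s by (simp add: dist_commute)
  have "s * ?D \<le> s * (4 * (s + dist y z))" using far' s by (intro mult_left_mono) auto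
  then have "s / (s + dist y z) \<le> 4 * (s / ?D)" using p by (simp add: field_simps)
  then have "(s / (s + dist y z)) powr e2 \<le> (4 * (s / ?D)) powr e2" using e2 s p by (intro powr_mono2) auto
  also have "\<dots> = 4 powr e2 * ((s / r) * (r / ?D)) powr e2" using s by (subst powr_mult) auto
  also have "\<dots> = 4 powr e2 * ((s / r) powr e2 * (r / ?D) powr e2)" by (simp only: powr_mult)
  also have "\<dots> \<le> 4 powr e2 * ((s / r) powr \<beta> * (r / ?D) powr \<gamma>)"
    using s p by (intro mult_left_mono mult_mono powr_mono') (auto simp: divide_le_eq_1)
  finally have 1: "(s / (s + dist y z)) powr e2 \<le> 4 powr e2 * ((s / r) powr \<beta> * (r / ?D) powr \<gamma>)" .
  have "?D + dist x y \<le> 2 * ?D" using s by simp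
  also have "\<dots> \<le> 8 * (s + dist y z)" using far' by simp
  finally have 2: "1 / V y (s + dist y z) \<le> C1 * 8 powr n / V x ?D"
    using p by (intro Vinv_change) auto
  have "bump M y s e2 z = (s / (s + dist y z)) powr e2 * (1 / V y (s + dist y z))" by (simp add: bump_def)
  also have "\<dots> \<le> (4 powr e2 * ((s / r) powr \<beta> * (r / ?D) powr \<gamma>)) * (C1 * 8 powr n / V x ?D)"
    by (intro mult_mono 1 2) auto
  finally show ?thesis by (simp add: F0_def bump_def mult_ac)
qed

definition KT :: "real \<Rightarrow> real \<Rightarrow> real" where
  "KT \<beta> \<gamma> = C2 * (4 * Kint (e2 - \<beta>) + F0 * Kint \<gamma>)"

text \<open>Since the kernel integrates to 1, the difference is the integral of
  \<open>(\<psi> y - \<psi> z) * S k z y\<close>. Near \<open>y\<close>, the regularity of \<psi>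
  gives a power \<beta> of the distance, which the decay of the kernel turns into a power of the
  scale; this leaves a bump of exponent \<open>e2 - \<beta>\<close>, integrable as
  \<open>\<beta> < e2\<close>. Far from \<open>y\<close> the decay of the kernel yields the gain
  without regularity.\<close>

lemma T_approx:
  assumes \<beta>: "0 < \<beta>" "\<beta> \<le> e1" "\<beta> < e2" and \<gamma>: "0 < \<gamma>" "\<gamma> \<le> e2" and s: "dk k \<le> r"
    and f: "test_bound M x r \<beta> \<gamma> \<psi> B"
  shows "\<bar>\<psi> y - T k \<psi> y\<bar> \<le> KT \<beta> \<gamma> * B * (dk k / r) powr \<beta> * bump M x r \<gamma> y"
proof -
  define s where "s = dk k"
  define D where "D = r + dist x y"
  have sp: "s > 0" "s \<le> r" "r > 0" using dk_pos[of k] assms(6) by (auto simp: s_def)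
  have Dp: "D > 0" "r \<le> D" using sp add_dist_pos[of r x y] by (auto simp: D_def)
  let ?w = "bump M x r \<gamma> y" and ?R = "(s / r) powr \<beta>"
  note B = test_bound_nonneg[OF sp(3) f]
  have w: "?w \<ge> 0" using bump_nonneg sp by auto
  define G where "G z = C2 * ?R * ?w * (4 * B * bump M y s (e2 - \<beta>) z + F0 * \<bar>\<psi> z\<bar>)" for z
  note i\<psi> = test_bound_integrable[OF sp(3) \<beta>(1) \<gamma>(1) f]
  note ib = bump_integral[OF sp(1), of "e2 - \<beta>" y]
  have iG: "integrable M G" unfolding G_def using ib i\<psi> \<beta> by auto
  have bound: "\<bar>(\<psi> y - \<psi> z) * S k z y\<bar> \<le> G z" for z
  proof (cases "dist z y \<le> D / 4")
    case True
    have "0 \<le> s + dist y z" "dist z y \<le> s + dist y z" using sp by (auto simp: dist_commute)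
    have "(dist y z / D) powr \<beta> * bump M y s e2 z \<le> ((s / r) * ((s + dist y z) / s)) powr \<beta> * bump M y s e2 z"
      using sp Dp \<beta> bump_nonneg[OF sp(1)] by (intro mult_right_mono powr_mono2) (auto intro!: frac_le)
    also have "\<dots> = ?R * (((s + dist y z) / s) powr \<beta> * bump M y s e2 z)" by (simp only: powr_mult mult.assoc)
    also have "((s + dist y z) / s) powr \<beta> = (s / (s + dist y z)) powr (- \<beta>)"
      using sp add_dist_pos[OF sp(1), of y z] by (simp add: powr_minus powr_divide)
    also have "(s / (s + dist y z)) powr (- \<beta>) * bump M y s e2 z = bump M y s (e2 - \<beta>) z"
      using bump_mult_powr[OF sp(1)] by simp
    finally have 1: "(dist y z / D) powr \<beta> * bump M y s e2 z \<le> ?R * bump M y s (e2 - \<beta>) z" .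
    have d: "dist y z \<le> (r + dist x y) / 2" using True Dp by (simp add: D_def dist_commute)
    have "\<bar>(\<psi> y - \<psi> z) * S k z y\<bar> \<le> (B * (dist y z / D) powr \<beta> * ?w) * (C2 * bump M y s e2 z)"
      unfolding abs_mult using test_boundD2[OF f d] S_size[of k z y] B w
      by (intro mult_mono) (auto simp: D_def s_def)
    also have "\<dots> = (B * C2 * ?w) * ((dist y z / D) powr \<beta> * bump M y s e2 z)" by (simp only: mult_ac)
    also have "\<dots> \<le> (B * C2 * ?w) * (?R * bump M y s (e2 - \<beta>) z)"
      using B C2_nonneg w by (intro mult_left_mono 1) auto
    also have "\<dots> = C2 * ?R * ?w * (B * bump M y s (e2 - \<beta>) z)" by (simp only: mult_ac)
    also have "\<dots> \<le> G z" unfolding G_def using B C2_nonneg w F0_pos bump_nonneg[OF sp(1)]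
      by (intro mult_left_mono) auto
    finally show ?thesis .
  next
    case False
    then have far: "(r + dist x y) / 4 \<le> dist z y" by (simp add: D_def)
    have pz: "s + dist y z > 0" using sp add_dist_pos by auto
    have "s / (s + dist y z) \<le> 4 * (s / r)"
    proof -
      have "r \<le> 4 * (s + dist y z)" using False sp Dp by (simp add: dist_commute)
      then have "s * r \<le> s * (4 * (s + dist y z))" using sp by (intro mult_left_mono) auto
      then show ?thesis using sp pz by (simp add: field_simps)
    qed
    then have "(s / (s + dist y z)) powr \<beta> \<le> (4 * (s / r)) powr \<beta>" using sp \<beta> pz by (intro powr_mono2) auto
    also have "\<dots> = 4 powr \<beta> * ?R" by (simp only: powr_mult)
    also have "\<dots> \<le> 4 powr 1 * ?R" using \<beta> e1 by (intro mult_right_mono powr_mono) auto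
    finally have "(s / (s + dist y z)) powr \<beta> * bump M y s (e2 - \<beta>) z \<le> 4 * ?R * bump M y s (e2 - \<beta>) z"
      using bump_nonneg[OF sp(1)] by (intro mult_right_mono) auto
    then have P1: "bump M y s e2 z \<le> 4 * ?R * bump M y s (e2 - \<beta>) z"
      using bump_mult_powr[OF sp(1), of y z \<beta> "e2 - \<beta>"] by simp
    have P2: "bump M y s e2 z \<le> F0 * ?R * ?w"
      using sp \<beta> \<gamma> far by (intro bump_far) auto
    have "\<bar>(\<psi> y - \<psi> z) * S k z y\<bar> \<le> (\<bar>\<psi> y\<bar> + \<bar>\<psi> z\<bar>) * (C2 * bump M y s e2 z)"
      unfolding abs_mult using S_size[of k z y] by (intro mult_mono) (auto simp: s_def)
    also have "\<dots> = C2 * (\<bar>\<psi> y\<bar> * bump M y s e2 z + \<bar>\<psi> z\<bar> * bump M y s e2 z)" by algebra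
    \<comment> \<open>The same kernel bound is used in two forms: integrable in \<open>z\<close>
      against the value at \<open>y\<close>, and uniform in \<open>z\<close> against the integrable
      function \<psi>.\<close>
    also have "\<dots> \<le> C2 * ((B * ?w) * (4 * ?R * bump M y s (e2 - \<beta>) z) + \<bar>\<psi> z\<bar> * (F0 * ?R * ?w))"
      using C2_nonneg P1 P2 B w test_boundD1[OF f, of y] bump_nonneg[OF sp(1)]
      by (intro mult_left_mono add_mono mult_mono) auto
    also have "\<dots> = G z" unfolding G_def by algebra
    finally show ?thesis .
  qed
  have eq: "\<psi> y - T k \<psi> y = (\<integral>z. (\<psi> y - \<psi> z) * S k z y \<partial>M)"
    using S_integrable[of k y] T_integrable[OF sp(3) \<beta>(1) less_imp_le[OF \<gamma>(1)] f, of k y] normalized[of k y]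
    by (simp add: left_diff_distrib T_def)
  have m: "(\<lambda>z. (\<psi> y - \<psi> z) * S k z y) \<in> borel_measurable M"
    using i\<psi> by measurable
  have "\<bar>\<psi> y - T k \<psi> y\<bar> \<le> (\<integral>z. G z \<partial>M)"
    unfolding eq by (rule integral_abs_le(2)[OF iG m bound])
  also have "\<dots> = C2 * ?R * ?w * (4 * B * (\<integral>z. bump M y s (e2 - \<beta>) z \<partial>M) + F0 * (\<integral>z. \<bar>\<psi> z\<bar> \<partial>M))"
    unfolding G_def using ib i\<psi> \<beta> by simp
  also have "\<dots> \<le> C2 * ?R * ?w * (4 * B * Kint (e2 - \<beta>) + F0 * (B * Kint \<gamma>))"
    using C2_nonneg w B ib i\<psi> \<beta> F0_pos by (intro mult_left_mono add_mono) auto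
  also have "\<dots> = KT \<beta> \<gamma> * B * ?R * ?w" unfolding KT_def by algebra
  finally show ?thesis by (simp add: s_def)
qed

definition KT2 :: "real \<Rightarrow> real" where
  "KT2 \<gamma> = C2 * (8 * Kint e2 + 4 * F0 * Kint \<gamma>)"

text \<open>Because the kernel integrates to 1, \<open>T \<psi> y - T \<psi> y'\<close> is the integral of
  \<open>(\<psi> z - \<psi> y) * (S z y - S z y')\<close>. When \<open>y\<close> and \<open>y'\<close> are too far apart for the regularity of the
  kernel, \<open>z\<close> is within \<open>2 * dist y y'\<close> of \<open>y\<close> and the regularity of \<open>\<psi>\<close> suffices.\<close>

lemma T_regular:
  assumes \<beta>: "0 < \<beta>" "\<beta> \<le> e1" "\<beta> < e2" and \<gamma>: "0 < \<gamma>" "\<gamma> \<le> e2" and s: "dk k \<le> r"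
    and f: "test_bound M x r \<beta> \<gamma> \<psi> B" and d: "dist y y' \<le> (r + dist x y) / 8"
  shows "\<bar>T k \<psi> y - T k \<psi> y'\<bar> \<le> KT2 \<gamma> * B * (dist y y' / (r + dist x y)) powr \<beta> * bump M x r \<gamma> y"
proof -
  define s where "s = dk k"
  define D where "D = r + dist x y"
  have sp: "s > 0" "s \<le> r" "r > 0" using dk_pos[of k] assms(6) by (auto simp: s_def)
  have Dp: "D > 0" "r \<le> D" using sp add_dist_pos[of r x y] by (auto simp: D_def)
  let ?w = "bump M x r \<gamma> y" and ?R = "(dist y y' / D) powr \<beta>"
  note B = test_bound_nonneg[OF sp(3) f]
  have w: "?w \<ge> 0" using bump_nonneg sp by auto
  have R: "?R \<ge> 0" by simp
  define P where "P y z = bump M y s e2 z" for y z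
  have P: "P y z \<ge> 0" for y z using bump_nonneg sp by (auto simp: P_def)
  define G where "G z = C2 * ?R * ?w * (4 * B * (P y z + P y' z) + 4 * F0 * \<bar>\<psi> z\<bar>)" for z
  note i\<psi> = test_bound_integrable[OF sp(3) \<beta>(1) \<gamma>(1) f]
  have ib: "integrable M (P y)" "(\<integral>z. P y z \<partial>M) \<le> Kint e2" for y
    using bump_integral[OF sp(1) e2] by (auto simp: P_def[abs_def])
  have iG: "integrable M G" unfolding G_def using ib i\<psi> by auto
  have four: "(4::real) powr \<beta> \<le> 4" using \<beta> e1 by (auto intro: order_trans[OF powr_mono[of \<beta> 1 4]])
  have two: "(2::real) powr \<beta> \<le> 2" using \<beta> e1 by (auto intro: order_trans[OF powr_mono[of \<beta> 1 2]])
  have Sz: "\<bar>S k z y\<bar> \<le> C2 * P y z" for z y using S_size by (simp add: P_def s_def)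
  have pz: "s + dist z y > 0" for z using sp add_dist_pos by auto
  have CRw: "C2 * ?R * ?w \<ge> 0" using C2_nonneg w by auto
  have d': "dist y y' \<le> D / 8" using d by (simp add: D_def)
  have bound: "\<bar>(\<psi> z - \<psi> y) * (S k z y - S k z y')\<bar> \<le> G z" for z
  proof (cases "dist z y \<le> D / 4")
    case True
    have dz: "dist y z \<le> (r + dist x y) / 2" using True Dp by (simp add: D_def dist_commute)
    have \<psi>d: "\<bar>\<psi> z - \<psi> y\<bar> \<le> B * (dist z y / D) powr \<beta> * ?w"
      using test_boundD2[OF f dz] by (simp add: D_def dist_commute abs_minus_commute)
    show ?thesis
    proof (cases "dist y y' \<le> (s + dist z y) / 2")
      case close: True
      \<comment> \<open>Both regularities are used at once: the distance \<open>dist z y\<close>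
        contributed by \<psi> is absorbed by \<open>s + dist z y\<close> in the kernel, leaving
        \<open>dist y y' / D\<close>.\<close>
      have "dist z y / D * (dist y y' / (s + dist z y)) = dist y y' / D * (dist z y / (s + dist z y))"
        by simp
      also have "\<dots> \<le> dist y y' / D * 1"
        using Dp sp pz[of z] by (intro mult_left_mono) (auto simp: divide_le_eq_1)
      finally have "dist z y / D * (dist y y' / (s + dist z y)) \<le> dist y y' / D" by simp
      then have "(dist z y / D * (dist y y' / (s + dist z y))) powr \<beta> \<le> ?R"
        using \<beta> Dp pz[of z] by (intro powr_mono2) auto
      then have q: "(dist z y / D) powr \<beta> * (dist y y' / (s + dist z y)) powr \<beta> \<le> ?R" by (simp only: powr_mult)
      have "\<bar>(\<psi> z - \<psi> y) * (S k z y - S k z y')\<bar>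
         \<le> (B * (dist z y / D) powr \<beta> * ?w) * (C2 * (dist y y' / (s + dist z y)) powr \<beta> * P y z)"
        unfolding abs_mult using \<psi>d S_reg2[of y y' k z \<beta>] close \<beta> B w
        by (intro mult_mono) (auto simp: P_def s_def)
      also have "\<dots> = (B * ?w * C2 * P y z) * ((dist z y / D) powr \<beta> * (dist y y' / (s + dist z y)) powr \<beta>)"
        by (simp only: mult_ac)
      also have "\<dots> \<le> (B * ?w * C2 * P y z) * ?R"
        using B w C2_nonneg P by (intro mult_left_mono q) auto
      also have "\<dots> = C2 * ?R * ?w * (B * P y z)" by (simp only: mult_ac)
      also have "\<dots> \<le> G z" unfolding G_def using B P[of y z] P[of y' z] F0_pos
        by (intro mult_left_mono[OF _ CRw] add_increasing2 mult_mono) auto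
      finally show ?thesis .
    next
      case False
      then have "dist z y / D \<le> 2 * (dist y y' / D)" using sp Dp by (simp add: field_simps)
      then have "(dist z y / D) powr \<beta> \<le> (2 * (dist y y' / D)) powr \<beta>" using \<beta> Dp by (intro powr_mono2) auto
      also have "\<dots> = 2 powr \<beta> * ?R" by (rule powr_mult)
      also have "\<dots> \<le> 2 * ?R" using two by (intro mult_right_mono) auto
      finally have q: "(dist z y / D) powr \<beta> \<le> 2 * ?R" .
      have "\<bar>\<psi> z - \<psi> y\<bar> \<le> B * (2 * ?R) * ?w"
        by (rule order_trans[OF \<psi>d]) (use B w q in \<open>intro mult_right_mono mult_left_mono; simp\<close>)
      moreover have "\<bar>S k z y - S k z y'\<bar> \<le> C2 * P y z + C2 * P y' z"
        using Sz[of z y] Sz[of z y'] by linarith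
      ultimately have "\<bar>(\<psi> z - \<psi> y) * (S k z y - S k z y')\<bar> \<le> (B * (2 * ?R) * ?w) * (C2 * P y z + C2 * P y' z)"
        unfolding abs_mult using B w by (intro mult_mono) auto
      also have "\<dots> = C2 * ?R * ?w * (2 * B * (P y z + P y' z))" by algebra
      also have "\<dots> \<le> G z" unfolding G_def using B P[of y z] P[of y' z] F0_pos
        by (intro mult_left_mono[OF _ CRw] add_increasing2 mult_right_mono) auto
      finally show ?thesis .
    qed
  next
    case False
    then have far: "(r + dist x y) / 4 \<le> dist z y" by (simp add: D_def)
    \<comment> \<open>From \<open>dist y y' \<le> D / 8\<close> and \<open>dist z y > D / 4\<close>:
      for every far \<open>z\<close> the kernel is regular between \<open>y\<close> and
      \<open>y'\<close>.\<close>
    have close: "dist y y' \<le> (dk k + dist z y) / 2" using False d' sp by (simp add: s_def)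
    have "D \<le> 4 * (s + dist z y)" using False sp by simp
    then have "dist y y' * D \<le> dist y y' * (4 * (s + dist z y))" by (intro mult_left_mono) auto
    then have "dist y y' / (s + dist z y) \<le> 4 * (dist y y' / D)"
      using Dp pz[of z] by (simp add: field_simps)
    then have "(dist y y' / (s + dist z y)) powr \<beta> \<le> (4 * (dist y y' / D)) powr \<beta>"
      using \<beta> Dp pz[of z] by (intro powr_mono2) auto
    also have "\<dots> = 4 powr \<beta> * ?R" by (rule powr_mult)
    also have "\<dots> \<le> 4 * ?R" using four by (intro mult_right_mono) auto
    finally have q: "(dist y y' / (s + dist z y)) powr \<beta> \<le> 4 * ?R" .
    have "P y z \<le> F0 * (s / r) powr \<beta> * ?w"
      unfolding P_def using sp \<beta> \<gamma> far by (intro bump_far) auto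
    also have "\<dots> \<le> F0 * 1 * ?w" using F0_pos sp \<beta> w
      by (intro mult_right_mono mult_left_mono powr_le1) auto
    finally have P2: "P y z \<le> F0 * ?w" by simp
    have "\<bar>S k z y - S k z y'\<bar> \<le> C2 * (4 * ?R) * P y z"
      using S_reg2[OF close \<beta>(2)] mult_right_mono[OF mult_left_mono[OF q C2_nonneg] P[of y z]]
      by (simp add: P_def s_def)
    then have "\<bar>(\<psi> z - \<psi> y) * (S k z y - S k z y')\<bar> \<le> (\<bar>\<psi> z\<bar> + \<bar>\<psi> y\<bar>) * (C2 * (4 * ?R) * P y z)"
      unfolding abs_mult by (intro mult_mono) auto
    also have "\<dots> = C2 * ?R * 4 * (\<bar>\<psi> z\<bar> * P y z + \<bar>\<psi> y\<bar> * P y z)" by algebra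
    also have "\<dots> \<le> C2 * ?R * 4 * (\<bar>\<psi> z\<bar> * (F0 * ?w) + (B * ?w) * P y z)"
      using C2_nonneg P2 B w test_boundD1[OF f, of y] P
      by (intro mult_left_mono add_mono mult_right_mono) auto
    also have "\<dots> = C2 * ?R * ?w * (4 * B * P y z + 4 * F0 * \<bar>\<psi> z\<bar>)" by algebra
    also have "\<dots> \<le> G z" unfolding G_def using B P[of y z] P[of y' z] F0_pos
      by (intro mult_left_mono[OF _ CRw] add_mono mult_mono) auto
    finally show ?thesis .
  qed
  have iT: "integrable M (\<lambda>z. \<psi> z * S k z y)" for y
    by (rule T_integrable[OF sp(3) \<beta>(1) less_imp_le[OF \<gamma>(1)] f])
  have "(\<integral>z. (\<psi> z - \<psi> y) * (S k z y - S k z y') \<partial>M)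
      = (\<integral>z. (\<psi> z * S k z y - \<psi> z * S k z y') - \<psi> y * (S k z y - S k z y') \<partial>M)"
    by (intro Bochner_Integration.integral_cong) (auto simp: algebra_simps)
  also have "\<dots> = T k \<psi> y - T k \<psi> y'"
    using S_integrable iT normalized by (simp add: T_def)
  finally have eq: "T k \<psi> y - T k \<psi> y' = (\<integral>z. (\<psi> z - \<psi> y) * (S k z y - S k z y') \<partial>M)" ..
  have m: "(\<lambda>z. (\<psi> z - \<psi> y) * (S k z y - S k z y')) \<in> borel_measurable M"
    using i\<psi> by measurable
  have "\<bar>T k \<psi> y - T k \<psi> y'\<bar> \<le> (\<integral>z. G z \<partial>M)"
    unfolding eq by (rule integral_abs_le(2)[OF iG m bound])
  also have "\<dots> = C2 * ?R * ?w * (4 * B * ((\<integral>z. P y z \<partial>M) + (\<integral>z. P y' z \<partial>M)) + 4 * F0 * (\<integral>z. \<bar>\<psi> z\<bar> \<partial>M))"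
    unfolding G_def using ib i\<psi> by simp
  also have "\<dots> \<le> C2 * ?R * ?w * (4 * B * (Kint e2 + Kint e2) + 4 * F0 * (B * Kint \<gamma>))"
    using B ib i\<psi> F0_pos by (intro mult_left_mono[OF _ CRw] add_mono mult_left_mono) auto
  also have "\<dots> = KT2 \<gamma> * B * ?R * ?w" unfolding KT2_def by algebra
  finally show ?thesis by (simp add: D_def)
qed

text \<open>One constant for both conclusions of \<open>T_remainder\<close>:
  \<open>1 + KT2 \<gamma>\<close> for the regularity, the middle term for extending its range, and
  one more \<open>KT \<beta> \<gamma>\<close> for the size.\<close>

definition KR :: "real \<Rightarrow> real \<Rightarrow> real" where
  "KR \<beta> \<gamma> = (1 + KT2 \<gamma>) + ((1 + Kb \<gamma>) * (2 * 4) powr \<beta> + 1) * KT \<beta> \<gamma>"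

lemma KT_nonneg:
  assumes "0 < \<gamma>" shows "\<beta> < e2 \<Longrightarrow> 0 \<le> KT \<beta> \<gamma>" "0 \<le> KT2 \<gamma>"
  unfolding KT_def KT2_def using C2_nonneg F0_pos Kint_pos[OF assms] Kint_pos[OF e2] Kint_pos[of "e2 - \<beta>"] assms
  by (auto intro!: mult_nonneg_nonneg add_nonneg_nonneg)

lemma KR_ge:
  assumes "0 < \<gamma>" "\<beta> < e2" shows "KR \<beta> \<gamma> \<ge> 1" "KR \<beta> \<gamma> \<ge> KT \<beta> \<gamma>"
proof -
  note K = KT_nonneg(1)[OF assms] KT_nonneg(2)[OF assms(1)] Kb_ge[OF less_imp_le[OF assms(1)]]
  have "0 \<le> (1 + Kb \<gamma>) * (2 * 4) powr \<beta> * KT \<beta> \<gamma>" using K by auto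
  moreover have "KR \<beta> \<gamma> = 1 + KT2 \<gamma> + (1 + Kb \<gamma>) * (2 * 4) powr \<beta> * KT \<beta> \<gamma> + KT \<beta> \<gamma>"
    unfolding KR_def by (simp add: algebra_simps)
  ultimately show "KR \<beta> \<gamma> \<ge> 1" "KR \<beta> \<gamma> \<ge> KT \<beta> \<gamma>" using K by linarith+
qed

text \<open>The regularity estimate for \<open>T k\<close> covers distances up to an eighth of the
  natural radius. The remaining distances are filled in by \<open>test_bound_extend\<close> from the
  size estimate, whose gain is given up there.\<close>

lemma T_remainder:
  assumes \<beta>: "0 < \<beta>" "\<beta> \<le> e1" "\<beta> < e2" and \<gamma>: "0 < \<gamma>" "\<gamma> \<le> e2" and s: "dk k \<le> r"
    and f: "test_bound M x r \<beta> \<gamma> \<psi> B"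
  shows "\<bar>\<psi> y - T k \<psi> y\<bar> \<le> KR \<beta> \<gamma> * B * (dk k / r) powr \<beta> * bump M x r \<gamma> y"
    and "test_bound M x r \<beta> \<gamma> (\<lambda>y. \<psi> y - T k \<psi> y) (KR \<beta> \<gamma> * B)"
proof -
  have sp: "r > 0" using dk_pos[of k] s by linarith
  note B = test_bound_nonneg[OF sp f]
  note K = KT_nonneg(1)[OF \<gamma>(1) \<beta>(3)] KT_nonneg(2)[OF \<gamma>(1)] KR_ge[OF \<gamma>(1) \<beta>(3)]
  have "KT \<beta> \<gamma> * (B * (dk k / r) powr \<beta> * bump M x r \<gamma> y) \<le> KR \<beta> \<gamma> * (B * (dk k / r) powr \<beta> * bump M x r \<gamma> y)"
    using B bump_nonneg[OF sp] by (intro mult_right_mono K) auto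
  then show "\<bar>\<psi> y - T k \<psi> y\<bar> \<le> KR \<beta> \<gamma> * B * (dk k / r) powr \<beta> * bump M x r \<gamma> y"
    using T_approx[OF assms, of y] by (simp add: mult_ac)
  have "test_bound M x r \<beta> \<gamma> (\<lambda>y. \<psi> y - T k \<psi> y) ((1 + KT2 \<gamma>) * B + (1 + Kb \<gamma>) * (2 * 4) powr \<beta> * (KT \<beta> \<gamma> * B))"
  proof (rule test_bound_extend)
    fix y
    have "KT \<beta> \<gamma> * B * (dk k / r) powr \<beta> * bump M x r \<gamma> y \<le> KT \<beta> \<gamma> * B * 1 * bump M x r \<gamma> y"
      using B K bump_nonneg[OF sp] s dk_pos[of k] sp \<beta> by (intro mult_right_mono mult_left_mono powr_le1) auto
    then show "\<bar>\<psi> y - T k \<psi> y\<bar> \<le> KT \<beta> \<gamma> * B * bump M x r \<gamma> y" using T_approx[OF assms, of y] by simp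
  next
    fix y y' assume d: "dist y y' \<le> (r + dist x y) / (2 * 4)"
    have "\<bar>\<psi> y - \<psi> y'\<bar> \<le> B * (dist y y' / (r + dist x y)) powr \<beta> * bump M x r \<gamma> y"
      using d add_dist_pos[OF sp, of x y] by (intro test_boundD2[OF f]) (simp add: field_simps)
    moreover have "\<bar>T k \<psi> y - T k \<psi> y'\<bar> \<le> KT2 \<gamma> * B * (dist y y' / (r + dist x y)) powr \<beta> * bump M x r \<gamma> y"
      using d by (intro T_regular[OF assms]) simp
    ultimately show "\<bar>\<psi> y - T k \<psi> y - (\<psi> y' - T k \<psi> y')\<bar> \<le> (1 + KT2 \<gamma>) * B * (dist y y' / (r + dist x y)) powr \<beta> * bump M x r \<gamma> y"
      by (simp add: algebra_simps)
  qed (use sp \<gamma> \<beta> B K in auto)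
  then show "test_bound M x r \<beta> \<gamma> (\<lambda>y. \<psi> y - T k \<psi> y) (KR \<beta> \<gamma> * B)"
    by (rule test_bound_mono[OF sp]) (use K B in \<open>simp add: KR_def algebra_simps\<close>)
qed

end

section \<open>Functionals and integral averages\<close>

context doubling_measure
begin

text \<open>A \<delta>-separated subset of maximal cardinality is a cover. The cardinality is
  bounded because the balls of radius \<open>\<delta> / 2\<close> around its points are disjoint,
  lie in the ball of radius \<open>\<rho> + \<delta>\<close>, and each carries at least the fraction
  \<open>1 / K\<close> of its measure.\<close>

lemma totally_bounded_ball:
  fixes x :: 'a
  assumes "\<delta> > 0" shows "\<exists>F. finite F \<and> ball x \<rho> \<subseteq> (\<Union>c\<in>F. ball c \<delta>)"
proof (cases "\<rho> > 0")
  case False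
  then have "ball x \<rho> = {}" by auto
  then show ?thesis by (intro exI[of _ "{}"]) simp
next
  case True
  define sep where "sep F \<longleftrightarrow> finite F \<and> F \<subseteq> ball x \<rho> \<and> (\<forall>a\<in>F. \<forall>b\<in>F. a \<noteq> b \<longrightarrow> \<delta> \<le> dist a b)" for F
  define K where "K = C1 * ((2 * \<rho> + \<delta>) / (\<delta> / 2)) powr n"
  have "1 \<le> (2 * \<rho> + \<delta>) / (\<delta> / 2)" using assms True by (simp add: field_simps)
  then have K1: "K \<ge> 1" unfolding K_def using C1_ge n_pos by (intro mult_ge_one ge_one_powr_ge_zero) auto
  have card: "real (card F) \<le> K" if F: "sep F" for F
  proof -
    have fin: "finite F" using F by (simp add: sep_def)
    have "V x (\<rho> + \<delta>) \<le> K * V c (\<delta> / 2)" if "c \<in> F" for c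
      unfolding K_def using assms True that F by (intro V_change) (auto simp: sep_def subset_eq field_simps)
    then have "(\<Sum>c\<in>F. V x (\<rho> + \<delta>) / K) \<le> (\<Sum>c\<in>F. V c (\<delta> / 2))"
      using K1 by (intro sum_mono) (simp add: field_simps)
    also have "\<dots> = measure M (\<Union>c\<in>F. ball c (\<delta> / 2))"
    proof (rule measure_finite_Union[symmetric])
      show "disjoint_family_on (\<lambda>c. ball c (\<delta> / 2)) F"
        unfolding disjoint_family_on_def
      proof (intro ballI impI)
        fix a b assume "a \<in> F" "b \<in> F" "a \<noteq> b"
        then have "\<delta> \<le> dist a b" using F by (simp add: sep_def)
        then show "ball a (\<delta> / 2) \<inter> ball b (\<delta> / 2) = {}"
          by (intro disjoint_ballI) simp
      qed
    qed (use fin in \<open>auto simp: emeasure_ball\<close>)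
    also have "\<dots> \<le> V x (\<rho> + \<delta>)"
    proof (rule measure_mono_fmeasurable)
      show "(\<Union>c\<in>F. ball c (\<delta> / 2)) \<subseteq> ball x (\<rho> + \<delta>)"
      proof
        fix z assume "z \<in> (\<Union>c\<in>F. ball c (\<delta> / 2))"
        then obtain c where "c \<in> F" "dist c z < \<delta> / 2" by auto
        moreover have "dist x c < \<rho>" using F \<open>c \<in> F\<close> by (auto simp: sep_def)
        ultimately show "z \<in> ball x (\<rho> + \<delta>)" using dist_triangle[of x z c] assms by auto
      qed
    qed (use fin in \<open>auto simp: fmeasurable_def emeasure_ball\<close>)
    finally have "real (card F) * V x (\<rho> + \<delta>) \<le> K * V x (\<rho> + \<delta>)" using K1 by (simp add: field_simps)
    moreover have "V x (\<rho> + \<delta>) > 0" using assms True by (intro V_pos) auto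
    ultimately show ?thesis by (simp add: mult_le_cancel_right)
  qed
  have "sep {}" by (simp add: sep_def)
  moreover have "\<forall>F. sep F \<longrightarrow> card F < nat \<lceil>K\<rceil> + 1"
  proof (intro allI impI)
    fix F assume "sep F"
    then have "real (card F) \<le> real (nat \<lceil>K\<rceil>)" using card real_nat_ceiling_ge[of K] by (blast intro: order_trans)
    then show "card F < nat \<lceil>K\<rceil> + 1" by simp
  qed
  ultimately obtain F where F: "sep F" "\<And>F'. sep F' \<Longrightarrow> card F' \<le> card F"
    using ex_has_greatest_nat[of sep "{}" card] by blast
  have "ball x \<rho> \<subseteq> (\<Union>c\<in>F. ball c \<delta>)"
  proof
    fix z assume z: "z \<in> ball x \<rho>"
    show "z \<in> (\<Union>c\<in>F. ball c \<delta>)"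
    proof (rule ccontr)
      assume neg: "z \<notin> (\<Union>c\<in>F. ball c \<delta>)"
      then have far: "\<And>c. c \<in> F \<Longrightarrow> \<delta> \<le> dist c z" by (auto simp: not_less)
      then have "z \<notin> F" using assms by force
      moreover have "sep (insert z F)" using F(1) z far by (auto simp: sep_def dist_commute)
      ultimately show False using F(2)[of "insert z F"] F(1) by (simp add: sep_def)
    qed
  qed
  then show ?thesis using F(1) by (auto simp: sep_def)
qed

lemma Vxy_bounds:
  assumes "r > 0"
  shows "Vr M r x + Vxy M x y \<le> 2 * V x (r + dist x y)"
    and "V x (r + dist x y) \<le> C1 * 2 powr n * (Vr M r x + Vxy M x y)"
    and "Vr M r x + Vxy M x y > 0"
proof -
  have "V x r \<le> V x (r + dist x y)" "V x (dist x y) \<le> V x (r + dist x y)"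
    using assms by (auto intro: V_mono_r)
  then show "Vr M r x + Vxy M x y \<le> 2 * V x (r + dist x y)" by (simp add: Vr_def Vxy_def)
  define m where "m = max r (dist x y)"
  have "V x (r + dist x y) \<le> C1 * 2 powr n * V x m"
    using assms by (intro V_change) (auto simp: m_def)
  also have "V x m \<le> Vr M r x + Vxy M x y" by (simp add: m_def max_def Vr_def Vxy_def)
  finally show "V x (r + dist x y) \<le> C1 * 2 powr n * (Vr M r x + Vxy M x y)"
    using C1_ge by (simp add: mult_left_mono)
  show "Vr M r x + Vxy M x y > 0" using V_pos[OF assms, of x] by (simp add: Vr_def Vxy_def add_pos_nonneg)
qed

lemma bump_G:
  assumes "r > 0"
  shows "1 / (Vr M r x + Vxy M x y) * (r / (r + dist x y)) powr \<gamma>' \<le> C1 * 2 powr n * bump M x r \<gamma>' y"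
    and "bump M x r \<gamma>' y \<le> 2 * (1 / (Vr M r x + Vxy M x y) * (r / (r + dist x y)) powr \<gamma>')"
proof -
  note v = Vxy_bounds[OF assms, of x y] and p = V_pos[OF add_dist_pos[OF assms, of x y], of x]
  have "1 / (Vr M r x + Vxy M x y) \<le> C1 * 2 powr n / V x (r + dist x y)" using v p by (simp add: field_simps)
  from mult_right_mono[OF this, of "(r / (r + dist x y)) powr \<gamma>'"]
  show "1 / (Vr M r x + Vxy M x y) * (r / (r + dist x y)) powr \<gamma>' \<le> C1 * 2 powr n * bump M x r \<gamma>' y"
    by (simp add: bump_def)
  have "1 / V x (r + dist x y) \<le> 2 * (1 / (Vr M r x + Vxy M x y))" using v p by (simp add: field_simps)
  from mult_right_mono[OF this, of "(r / (r + dist x y)) powr \<gamma>'"]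
  show "bump M x r \<gamma>' y \<le> 2 * (1 / (Vr M r x + Vxy M x y) * (r / (r + dist x y)) powr \<gamma>')"
    by (simp add: bump_def)
qed

lemma G_bound_test_bound:
  assumes "r > 0" "G_bound M x r \<beta>' \<gamma>' f C"
  shows "test_bound M x r \<beta>' \<gamma>' f (C1 * 2 powr n * C)"
proof (rule test_boundI)
  have C: "C \<ge> 0" using assms(2) by (simp add: G_bound_def)
  fix y
  have "\<bar>f y\<bar> \<le> C * (1 / (Vr M r x + Vxy M x y) * (r / (r + dist x y)) powr \<gamma>')"
    using assms(2) by (simp add: G_bound_def mult.assoc)
  also have "\<dots> \<le> C * (C1 * 2 powr n * bump M x r \<gamma>' y)" using C by (intro mult_left_mono bump_G assms)
  finally show "\<bar>f y\<bar> \<le> C1 * 2 powr n * C * bump M x r \<gamma>' y" by (simp add: mult_ac)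
  fix z assume "dist y z \<le> (r + dist x y) / 2"
  then have "\<bar>f y - f z\<bar> \<le> (C * (dist y z / (r + dist x y)) powr \<beta>') * (1 / (Vr M r x + Vxy M x y) * (r / (r + dist x y)) powr \<gamma>')"
    using assms(2) by (simp add: G_bound_def mult.assoc abs_minus_commute[of "f y"])
  also have "\<dots> \<le> (C * (dist y z / (r + dist x y)) powr \<beta>') * (C1 * 2 powr n * bump M x r \<gamma>' y)"
    using C by (intro mult_left_mono bump_G assms) auto
  finally show "\<bar>f y - f z\<bar> \<le> C1 * 2 powr n * C * (dist y z / (r + dist x y)) powr \<beta>' * bump M x r \<gamma>' y"
    by (simp add: mult_ac)
qed

lemma test_bound_G_bound:
  assumes "r > 0" "test_bound M x r \<beta>' \<gamma>' f B"
  shows "G_bound M x r \<beta>' \<gamma>' f (2 * B)"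
  unfolding G_bound_def
proof (intro conjI allI impI)
  note B = test_bound_nonneg[OF assms]
  show "0 \<le> 2 * B" using B by simp
  fix y
  have "\<bar>f y\<bar> \<le> B * bump M x r \<gamma>' y" by (rule test_boundD1[OF assms(2)])
  also have "\<dots> \<le> B * (2 * (1 / (Vr M r x + Vxy M x y) * (r / (r + dist x y)) powr \<gamma>'))"
    using B by (intro mult_left_mono bump_G assms)
  finally show "\<bar>f y\<bar> \<le> 2 * B * (1 / (Vr M r x + Vxy M x y)) * (r / (r + dist x y)) powr \<gamma>'" by (simp add: mult_ac)
  fix z assume d: "dist y z \<le> (r + dist x y) / 2"
  have "\<bar>f z - f y\<bar> \<le> B * (dist y z / (r + dist x y)) powr \<beta>' * bump M x r \<gamma>' y"
    using test_boundD2[OF assms(2) d] by (simp add: abs_minus_commute)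
  also have "\<dots> \<le> B * (dist y z / (r + dist x y)) powr \<beta>' * (2 * (1 / (Vr M r x + Vxy M x y) * (r / (r + dist x y)) powr \<gamma>'))"
    using B by (intro mult_left_mono bump_G assms) auto
  finally show "\<bar>f z - f y\<bar> \<le> 2 * B * (dist y z / (r + dist x y)) powr \<beta>' * (1 / (Vr M r x + Vxy M x y)) * (r / (r + dist x y)) powr \<gamma>'"
    by (simp add: mult_ac)
qed

lemma G_norm_le: "G_bound M x r \<beta>' \<gamma>' f C \<Longrightarrow> G_norm M x r \<beta>' \<gamma>' f \<le> C"
  unfolding G_norm_def by (rule cInf_lower) (auto simp: bdd_below_def G_bound_def)

lemma G_norm_nonneg: "f \<in> G_set M x r \<beta>' \<gamma>' \<Longrightarrow> 0 \<le> G_norm M x r \<beta>' \<gamma>' f"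
  unfolding G_norm_def by (rule cInf_greatest) (auto simp: G_set_def G_bound_def)

lemma G_norm_less: 
  assumes "f \<in> G_set M x r \<beta>' \<gamma>'" "G_norm M x r \<beta>' \<gamma>' f < c"
  shows "\<exists>C<c. G_bound M x r \<beta>' \<gamma>' f C"
  using cInf_lessD[of "{C. G_bound M x r \<beta>' \<gamma>' f C}" c] assms unfolding G_norm_def G_set_def by auto

text \<open>The product of the constants of \<open>test_bound_center\<close> and
  \<open>test_bound_scale_up\<close>, with the power of the ratio of scales split off.\<close>

definition Kmove :: "real \<Rightarrow> real \<Rightarrow> real" where
  "Kmove \<beta> \<gamma> = (2 powr \<beta> * Kb \<gamma> * (1 + (1 + Kb \<gamma>) * 2 powr \<beta>)) * (C1 * (1 + (1 + Kb \<gamma>) * 2 powr \<beta>))"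

lemma Kmove_pos: "0 \<le> \<beta> \<Longrightarrow> 0 \<le> \<gamma> \<Longrightarrow> Kmove \<beta> \<gamma> > 0"
  unfolding Kmove_def using Kb_ge[of \<gamma>] C1_ge by (intro mult_pos_pos add_pos_nonneg) auto

lemma test_bound_move:
  assumes "0 < s" "s \<le> R" "dist x z \<le> R" "0 \<le> \<beta>" "0 \<le> \<gamma>" "test_bound M z s \<beta> \<gamma> f B"
  shows "test_bound M x R \<beta> \<gamma> f (Kmove \<beta> \<gamma> * (R / s) powr (n + \<beta>) * B)"
  using test_bound_center[OF less_le_trans[OF assms(1,2)] assms(4,5,3)
      test_bound_scale_up[OF assms(1,2,4,5,6)]]
  by (simp add: Kmove_def mult_ac)

end

context approx_identity
begin

text \<open>Interpolates between the regularity of the kernel in its first and in its second variable.\<close>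

lemma kernel_difference:
  assumes "0 < \<beta>" "\<beta> < e1"
  shows "\<exists>C\<ge>0. \<forall>k z z'. dist z z' \<le> dk k / 2 \<longrightarrow>
     test_bound M z (dk k) \<beta> e2 (\<lambda>y. S k z y - S k z' y) (C * (dist z z' / dk k) powr (e1 - \<beta>))"
proof -
  define Kc where "Kc = 2 powr e1 * Kb e2 * (1 + (1 + Kb e2) * 2 powr e1)"
  define B1 where "B1 = Ck + Kc * Ck"
  \<comment> \<open>The interpolation weight that turns regularity \<open>e1\<close> into \<beta>;
    the rest of the exponent, \<open>e1 * (1 - t) = e1 - \<beta>\<close>, goes to
    \<open>dist z z'\<close>.\<close>
  define t where "t = \<beta> / e1"
  define C where "C = Ck + ((1 + Kb e2) * Ck) powr (1 - t) * B1 powr t"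
  have "test_bound M z (dk k) \<beta> e2 (\<lambda>y. S k z y - S k z' y) (C * (dist z z' / dk k) powr (e1 - \<beta>))"
    if d: "dist z z' \<le> dk k / 2" for k z z'
  proof -
    define q where "q = dist z z' / dk k"
    have q: "0 \<le> q" "q \<le> 1" using d dk_pos[of k] by (auto simp: q_def field_simps)
    have "dist z z' \<le> dk k" using d dk_pos[of k] by linarith
    then have "test_bound M z (dk k) e1 e2 (S k z') (Kc * Ck)"
      unfolding Kc_def using e1 e2 dk_pos row by (intro test_bound_center) auto
    from test_bound_diff[OF row this]
    have tb: "test_bound M z (dk k) e1 e2 (\<lambda>y. S k z y - S k z' y) B1" by (simp add: B1_def)
    have size: "\<bar>S k z y - S k z' y\<bar> \<le> Ck * q powr e1 * bump M z (dk k) e2 y" for y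
    proof -
      have "\<bar>S k z y - S k z' y\<bar> \<le> Ck * (dist z z' / (dk k + dist z y)) powr e1 * bump M z (dk k) e2 y"
        using d by (intro reg1) (simp add: add_increasing2)
      also have "\<dots> \<le> Ck * q powr e1 * bump M z (dk k) e2 y"
        unfolding q_def using Ck_nonneg e1 dk_pos[of k] bump_nonneg[OF dk_pos]
        by (intro mult_right_mono mult_left_mono powr_mono2 frac_le divide_nonneg_nonneg) auto
      finally show ?thesis .
    qed
    have "test_bound M z (dk k) \<beta> e2 (\<lambda>y. S k z y - S k z' y)
       (Ck * q powr e1 + ((1 + Kb e2) * (Ck * q powr e1)) powr (1 - t) * B1 powr t)"
      unfolding t_def by (rule test_bound_interp[OF dk_pos _ _ _ _ tb size]) (use e2 assms Ck_nonneg in auto)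
    moreover have "Ck * q powr e1 + ((1 + Kb e2) * (Ck * q powr e1)) powr (1 - t) * B1 powr t \<le> C * q powr (e1 - \<beta>)"
    proof -
      have 1: "Ck * q powr e1 \<le> Ck * q powr (e1 - \<beta>)"
        using Ck_nonneg q assms by (intro mult_left_mono powr_mono') auto
      have "((1 + Kb e2) * (Ck * q powr e1)) powr (1 - t) = ((1 + Kb e2) * Ck) powr (1 - t) * (q powr e1) powr (1 - t)"
        by (simp only: mult.assoc[symmetric] powr_mult)
      also have "(q powr e1) powr (1 - t) = q powr (e1 - \<beta>)"
        using e1 by (simp add: powr_powr t_def right_diff_distrib)
      finally show ?thesis using 1 by (simp add: C_def algebra_simps)
    qed
    ultimately show ?thesis using test_bound_mono[OF dk_pos] by (simp add: q_def)
  qed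
  moreover have "C \<ge> 0" unfolding C_def using Ck_nonneg by auto
  ultimately show ?thesis by blast
qed

end

section \<open>Functionals on the completed class of test functions\<close>

locale hardy_params = approx_identity M C1 n S e1 e2 Ck
  for M :: "'a::metric_space measure" and C1 n S e1 e2 Ck +
  fixes x1 :: 'a and \<epsilon> \<beta> \<gamma> :: real
  assumes params: "0 < \<beta>" "\<beta> < \<epsilon>" "0 < \<gamma>" "\<gamma> < \<epsilon>" "\<epsilon> < e1" "\<epsilon> < e2"
begin

abbreviation "dual \<equiv> G0_dual M x1 \<epsilon> \<beta> \<gamma>"

text \<open>The dense subspace on which the estimates are proved before the passage to the
  completion. It contains the rows of the kernels and the iterated remainders, and it does not
  depend on centre and scale.\<close>

definition smooth :: "('a \<Rightarrow> real) \<Rightarrow> bool" where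
  "smooth \<phi> \<longleftrightarrow> (\<exists>B. test_bound M x1 1 \<epsilon> \<epsilon> \<phi> B)"

lemma smoothI:
  assumes "r > 0" "test_bound M x r \<epsilon> \<epsilon> \<phi> B" shows "smooth \<phi>"
  using test_bound_change[of 1 r \<epsilon> \<epsilon> x x1] assms params unfolding smooth_def by fastforce

lemma smoothD:
  assumes "r > 0" "smooth \<phi>" shows "\<exists>B\<ge>0. test_bound M x r \<epsilon> \<epsilon> \<phi> B"
proof -
  obtain B where "test_bound M x1 1 \<epsilon> \<epsilon> \<phi> B" using assms by (auto simp: smooth_def)
  moreover obtain C where "\<forall>f B. test_bound M x1 1 \<epsilon> \<epsilon> f B \<longrightarrow> test_bound M x r \<epsilon> \<epsilon> f (C * B)"
    using test_bound_change[of r 1 \<epsilon> \<epsilon> x1 x] assms params by auto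
  ultimately have "test_bound M x r \<epsilon> \<epsilon> \<phi> (C * B)" by blast
  then show ?thesis using test_bound_nonneg[OF assms(1)] by blast
qed

lemma smooth_diff: "smooth \<phi> \<Longrightarrow> smooth \<psi> \<Longrightarrow> smooth (\<lambda>y. \<phi> y - \<psi> y)"
  unfolding smooth_def using test_bound_diff by blast

lemma smooth_scale: "smooth \<phi> \<Longrightarrow> smooth (\<lambda>y. c * \<phi> y)"
  unfolding smooth_def using test_bound_scale by blast

lemma smooth_G_set: "smooth \<phi> \<Longrightarrow> \<phi> \<in> G_set M x1 1 \<epsilon> \<epsilon>"
  unfolding smooth_def G_set_def using test_bound_G_bound[of 1] by fastforce

lemma G_set_smooth: "\<phi> \<in> G_set M x1 1 \<epsilon> \<epsilon> \<Longrightarrow> smooth \<phi>"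
  unfolding smooth_def G_set_def using G_bound_test_bound[of 1] by fastforce

lemma smooth_test_bound:
  assumes "r > 0" "smooth \<phi>" shows "\<exists>B. test_bound M x r \<beta> \<gamma> \<phi> B"
  using smoothD[OF assms, of x] test_bound_weaken[OF assms(1), of \<beta> \<epsilon> \<gamma> \<epsilon>] params by fastforce

lemma smooth_G0:
  assumes "smooth \<phi>" shows "\<phi> \<in> G0 M x1 \<epsilon> \<beta> \<gamma>"
proof -
  have "\<phi> \<in> G_set M x1 1 \<beta> \<gamma>"
    unfolding G_set_def using smooth_test_bound[OF _ assms, of 1 x1] test_bound_G_bound[of 1] by fastforce
  moreover have "G_bound M x1 1 \<beta> \<gamma> (\<lambda>y. \<phi> y - \<phi> y) 0" by (simp add: G_bound_def)
  then have "G_norm M x1 1 \<beta> \<gamma> (\<lambda>y. \<phi> y - \<phi> y) \<le> 0" by (rule G_norm_le)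
  ultimately show ?thesis unfolding G0_def using smooth_G_set[OF assms] by force
qed

lemma dual_linear:
  assumes "L \<in> dual" "smooth \<phi>" "smooth \<psi>"
  shows "L (\<lambda>y. \<phi> y + \<psi> y) = L \<phi> + L \<psi>" "L (\<lambda>y. \<phi> y - \<psi> y) = L \<phi> - L \<psi>" "L (\<lambda>y. c * \<phi> y) = c * L \<phi>"
proof -
  have *: "L (\<lambda>y. a * \<phi> y + b * \<psi> y) = a * L \<phi> + b * L \<psi>" for a b
    using assms smooth_G0 unfolding G0_dual_def by blast
  show "L (\<lambda>y. \<phi> y + \<psi> y) = L \<phi> + L \<psi>" using *[of 1 1] by simp
  show "L (\<lambda>y. \<phi> y - \<psi> y) = L \<phi> - L \<psi>" using *[of 1 "-1"] by simp
  show "L (\<lambda>y. c * \<phi> y) = c * L \<phi>" using *[of c 0] by simp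
qed

lemma dual_zero: "L \<in> dual \<Longrightarrow> L (\<lambda>y. 0) = 0"
proof -
  assume L: "L \<in> dual"
  have "test_bound M x1 1 \<epsilon> \<epsilon> (\<lambda>y. 0) 0" by (simp add: test_bound_def)
  then have "smooth (\<lambda>y. 0)" unfolding smooth_def by blast
  from dual_linear(3)[OF L this this, of 0] show ?thesis by simp
qed

lemma dual_bounded1:
  assumes "L \<in> dual"
  shows "\<exists>C\<ge>0. \<forall>\<phi>\<in>G0 M x1 \<epsilon> \<beta> \<gamma>. \<forall>B. test_bound M x1 1 \<beta> \<gamma> \<phi> B \<longrightarrow> \<bar>L \<phi>\<bar> \<le> C * B"
proof -
  obtain C where C: "\<And>\<phi>. \<phi> \<in> G0 M x1 \<epsilon> \<beta> \<gamma> \<Longrightarrow> \<bar>L \<phi>\<bar> \<le> C * G_norm M x1 1 \<beta> \<gamma> \<phi>"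
    using assms unfolding G0_dual_def by blast
  have "\<bar>L \<phi>\<bar> \<le> (2 * \<bar>C\<bar>) * B" if \<phi>: "\<phi> \<in> G0 M x1 \<epsilon> \<beta> \<gamma>" "test_bound M x1 1 \<beta> \<gamma> \<phi> B" for \<phi> B
  proof -
    have g: "0 \<le> G_norm M x1 1 \<beta> \<gamma> \<phi>" using \<phi>(1) by (intro G_norm_nonneg) (simp add: G0_def)
    have "\<bar>L \<phi>\<bar> \<le> C * G_norm M x1 1 \<beta> \<gamma> \<phi>" by (rule C[OF \<phi>(1)])
    also have "\<dots> \<le> \<bar>C\<bar> * G_norm M x1 1 \<beta> \<gamma> \<phi>" using g by (intro mult_right_mono) auto
    also have "\<dots> \<le> \<bar>C\<bar> * (2 * B)"
      using G_norm_le[OF test_bound_G_bound[OF _ \<phi>(2)]] by (intro mult_left_mono) auto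
    finally show ?thesis by simp
  qed
  then show ?thesis by (intro exI[of _ "2 * \<bar>C\<bar>"]) auto
qed

text \<open>The constant depends on the functional, on \<open>x\<close> and on \<open>r\<close>. It
  serves finiteness and convergence and does not enter the final constants.\<close>

lemma dual_bounded:
  assumes "L \<in> dual" "r > 0"
  shows "\<exists>C\<ge>0. \<forall>\<phi>\<in>G0 M x1 \<epsilon> \<beta> \<gamma>. \<forall>B. test_bound M x r \<beta> \<gamma> \<phi> B \<longrightarrow> \<bar>L \<phi>\<bar> \<le> C * B"
proof -
  obtain C where C: "C \<ge> 0" "\<And>\<phi> B. \<phi> \<in> G0 M x1 \<epsilon> \<beta> \<gamma> \<Longrightarrow> test_bound M x1 1 \<beta> \<gamma> \<phi> B \<Longrightarrow> \<bar>L \<phi>\<bar> \<le> C * B"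
    using dual_bounded1[OF assms(1)] by auto
  obtain C' where C': "C' > 0" "\<And>f B. test_bound M x r \<beta> \<gamma> f B \<Longrightarrow> test_bound M x1 1 \<beta> \<gamma> f (C' * B)"
    using test_bound_change[of 1 r \<beta> \<gamma> x x1] assms params by auto
  show ?thesis using C C' by (intro exI[of _ "C * C'"]) (auto simp: mult.assoc)
qed

lemma row_weak: "\<beta>' \<le> e1 \<Longrightarrow> \<gamma>' \<le> e2 \<Longrightarrow> test_bound M z (dk k) \<beta>' \<gamma>' (S k z) Ck"
  using test_bound_weaken[OF dk_pos _ _ row] .

lemma smooth_S: "smooth (S k z)"
  using smoothI[OF dk_pos row_weak] params by auto

text \<open>Uniform in \<open>z\<close> over a ball, with a constant depending on \<open>k\<close>
  and the radius. In \<open>exchange\<close> both are fixed before the mesh of the Riemann sums is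
  chosen.\<close>

lemma S_difference_uniform:
  assumes "\<rho> > 0"
  shows "\<exists>C\<ge>0. \<forall>z z'. dist x z \<le> \<rho> \<longrightarrow> dist z z' \<le> dk k / 2 \<longrightarrow>
    test_bound M x1 1 \<beta> \<gamma> (\<lambda>y. S k z y - S k z' y) (C * (dist z z' / dk k) powr (e1 - \<beta>))"
proof -
  have "\<beta> < e1" using params by auto
  then obtain C where C: "C \<ge> 0" "\<And>z z'. dist z z' \<le> dk k / 2 \<Longrightarrow>
     test_bound M z (dk k) \<beta> e2 (\<lambda>y. S k z y - S k z' y) (C * (dist z z' / dk k) powr (e1 - \<beta>))"
    using kernel_difference[of \<beta>] params by blast
  define R where "R = max (dk k) \<rho>"
  have R: "dk k \<le> R" "\<rho> \<le> R" "R > 0" using assms by (auto simp: R_def)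
  obtain C' where C': "C' > 0" "\<And>f B. test_bound M x R \<beta> \<gamma> f B \<Longrightarrow> test_bound M x1 1 \<beta> \<gamma> f (C' * B)"
    using test_bound_change[of 1 R \<beta> \<gamma> x x1] R params by auto
  define D where "D = C' * (Kmove \<beta> \<gamma> * (R / dk k) powr (n + \<beta>)) * C"
  have "D \<ge> 0" unfolding D_def using C C' Kmove_pos[of \<beta> \<gamma>] params by auto
  moreover have "test_bound M x1 1 \<beta> \<gamma> (\<lambda>y. S k z y - S k z' y) (D * (dist z z' / dk k) powr (e1 - \<beta>))"
    if "dist x z \<le> \<rho>" "dist z z' \<le> dk k / 2" for z z'
  proof -
    have "test_bound M z (dk k) \<beta> \<gamma> (\<lambda>y. S k z y - S k z' y) (C * (dist z z' / dk k) powr (e1 - \<beta>))"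
      using test_bound_weaken[OF dk_pos _ _ C(2)[OF that(2)]] params by auto
    from C'(2)[OF test_bound_move[OF dk_pos R(1) _ _ _ this, of x]] show ?thesis
      using that R params by (simp add: D_def mult_ac)
  qed
  ultimately show ?thesis by blast
qed

lemma S_uniform:
  assumes "\<rho> > 0"
  shows "\<exists>C\<ge>0. \<forall>z. dist x z \<le> \<rho> \<longrightarrow> test_bound M x1 1 \<epsilon> \<epsilon> (S k z) C"
proof -
  define R where "R = max (dk k) \<rho>"
  have R: "dk k \<le> R" "\<rho> \<le> R" "R > 0" using assms by (auto simp: R_def)
  obtain C' where C': "C' > 0" "\<And>f B. test_bound M x R \<epsilon> \<epsilon> f B \<Longrightarrow> test_bound M x1 1 \<epsilon> \<epsilon> f (C' * B)"
    using test_bound_change[of 1 R \<epsilon> \<epsilon> x x1] R params by auto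
  define D where "D = C' * (Kmove \<epsilon> \<epsilon> * (R / dk k) powr (n + \<epsilon>) * Ck)"
  have "D \<ge> 0" unfolding D_def using Ck_nonneg C' Kmove_pos[of \<epsilon> \<epsilon>] params by auto
  moreover have "test_bound M x1 1 \<epsilon> \<epsilon> (S k z) D" if "dist x z \<le> \<rho>" for z
    unfolding D_def
    by (rule C'(2)[OF test_bound_move[OF dk_pos R(1) _ _ _ row_weak]]) (use params R that in auto)
  ultimately show ?thesis by blast
qed

text \<open>In the norm for which \<open>L\<close> is continuous, differences of rows are of order
  \<open>(dist z z' / dk k) powr (e1 - \<beta>)\<close>, which tends to 0 since
  \<open>\<beta> < e1\<close>. The measurability of the radial maximal function rests on
  this.\<close>

lemma continuous_dual_S:
  assumes L: "L \<in> dual" shows "continuous_on UNIV (\<lambda>z. L (S k z))"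
  unfolding continuous_on_def
proof
  fix z :: 'a
  obtain C where C: "C \<ge> 0" "\<And>z'. dist z z' \<le> dk k / 2 \<Longrightarrow>
    test_bound M x1 1 \<beta> \<gamma> (\<lambda>y. S k z y - S k z' y) (C * (dist z z' / dk k) powr (e1 - \<beta>))"
    using S_difference_uniform[of 1 z k] by force
  obtain B where B: "B \<ge> 0" "\<And>\<phi> b. \<phi> \<in> G0 M x1 \<epsilon> \<beta> \<gamma> \<Longrightarrow> test_bound M x1 1 \<beta> \<gamma> \<phi> b \<Longrightarrow> \<bar>L \<phi>\<bar> \<le> B * b"
    using dual_bounded1[OF L] by auto
  have lim: "((\<lambda>z'. B * (C * (dist z z' / dk k) powr (e1 - \<beta>))) \<longlongrightarrow> B * (C * (dist z z / dk k) powr (e1 - \<beta>))) (at z)"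
    using params dk_pos[of k] by (intro tendsto_intros tendsto_powr') auto
  have "eventually (\<lambda>z'. z' \<in> ball z (dk k / 2)) (at z)"
    using dk_pos[of k] eventually_at_ball[of "dk k / 2" z UNIV] by auto
  then have ev: "eventually (\<lambda>z'. norm (L (S k z') - L (S k z)) \<le> B * (C * (dist z z' / dk k) powr (e1 - \<beta>))) (at z)"
  proof eventually_elim
    case (elim z')
    then have "\<bar>L (\<lambda>y. S k z y - S k z' y)\<bar> \<le> B * (C * (dist z z' / dk k) powr (e1 - \<beta>))"
      by (intro B smooth_G0 smooth_diff smooth_S C) auto
    then show ?case using dual_linear(2)[OF L smooth_S smooth_S] by (simp add: abs_minus_commute)
  qed
  have "((\<lambda>z'. L (S k z') - L (S k z)) \<longlongrightarrow> 0) (at z)"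
    by (rule Lim_null_comparison[OF ev]) (use lim params in simp)
  then show "((\<lambda>z. L (S k z)) \<longlongrightarrow> L (S k z)) (at z within UNIV)" by (simp add: LIM_zero_iff)
qed

text \<open>Bounded support makes the rows involved uniform test functions at the fixed centre
  \<open>x1\<close>, so their superposition stays in the dense subspace.\<close>

lemma smooth_T:
  assumes "\<rho> > 0" "integrable M \<psi>" "\<And>z. \<rho> < dist x z \<Longrightarrow> \<psi> z = 0"
  shows "smooth (T k \<psi>)"
proof -
  obtain C where C: "C \<ge> 0" "\<And>z. dist x z \<le> \<rho> \<Longrightarrow> test_bound M x1 1 \<epsilon> \<epsilon> (S k z) C"
    using S_uniform[OF assms(1)] by blast
  have "test_bound M x1 1 \<epsilon> \<epsilon> (\<lambda>y. \<integral>z. \<psi> z * S k z y \<partial>M) (C * (\<integral>z. \<bar>\<psi> z\<bar> \<partial>M))"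
  proof (rule test_bound_integral(1)[OF _ assms(2) C(1) S_measurable])
    fix z assume "\<psi> z \<noteq> 0"
    then have "dist x z \<le> \<rho>" using assms(3)[of z] by force
    then show "test_bound M x1 1 \<epsilon> \<epsilon> (S k z) C" by (rule C)
  qed simp
  then show ?thesis unfolding smooth_def T_def[abs_def] by blast
qed

lemma T_integrable':
  assumes "\<rho> > 0" "integrable M \<psi>" "\<And>z. \<rho> < dist x z \<Longrightarrow> \<psi> z = 0"
  shows "integrable M (\<lambda>z. \<psi> z * S k z y)"
proof -
  obtain C where C: "C \<ge> 0" "\<And>z. dist x z \<le> \<rho> \<Longrightarrow> test_bound M x1 1 \<epsilon> \<epsilon> (S k z) C"
    using S_uniform[OF assms(1)] by blast
  show ?thesis
  proof (rule test_bound_integral(2)[OF _ assms(2) C(1) S_measurable])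
    fix z assume "\<psi> z \<noteq> 0"
    then have "dist x z \<le> \<rho>" using assms(3)[of z] by force
    then show "test_bound M x1 1 \<epsilon> \<epsilon> (S k z) C" by (rule C)
  qed simp
qed

text \<open>The functional \<open>L\<close> is only defined on functions, so it is moved under the integral by Riemann
  sums: on a bounded set, \<open>S k z\<close> varies little in the norm of test functions over small cells.\<close>

lemma exchange:
  assumes L: "L \<in> dual" and \<rho>: "\<rho> > 0" and i: "integrable M \<psi>" and supp: "\<And>z. \<rho> \<le> dist x z \<Longrightarrow> \<psi> z = 0"
  shows "integrable M (\<lambda>z. \<bar>\<psi> z\<bar> * \<bar>L (S k z)\<bar>)"
    and "\<bar>L (T k \<psi>)\<bar> \<le> (\<integral>z. \<bar>\<psi> z\<bar> * \<bar>L (S k z)\<bar> \<partial>M)"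
proof -
  define g where "g z = \<bar>L (S k z)\<bar>" for z
  have mg[measurable]: "g \<in> borel_measurable M"
    unfolding g_def by (intro cont_measurable continuous_intros continuous_dual_S L)
  obtain BL where BL: "BL \<ge> 0" "\<And>\<phi> b. \<phi> \<in> G0 M x1 \<epsilon> \<beta> \<gamma> \<Longrightarrow> test_bound M x1 1 \<beta> \<gamma> \<phi> b \<Longrightarrow> \<bar>L \<phi>\<bar> \<le> BL * b"
    using dual_bounded1[OF L] by auto
  obtain C0 where C0: "C0 \<ge> 0" "\<And>z. dist x z \<le> \<rho> \<Longrightarrow> test_bound M x1 1 \<epsilon> \<epsilon> (S k z) C0"
    using S_uniform[OF \<rho>] by blast
  note [measurable] = borel_measurable_integrable[OF i]
  have gb: "g z \<le> BL * C0" if "dist x z \<le> \<rho>" for z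
    unfolding g_def using params
    by (intro BL smooth_G0 smooth_S test_bound_weaken[OF _ _ _ C0(2)[OF that]]) auto
  have ig: "integrable M (\<lambda>z. \<bar>\<psi> z\<bar> * g z)"
  proof (rule integral_abs_le(1))
    show "integrable M (\<lambda>z. BL * C0 * \<bar>\<psi> z\<bar>)" using i by auto
    fix z show "\<bar>\<bar>\<psi> z\<bar> * g z\<bar> \<le> BL * C0 * \<bar>\<psi> z\<bar>"
    proof (cases "\<rho> \<le> dist x z")
      case False
      then have "g z \<le> BL * C0" by (intro gb) simp
      then show ?thesis using mult_right_mono[of "g z" "BL * C0" "\<bar>\<psi> z\<bar>"] by (simp add: g_def abs_mult mult_ac)
    qed (simp add: supp)
  qed measurable
  then show "integrable M (\<lambda>z. \<bar>\<psi> z\<bar> * \<bar>L (S k z)\<bar>)" by (simp add: g_def)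
  obtain C where C: "C \<ge> 0" "\<And>z z'. dist x z \<le> \<rho> \<Longrightarrow> dist z z' \<le> dk k / 2 \<Longrightarrow>
    test_bound M x1 1 \<beta> \<gamma> (\<lambda>y. S k z y - S k z' y) (C * (dist z z' / dk k) powr (e1 - \<beta>))"
    using S_difference_uniform[OF \<rho>] by blast
  \<comment> \<open>The bound with an error proportional to \<eta> and to the mass of \<psi>; \<eta>
    is sent to 0 at the end.\<close>
  have main: "\<bar>L (T k \<psi>)\<bar> \<le> (\<integral>z. \<bar>\<psi> z\<bar> * g z \<partial>M) + 2 * BL * \<eta> * (\<integral>z. \<bar>\<psi> z\<bar> \<partial>M)" if \<eta>: "\<eta> > 0" for \<eta>
  proof -
    have "((\<lambda>t. C * (t / dk k) powr (e1 - \<beta>)) \<longlongrightarrow> C * (0 / dk k) powr (e1 - \<beta>)) (at_right 0)"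
      using params dk_pos[of k] by (intro tendsto_intros tendsto_powr') (auto simp: eventually_at_filter)
    then have "eventually (\<lambda>t. C * (t / dk k) powr (e1 - \<beta>) < \<eta>) (at_right 0)"
      using order_tendstoD(2)[of _ 0 _ \<eta>] \<eta> params by simp
    moreover have "eventually (\<lambda>t. t < dk k / 2) (at_right 0)"
      using eventually_at_right_real[of 0 "dk k / 2"] dk_pos[of k] by (auto elim: eventually_mono)
    ultimately have "eventually (\<lambda>t. C * (t / dk k) powr (e1 - \<beta>) < \<eta> \<and> t < dk k / 2 \<and> 0 < t) (at_right 0)"
      using eventually_at_right_less[of "0::real"] by eventually_elim auto
    then obtain \<delta> where \<delta>: "\<delta> > 0" "\<delta> < dk k / 2" "C * (\<delta> / dk k) powr (e1 - \<beta>) < \<eta>"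
      using eventually_happens'[OF trivial_limit_at_right_real] by blast
    have close: "test_bound M x1 1 \<beta> \<gamma> (\<lambda>y. S k z y - S k c y) \<eta>" if "dist x z \<le> \<rho>" "dist z c < \<delta>" for z c
    proof (rule test_bound_mono[OF _ C(2)])
      have "C * (dist z c / dk k) powr (e1 - \<beta>) \<le> C * (\<delta> / dk k) powr (e1 - \<beta>)"
        using that C(1) params dk_pos[of k] by (intro mult_left_mono powr_mono2 divide_right_mono) auto
      then show "C * (dist z c / dk k) powr (e1 - \<beta>) \<le> \<eta>" using \<delta> by linarith
    qed (use that \<delta> in auto)
    have gclose: "g c \<le> g z + BL * \<eta>" if "dist x z \<le> \<rho>" "dist z c < \<delta>" for z c
    proof -
      have "\<bar>L (\<lambda>y. S k z y - S k c y)\<bar> \<le> BL * \<eta>"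
        by (intro BL smooth_G0 smooth_diff smooth_S close that)
      moreover have "L (\<lambda>y. S k z y - S k c y) = L (S k z) - L (S k c)"
        by (rule dual_linear(2)[OF L smooth_S smooth_S])
      ultimately show ?thesis by (simp add: g_def)
    qed
    \<comment> \<open>Both sides behave well under disjoint unions of \<open>E\<close>, so small
      cells suffice. The factor 2 in the error counts \<open>BL * \<eta>\<close> once for freezing
      the kernel at the centre \<open>c\<close> and once for returning from \<open>g c\<close> to
      \<open>g z\<close>.\<close>
    define P where "P E \<longleftrightarrow> \<bar>L (T k (\<lambda>z. indicator E z * \<psi> z))\<bar> \<le>
       (\<integral>z. indicator E z * (\<bar>\<psi> z\<bar> * g z) \<partial>M) + 2 * BL * \<eta> * (\<integral>z. indicator E z * \<bar>\<psi> z\<bar> \<partial>M)" for E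
    have iE: "integrable M (\<lambda>z. indicator E z * \<psi> z)" "integrable M (\<lambda>z. indicator E z * \<bar>\<psi> z\<bar>)"
        "integrable M (\<lambda>z. indicator E z * (\<bar>\<psi> z\<bar> * g z))" if "E \<in> sets M" for E
      using integrable_mult_indicator[OF that i] integrable_mult_indicator[OF that ig]
        integrable_mult_indicator[OF that integrable_abs[OF i]] by simp_all
    have sE: "indicator E z * \<psi> z = 0" if "\<rho> < dist x z" for E z using supp that by simp
    have single: "P E" if E: "E \<in> sets M" "E \<subseteq> ball x \<rho> \<inter> ball c \<delta>" for E c
    proof -
      define a where "a = (\<integral>z. indicator E z * \<psi> z \<partial>M)"
      define I where "I = (\<integral>z. indicator E z * \<bar>\<psi> z\<bar> \<partial>M)"
      have sT: "smooth (T k (\<lambda>z. indicator E z * \<psi> z))"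
        by (rule smooth_T[OF \<rho> iE(1)[OF E(1)] sE])
      have sc: "smooth (\<lambda>y. a * S k c y)" by (intro smooth_scale smooth_S)
      define h where "h y = T k (\<lambda>z. indicator E z * \<psi> z) y - a * S k c y" for y
      have h_eq: "h y = (\<integral>z. (indicator E z * \<psi> z) * (S k z y - S k c y) \<partial>M)" for y
      proof -
        have "(\<integral>z. (indicator E z * \<psi> z) * S k z y - (indicator E z * \<psi> z) * S k c y \<partial>M) =
            T k (\<lambda>z. indicator E z * \<psi> z) y - (\<integral>z. (indicator E z * \<psi> z) * S k c y \<partial>M)"
          unfolding T_def
          by (rule Bochner_Integration.integral_diff[OF T_integrable'[OF \<rho> iE(1)[OF E(1)] sE]
                integrable_mult_left[OF iE(1)[OF E(1)]]])
        also have "(\<integral>z. (indicator E z * \<psi> z) * S k c y \<partial>M) = a * S k c y"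
          unfolding a_def by (rule integral_mult_left_zero)
        finally show ?thesis by (simp only: h_def right_diff_distrib)
      qed
      have "test_bound M x1 1 \<beta> \<gamma> (\<lambda>y. \<integral>z. (indicator E z * \<psi> z) * (S k z y - S k c y) \<partial>M)
          (\<eta> * (\<integral>z. \<bar>indicator E z * \<psi> z\<bar> \<partial>M))"
      proof (rule test_bound_integral(1)[OF _ iE(1)[OF E(1)]])
        fix z assume "indicator E z * \<psi> z \<noteq> 0"
        then have "z \<in> E" by (simp add: indicator_def split: if_splits)
        then show "test_bound M x1 1 \<beta> \<gamma> (\<lambda>y. S k z y - S k c y) \<eta>"
          using E(2) by (intro close) (auto simp: dist_commute)
      qed (use \<eta> in auto)
      then have "test_bound M x1 1 \<beta> \<gamma> h (\<eta> * I)" by (simp add: h_eq[abs_def] abs_mult I_def)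
      moreover have "smooth h" unfolding h_def by (intro smooth_diff sT sc)
      ultimately have Lh: "\<bar>L h\<bar> \<le> BL * (\<eta> * I)" by (intro BL smooth_G0)
      have "L h = L (T k (\<lambda>z. indicator E z * \<psi> z)) - a * L (S k c)"
        unfolding h_def using dual_linear(2)[OF L sT sc] dual_linear(3)[OF L smooth_S smooth_S] by simp
      then have 1: "\<bar>L (T k (\<lambda>z. indicator E z * \<psi> z))\<bar> \<le> \<bar>a\<bar> * g c + BL * (\<eta> * I)"
        using Lh abs_mult[of a "L (S k c)"] unfolding g_def by linarith
      have "\<bar>a\<bar> \<le> I" unfolding a_def I_def
        by (rule integral_abs_le(2)[OF iE(2)[OF E(1)] borel_measurable_integrable[OF iE(1)[OF E(1)]]]) (simp add: abs_mult)
      then have "\<bar>a\<bar> * g c \<le> I * g c" by (intro mult_right_mono) (auto simp: g_def)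
      also have "\<dots> = (\<integral>z. indicator E z * \<bar>\<psi> z\<bar> * g c \<partial>M)" by (simp add: I_def)
      also have "\<dots> \<le> (\<integral>z. indicator E z * (\<bar>\<psi> z\<bar> * g z) + BL * \<eta> * (indicator E z * \<bar>\<psi> z\<bar>) \<partial>M)"
      proof (rule integral_mono)
        fix z
        show "indicator E z * \<bar>\<psi> z\<bar> * g c \<le> indicator E z * (\<bar>\<psi> z\<bar> * g z) + BL * \<eta> * (indicator E z * \<bar>\<psi> z\<bar>)"
        proof (cases "z \<in> E")
          case True
          then have "g c \<le> g z + BL * \<eta>" using E(2) by (intro gclose) (auto simp: dist_commute)
          from mult_left_mono[OF this, of "\<bar>\<psi> z\<bar>"] True show ?thesis by (simp add: algebra_simps)
        qed simp
      qed (use iE[OF E(1)] in auto)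
      also have "\<dots> = (\<integral>z. indicator E z * (\<bar>\<psi> z\<bar> * g z) \<partial>M) + BL * \<eta> * I"
        using iE[OF E(1)] by (simp add: I_def)
      finally have "\<bar>a\<bar> * g c \<le> (\<integral>z. indicator E z * (\<bar>\<psi> z\<bar> * g z) \<partial>M) + BL * \<eta> * I" .
      with 1 show ?thesis unfolding P_def I_def[symmetric] by (simp add: algebra_simps)
    qed
    obtain F where F: "finite F" "ball x \<rho> \<subseteq> (\<Union>c\<in>F. ball c \<delta>)"
      using totally_bounded_ball[OF \<delta>(1)] by blast
    \<comment> \<open>Induction on the cover: the ball around the new centre splits \<open>E\<close>
      into a piece inside a single cell and a piece covered by the remaining balls.\<close>
    have "\<forall>E\<in>sets M. E \<subseteq> ball x \<rho> \<inter> (\<Union>c\<in>F. ball c \<delta>) \<longrightarrow> P E"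
      using F(1)
    proof (induction F rule: finite_induct)
      case empty
      have "T k (\<lambda>z. 0) = (\<lambda>y. 0)" by (auto simp: T_def)
      then show ?case unfolding P_def by (auto simp: dual_zero[OF L])
    next
      case (insert c F)
      show ?case
      proof (intro ballI impI)
        fix E assume E: "E \<in> sets M" "E \<subseteq> ball x \<rho> \<inter> (\<Union>c\<in>insert c F. ball c \<delta>)"
        define E1 where "E1 = E \<inter> ball c \<delta>"
        define E2 where "E2 = E - ball c \<delta>"
        have m: "E1 \<in> sets M" "E2 \<in> sets M" unfolding E1_def E2_def using E by auto
        have "E1 \<subseteq> ball x \<rho> \<inter> ball c \<delta>" using E(2) unfolding E1_def by blast
        then have 1: "P E1" by (rule single[OF m(1)])
        have "E2 \<subseteq> ball x \<rho> \<inter> (\<Union>c\<in>F. ball c \<delta>)" using E(2) unfolding E2_def by blast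
        then have 2: "P E2" using insert.IH m(2) by blast
        have ind: "indicator E z = indicator E1 z + (indicator E2 z :: real)" for z
          by (auto simp: E1_def E2_def indicator_def)
        have "T k (\<lambda>z. indicator E z * \<psi> z) = (\<lambda>y. T k (\<lambda>z. indicator E1 z * \<psi> z) y + T k (\<lambda>z. indicator E2 z * \<psi> z) y)"
        proof
          fix y show "T k (\<lambda>z. indicator E z * \<psi> z) y = T k (\<lambda>z. indicator E1 z * \<psi> z) y + T k (\<lambda>z. indicator E2 z * \<psi> z) y"
            unfolding T_def ind distrib_right
            using T_integrable'[OF \<rho> iE(1)[OF m(1)] sE] T_integrable'[OF \<rho> iE(1)[OF m(2)] sE]
            by (rule Bochner_Integration.integral_add)
        qed
        then have "L (T k (\<lambda>z. indicator E z * \<psi> z)) = L (T k (\<lambda>z. indicator E1 z * \<psi> z)) + L (T k (\<lambda>z. indicator E2 z * \<psi> z))"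
          using dual_linear(1)[OF L smooth_T[OF \<rho> iE(1)[OF m(1)] sE] smooth_T[OF \<rho> iE(1)[OF m(2)] sE]] by simp
        moreover have "(\<integral>z. indicator E z * (\<bar>\<psi> z\<bar> * g z) \<partial>M) =
            (\<integral>z. indicator E1 z * (\<bar>\<psi> z\<bar> * g z) \<partial>M) + (\<integral>z. indicator E2 z * (\<bar>\<psi> z\<bar> * g z) \<partial>M)"
          unfolding ind distrib_right by (rule Bochner_Integration.integral_add[OF iE(3)[OF m(1)] iE(3)[OF m(2)]])
        moreover have "2 * BL * \<eta> * (\<integral>z. indicator E z * \<bar>\<psi> z\<bar> \<partial>M) =
            2 * BL * \<eta> * (\<integral>z. indicator E1 z * \<bar>\<psi> z\<bar> \<partial>M) + 2 * BL * \<eta> * (\<integral>z. indicator E2 z * \<bar>\<psi> z\<bar> \<partial>M)"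
          unfolding ind distrib_right distrib_left[symmetric]
          by (subst Bochner_Integration.integral_add[OF iE(2)[OF m(1)] iE(2)[OF m(2)]]) (rule refl)
        ultimately show "P E" using 1 2 unfolding P_def by linarith
      qed
    qed
    then have "P (ball x \<rho>)" using F(2) by auto
    moreover have "indicator (ball x \<rho>) z * \<psi> z = \<psi> z" for z using supp[of z] by (auto simp: indicator_def)
    moreover have "indicator (ball x \<rho>) z * \<bar>\<psi> z\<bar> = \<bar>\<psi> z\<bar>" for z using supp[of z] by (auto simp: indicator_def)
    moreover have "indicator (ball x \<rho>) z * (\<bar>\<psi> z\<bar> * g z) = \<bar>\<psi> z\<bar> * g z" for z using supp[of z] by (auto simp: indicator_def)
    ultimately show ?thesis unfolding P_def by simp
  qed
  show "\<bar>L (T k \<psi>)\<bar> \<le> (\<integral>z. \<bar>\<psi> z\<bar> * \<bar>L (S k z)\<bar> \<partial>M)"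
    unfolding g_def[symmetric]
  proof (rule field_le_epsilon)
    fix e :: real assume e: "e > 0"
    define J where "J = 2 * BL * (\<integral>z. \<bar>\<psi> z\<bar> \<partial>M)"
    have J: "J \<ge> 0" unfolding J_def using BL by auto
    have "2 * BL * (e / (J + 1)) * (\<integral>z. \<bar>\<psi> z\<bar> \<partial>M) = e * (J / (J + 1))" by (simp add: J_def)
    also have "\<dots> \<le> e * 1" using J e by (intro mult_left_mono) auto
    finally show "\<bar>L (T k \<psi>)\<bar> \<le> (\<integral>z. \<bar>\<psi> z\<bar> * g z \<partial>M) + e"
      using main[of "e / (J + 1)"] e J by simp
  qed
qed

end

section \<open>The iterated remainders\<close>

lemma telescoping_bound:
  fixes u :: "nat \<Rightarrow> real"
  assumes step: "\<And>j. u j \<le> K * x ^ j + u (Suc j)" and lim: "u \<longlonglongrightarrow> 0" and x: "0 \<le> x" "x < 1"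
  shows "u 0 \<le> K / (1 - x)"
proof -
  have *: "u 0 \<le> (\<Sum>j<J. K * x ^ j) + u J" for J
  proof (induction J)
    case (Suc J)
    then show ?case using step[of J] by simp
  qed simp
  have "(\<lambda>j. K * x ^ j) sums (K * (1 / (1 - x)))"
    using x by (intro sums_mult geometric_sums) auto
  then have "(\<lambda>J. (\<Sum>j<J. K * x ^ j) + u J) \<longlonglongrightarrow> K * (1 / (1 - x)) + 0"
    unfolding sums_def by (intro tendsto_add lim)
  then show ?thesis using LIMSEQ_le_const[of _ _ "u 0"] * by fastforce
qed

lemma dk_shift: "dk (k + int (m * j)) = dk k * ((1/2) ^ m) ^ j"
proof -
  have "dk (k + int (m * j)) = 2 powr (- real_of_int k + - real (m * j))" by (simp add: dk_def)
  also have "\<dots> = dk k * 2 powr (- real (m * j))" by (simp only: powr_add dk_def)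
  also have "2 powr (- real (m * j)) = (1/2) ^ (m * j)"
    by (simp only: powr_minus powr_realpow power_one_over inverse_eq_divide zero_less_numeral)
  finally show ?thesis by (simp only: power_mult)
qed

lemma dk_bracket:
  assumes "R > 0" shows "\<exists>k. dk k \<le> R \<and> R < 2 * dk k"
proof -
  define k where "k = - \<lfloor>log 2 R\<rfloor>"
  have "2 powr real_of_int \<lfloor>log 2 R\<rfloor> \<le> 2 powr log 2 R" "2 powr log 2 R < 2 powr (real_of_int \<lfloor>log 2 R\<rfloor> + 1)"
    by (auto intro: powr_mono powr_less_mono)
  then show ?thesis using assms by (intro exI[of _ k]) (simp add: dk_def k_def powr_add mult.commute)
qed

context hardy_params
begin

text \<open>The cutoff keeps every iterate boundedly supported, as \<open>exchange\<close> requires.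
  It is supported in the ball of radius \<open>4 * \<rho> j\<close>, so radii growing by the factor
  4 contain the supports of the successive iterates.\<close>

primrec iter :: "(nat \<Rightarrow> int) \<Rightarrow> (nat \<Rightarrow> real) \<Rightarrow> 'a \<Rightarrow> ('a \<Rightarrow> real) \<Rightarrow> nat \<Rightarrow> 'a \<Rightarrow> real" where
  "iter k \<rho> x \<phi> 0 = \<phi>"
| "iter k \<rho> x \<phi> (Suc j) =
     (\<lambda>y. cutoff x (2 * \<rho> j) y * (iter k \<rho> x \<phi> j y - T (k j) (iter k \<rho> x \<phi> j) y))"

definition Ktail :: real where "Ktail = 9 * Kb \<epsilon> * (4 + 8 * (1 + Kb \<epsilon>))"

definition Kfar :: real where
  "Kfar = 2 powr \<beta> * Kb \<epsilon> * (1 + (1 + Kb \<epsilon>) * 2 powr \<beta>) * (Ktail * Ck)"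

lemma Kb_eps: "Kb \<epsilon> \<ge> 1" using Kb_ge params by auto

lemma Ktail_nonneg: "Ktail \<ge> 0" unfolding Ktail_def using Kb_eps by auto

lemma Kfar_nonneg: "Kfar \<ge> 0" unfolding Kfar_def using Kb_eps Ktail_nonneg Ck_nonneg by auto

text \<open>For \<open>z\<close> in the support of \<psi>, the cutoff equals 1 on the ball of radius
  \<rho> around \<open>z\<close>. The truncated row is then a pure tail, and
  \<open>test_bound_mult_tail\<close> gives the gain \<open>(dk k / \<rho>) powr \<epsilon>\<close>.
  With this sign, the function is what has to be added to the next iterate to recover the
  remainder.\<close>

lemma far_tail:
  assumes \<rho>: "dk k \<le> \<rho>" and i: "integrable M \<psi>" and supp: "\<And>z. \<rho> \<le> dist x z \<Longrightarrow> \<psi> z = 0"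
  shows "test_bound M x \<rho> \<beta> \<epsilon> (\<lambda>y. - (1 - cutoff x (2 * \<rho>) y) * T k \<psi> y)
    (Kfar * (dk k / \<rho>) powr \<epsilon> * (\<integral>z. \<bar>\<psi> z\<bar> \<partial>M))"
proof -
  have \<rho>0: "\<rho> > 0" using \<rho> dk_pos[of k] by linarith
  define F where "F z y = (1 - cutoff x (2 * \<rho>) y) * S k z y" for z y
  have F: "test_bound M x \<rho> \<beta> \<epsilon> (F z) (Kfar * (dk k / \<rho>) powr \<epsilon>)" if z: "dist x z \<le> \<rho>" for z
  proof -
    have \<eta>: "multiplier (\<lambda>y. 1 - cutoff x (2 * \<rho>) y) z \<rho>"
      using z \<rho>0 by (intro multiplier_mono[OF cutoff_multiplier(2)[of "2 * \<rho>"]]) auto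
    have zero: "1 - cutoff x (2 * \<rho>) y = 0" if "dist z y \<le> \<rho>" for y
      using cutoff_eq_1[of "2 * \<rho>" x y] dist_triangle[of x y z] z that \<rho>0 by simp
    have "test_bound M z \<rho> \<beta> \<epsilon> (F z) (9 * Kb \<epsilon> * (4 + 8 * (1 + Kb \<epsilon>)) * (dk k / \<rho>) powr \<epsilon> * Ck)"
      unfolding F_def using params e1
      by (intro test_bound_mult_tail[OF dk_pos \<rho> _ _ _ row_weak \<eta> zero]) auto
    then have "test_bound M x \<rho> \<beta> \<epsilon> (F z) (2 powr \<beta> * Kb \<epsilon> * (1 + (1 + Kb \<epsilon>) * 2 powr \<beta>) * (9 * Kb \<epsilon> * (4 + 8 * (1 + Kb \<epsilon>)) * (dk k / \<rho>) powr \<epsilon> * Ck))"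
      using params by (intro test_bound_center[OF \<rho>0 _ _ z]) auto
    then show ?thesis by (simp add: Kfar_def Ktail_def mult_ac)
  qed
  have "test_bound M x \<rho> \<beta> \<epsilon> (\<lambda>y. \<integral>z. \<psi> z * F z y \<partial>M) (Kfar * (dk k / \<rho>) powr \<epsilon> * (\<integral>z. \<bar>\<psi> z\<bar> \<partial>M))"
  proof (rule test_bound_integral(1)[OF \<rho>0 i])
    show "0 \<le> Kfar * (dk k / \<rho>) powr \<epsilon>" using Kfar_nonneg by auto
    show "(\<lambda>z. F z y) \<in> borel_measurable M" for y unfolding F_def by measurable
    fix z assume "\<psi> z \<noteq> 0"
    then have "dist x z \<le> \<rho>" using supp[of z] by force
    then show "test_bound M x \<rho> \<beta> \<epsilon> (F z) (Kfar * (dk k / \<rho>) powr \<epsilon>)" by (rule F)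
  qed
  moreover have "(\<integral>z. \<psi> z * F z y \<partial>M) = (1 - cutoff x (2 * \<rho>) y) * T k \<psi> y" for y
  proof -
    have "(\<integral>z. \<psi> z * F z y \<partial>M) = (\<integral>z. (1 - cutoff x (2 * \<rho>) y) * (\<psi> z * S k z y) \<partial>M)"
      by (intro Bochner_Integration.integral_cong) (auto simp: F_def)
    then show ?thesis by (simp add: T_def)
  qed
  ultimately have "test_bound M x \<rho> \<beta> \<epsilon> (\<lambda>y. (1 - cutoff x (2 * \<rho>) y) * T k \<psi> y) (Kfar * (dk k / \<rho>) powr \<epsilon> * (\<integral>z. \<bar>\<psi> z\<bar> \<partial>M))"
    by simp
  from test_bound_minus[OF this] show ?thesis by (simp only: mult_minus_left)
qed

text \<open>\<open>h\<close> is a measurable majorant of the powers with exponent \<open>q\<close>.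
  Since \<psi> is dominated by a bump around \<open>x\<close>, averages of \<open>h\<close> over
  balls centred at \<open>x\<close> suffice, whatever the scale of \<open>k\<close>. The bound
  \<open>G\<close> is asked for on the ball that contains the support of \<psi>.\<close>

lemma main_term:
  assumes L: "L \<in> dual" and q: "0 < q" "q < 1" and R: "R > 0" and \<rho>: "\<rho> > 0"
    and i: "integrable M \<psi>" and supp: "\<And>z. \<rho> \<le> dist x z \<Longrightarrow> \<psi> z = 0"
    and a: "a \<ge> 0" "\<And>z. \<bar>\<psi> z\<bar> \<le> a * bump M x R \<epsilon> z"
    and [measurable]: "h \<in> borel_measurable M" and h: "\<And>z. ennreal (\<bar>L (S k z)\<bar> powr q) \<le> h z"
    and H: "H \<ge> 0" "\<And>t. t > 0 \<Longrightarrow> (\<integral>\<^sup>+z. h z * indicator (ball x t) z \<partial>M) \<le> ennreal (V x t) * ennreal H"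
    and G: "\<And>z. dist x z \<le> \<rho> \<Longrightarrow> \<bar>L (S k z)\<bar> \<le> G"
  shows "\<bar>L (T k \<psi>)\<bar> \<le> G powr (1 - q) * a * Kint \<epsilon> * H"
proof -
  have \<epsilon>: "\<epsilon> > 0" using params by auto
  note ex = exchange[OF L \<rho> i supp, where k = k]
  have G0: "G \<ge> 0" using G[of x] \<rho> by simp
  have pt: "ennreal (\<bar>\<psi> z\<bar> * \<bar>L (S k z)\<bar>) \<le> ennreal (G powr (1 - q) * a) * (ennreal (bump M x R \<epsilon> z) * h z)" for z
  proof (cases "\<rho> \<le> dist x z")
    case True then show ?thesis using supp by simp
  next
    case False
    let ?g = "\<bar>L (S k z)\<bar>"
    have "?g = ?g powr (1 - q) * ?g powr q" by (simp flip: powr_add)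
    also have "\<dots> \<le> G powr (1 - q) * ?g powr q"
      using False q by (intro mult_right_mono powr_mono2 G) auto
    finally have "\<bar>\<psi> z\<bar> * ?g \<le> (a * bump M x R \<epsilon> z) * (G powr (1 - q) * ?g powr q)"
      using a bump_nonneg[OF R] by (intro mult_mono) auto
    then have "ennreal (\<bar>\<psi> z\<bar> * ?g) \<le> ennreal ((G powr (1 - q) * a) * (bump M x R \<epsilon> z * ?g powr q))"
      by (intro ennreal_leI) (simp add: mult_ac)
    also have "\<dots> = ennreal (G powr (1 - q) * a) * (ennreal (bump M x R \<epsilon> z) * ennreal (?g powr q))"
      using a bump_nonneg[OF R, of x \<epsilon> z] by (simp add: ennreal_mult')
    also have "\<dots> \<le> ennreal (G powr (1 - q) * a) * (ennreal (bump M x R \<epsilon> z) * h z)"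
      by (intro mult_left_mono h) auto
    finally show ?thesis .
  qed
  have "ennreal \<bar>L (T k \<psi>)\<bar> \<le> ennreal (\<integral>z. \<bar>\<psi> z\<bar> * \<bar>L (S k z)\<bar> \<partial>M)" by (intro ennreal_leI ex)
  also have "\<dots> = (\<integral>\<^sup>+z. ennreal (\<bar>\<psi> z\<bar> * \<bar>L (S k z)\<bar>) \<partial>M)"
    by (rule nn_integral_eq_integral[symmetric, OF ex(1)]) auto
  also have "\<dots> \<le> (\<integral>\<^sup>+z. ennreal (G powr (1 - q) * a) * (ennreal (bump M x R \<epsilon> z) * h z) \<partial>M)"
    by (intro nn_integral_mono pt)
  also have "\<dots> = ennreal (G powr (1 - q) * a) * (\<integral>\<^sup>+z. ennreal (bump M x R \<epsilon> z) * h z \<partial>M)"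
    by (rule nn_integral_cmult) measurable
  also have "\<dots> \<le> ennreal (G powr (1 - q) * a) * (ennreal (Kint \<epsilon>) * ennreal H)"
    by (intro mult_left_mono nn_integral_bump_le R \<epsilon> H) auto
  also have "\<dots> = ennreal (G powr (1 - q) * a * Kint \<epsilon> * H)"
    using a H Kint_pos[OF \<epsilon>] by (simp add: ennreal_mult' mult.assoc)
  finally show ?thesis using a H Kint_pos[OF \<epsilon>] by (subst (asm) ennreal_le_iff) auto
qed

text \<open>Each step multiplies the norm by 9 for the cutoff and by \<open>KR b \<epsilon>\<close>
  for the remainder. The size at step \<open>j\<close> is read off from the norm at step
  \<open>j - 1\<close> and the relative scale \<open>\<theta> ^ (j - 1)\<close>, whence the
  prefactor \<open>\<theta> powr (- b)\<close>. The regularity \<open>b\<close> is a parameter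
  because the iteration is measured both with \<beta> and with \<epsilon>.\<close>

lemma iter_bounds:
  assumes R: "0 < R" and \<theta>: "\<theta> = (1/2) ^ m" and k0: "dk k0 \<le> R"
    and k: "k = (\<lambda>j. k0 + int (m * j))" and \<rho>: "\<And>j. R \<le> \<rho> j"
    and b: "0 < b" "b \<le> \<epsilon>" and f: "test_bound M x R b \<epsilon> \<phi> B"
  shows "test_bound M x R b \<epsilon> (iter k \<rho> x \<phi> j) ((9 * KR b \<epsilon>) ^ j * B)"
    and "\<bar>iter k \<rho> x \<phi> j y\<bar> \<le> \<theta> powr (- b) * ((9 * KR b \<epsilon>) * \<theta> powr b) ^ j * B * bump M x R \<epsilon> y"
proof -
  note B = test_bound_nonneg[OF R f]
  have \<epsilon>: "\<epsilon> > 0" "\<epsilon> \<le> e2" "b \<le> e1" "b < e2" "b \<le> 1" using params b e1 by auto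
  have th: "0 < \<theta>" "\<theta> \<le> 1" by (auto simp: \<theta> power_le_one)
  have KR: "KR b \<epsilon> \<ge> 1" using KR_ge \<epsilon> by auto
  have dkj: "dk (k j) = dk k0 * \<theta> ^ j" for j unfolding k \<theta> by (rule dk_shift)
  have dkR: "dk (k j) \<le> R" "dk (k j) / R \<le> \<theta> ^ j" for j
  proof -
    have "dk k0 * \<theta> ^ j \<le> R * \<theta> ^ j" using k0 th by (intro mult_right_mono) auto
    moreover have "R * \<theta> ^ j \<le> R" using R th by (simp add: mult_left_le power_le_one)
    ultimately have "dk k0 * \<theta> ^ j \<le> R * \<theta> ^ j" "dk k0 * \<theta> ^ j \<le> R" by auto
    then show "dk (k j) \<le> R" "dk (k j) / R \<le> \<theta> ^ j" using R by (auto simp: dkj field_simps)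
  qed
  show tb: "test_bound M x R b \<epsilon> (iter k \<rho> x \<phi> j) ((9 * KR b \<epsilon>) ^ j * B)" for j
  proof (induction j)
    case (Suc j)
    have "multiplier (cutoff x (2 * \<rho> j)) x (2 * \<rho> j)" using \<rho>[of j] R by (intro cutoff_multiplier) auto
    then have "test_bound M x R b \<epsilon> (iter k \<rho> x \<phi> (Suc j)) (9 * (KR b \<epsilon> * ((9 * KR b \<epsilon>) ^ j * B)))"
      unfolding iter.simps using \<rho>[of j] R \<epsilon>
      by (intro test_bound_mult[OF R _ _ T_remainder(2)[OF b(1) _ _ _ _ dkR(1) Suc]]) auto
    then show ?case by (simp add: mult_ac)
  qed (use f in simp)
  show "\<bar>iter k \<rho> x \<phi> j y\<bar> \<le> \<theta> powr (- b) * ((9 * KR b \<epsilon>) * \<theta> powr b) ^ j * B * bump M x R \<epsilon> y"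
  proof (cases j)
    case 0
    have "1 \<le> \<theta> powr (- b)" using th b by (simp add: powr_minus one_le_inverse_iff powr_le1)
    then have "B * bump M x R \<epsilon> y \<le> \<theta> powr (- b) * (B * bump M x R \<epsilon> y)"
      using B bump_nonneg[OF R, of x \<epsilon> y] mult_right_mono[of 1 "\<theta> powr (- b)" "B * bump M x R \<epsilon> y"] by simp
    then show ?thesis using test_boundD1[OF f, of y] 0 by (simp add: mult.assoc)
  next
    case (Suc i)
    let ?\<psi> = "iter k \<rho> x \<phi> i"
    have "\<bar>iter k \<rho> x \<phi> j y\<bar> \<le> 1 * \<bar>?\<psi> y - T (k i) ?\<psi> y\<bar>"
      unfolding Suc iter.simps abs_mult using cutoff_bounds[of x "2 * \<rho> i" y] by (intro mult_right_mono) auto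
    also have "\<dots> \<le> KR b \<epsilon> * ((9 * KR b \<epsilon>) ^ i * B) * (dk (k i) / R) powr b * bump M x R \<epsilon> y"
      unfolding mult_1 by (rule T_remainder(1)[OF b(1) _ _ _ _ dkR(1) tb]) (use \<epsilon> in auto)
    also have "\<dots> \<le> (9 * KR b \<epsilon>) * ((9 * KR b \<epsilon>) ^ i * B) * (\<theta> ^ i) powr b * bump M x R \<epsilon> y"
      using KR B b bump_nonneg[OF R] dkR R dk_pos[of "k i"]
      by (intro mult_mono powr_mono2 mult_nonneg_nonneg) auto
    also have "(\<theta> ^ i) powr b = (\<theta> powr b) ^ i"
      using th by (simp add: powr_realpow[symmetric] powr_powr mult.commute)
    also have "\<dots> = \<theta> powr (- b) * (\<theta> powr b) ^ j"
      using th by (simp add: Suc mult.assoc[symmetric] flip: powr_add)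
    finally show ?thesis by (simp add: Suc power_mult_distrib mult_ac)
  qed
qed

definition Kbeta :: real where "Kbeta = 9 * KR \<beta> \<epsilon>"
definition Keps :: real where "Keps = 9 * KR \<epsilon> \<epsilon>"

lemma Kbeta_pos: "Kbeta > 0" and Keps_pos: "Keps > 0"
  unfolding Kbeta_def Keps_def using KR_ge(1)[of \<epsilon> \<beta>] KR_ge(1)[of \<epsilon> \<epsilon>] params by auto

text \<open>Interpolating the size, of order \<open>(Keps * \<theta> powr \<epsilon>) ^ j\<close>,
  with the norm of regularity \<epsilon>, of order \<open>Keps ^ j\<close>, gives a norm of
  regularity \<beta> that is controlled by powers of
  \<open>Keps * \<theta> powr (\<epsilon> - \<beta>)\<close>. In that norm \<open>L\<close> is
  bounded.\<close>

lemma iter_limit: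
  assumes R: "0 < R" and \<theta>: "\<theta> = (1/2) ^ m" and k0: "dk k0 \<le> R"
    and k: "k = (\<lambda>j. k0 + int (m * j))" and \<rho>: "\<And>j. R \<le> \<rho> j"
    and small: "Keps * \<theta> powr (\<epsilon> - \<beta>) \<le> 1 / 2"
    and L: "L \<in> dual" and f: "test_bound M x R \<epsilon> \<epsilon> \<phi> B"
  shows "(\<lambda>j. \<bar>L (iter k \<rho> x \<phi> j)\<bar>) \<longlonglongrightarrow> 0"
proof -
  note B = test_bound_nonneg[OF R f]
  note b = iter_bounds[OF R \<theta> k0 k \<rho> _ order_refl f, folded Keps_def]
  have \<epsilon>: "\<epsilon> > 0" using params by auto
  have th: "0 < \<theta>" "\<theta> \<le> 1" by (auto simp: \<theta> power_le_one)
  define t where "t = \<beta> / \<epsilon>"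
  have t: "0 < t" "t < 1" "\<epsilon> * (1 - t) = \<epsilon> - \<beta>" using params by (auto simp: t_def right_diff_distrib)
  define P where "P = \<theta> powr (- \<epsilon>) * B"
  have P: "P \<ge> 0" using B by (simp add: P_def)
  define X where "X = Keps * \<theta> powr \<epsilon>"
  define Y where "Y = Keps * \<theta> powr (\<epsilon> - \<beta>)"
  have X: "0 \<le> X" "X \<le> Y" unfolding X_def Y_def using Keps_pos th params by (auto intro!: mult_left_mono powr_mono')
  have Y: "0 \<le> Y" "Y < 1" using X small by (auto simp: Y_def)
  have X1: "X < 1" using X Y by linarith
  define c where "c = ((1 + Kb \<epsilon>) * P) powr (1 - t) * B powr t"
  obtain CL where CL: "CL \<ge> 0" "\<And>\<phi> b. \<phi> \<in> G0 M x1 \<epsilon> \<beta> \<gamma> \<Longrightarrow> test_bound M x R \<beta> \<gamma> \<phi> b \<Longrightarrow> \<bar>L \<phi>\<bar> \<le> CL * b"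
    using dual_bounded[OF L R, of x] by auto
  have bound: "\<bar>L (iter k \<rho> x \<phi> j)\<bar> \<le> CL * (P * X ^ j + c * Y ^ j)" for j
  proof -
    have size: "\<bar>iter k \<rho> x \<phi> j y\<bar> \<le> P * X ^ j * bump M x R \<epsilon> y" for y
      using b(2)[OF \<epsilon>, where j = j and y = y] by (simp add: P_def X_def mult_ac)
    have "test_bound M x R \<beta> \<epsilon> (iter k \<rho> x \<phi> j)
        (P * X ^ j + ((1 + Kb \<epsilon>) * (P * X ^ j)) powr (1 - t) * (Keps ^ j * B) powr t)"
      unfolding t_def using params P X
      by (intro test_bound_interp[OF R _ _ _ _ b(1)[OF \<epsilon>] size]) auto
    moreover have "((1 + Kb \<epsilon>) * (P * X ^ j)) powr (1 - t) * (Keps ^ j * B) powr t = c * Y ^ j"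
    proof -
      have pw: "(a ^ j) powr u = (a powr u) ^ j" if "a > 0" for a u :: real
        using that by (simp add: powr_realpow[symmetric] powr_powr mult.commute)
      have Xp: "X > 0" using Keps_pos th by (simp add: X_def)
      have "X powr (1 - t) * Keps powr t = Keps powr (1 - t) * (\<theta> powr \<epsilon>) powr (1 - t) * Keps powr t"
        unfolding X_def by (simp only: powr_mult)
      also have "\<dots> = (Keps powr (1 - t) * Keps powr t) * \<theta> powr (\<epsilon> - \<beta>)"
        by (simp only: powr_powr t(3) mult_ac)
      also have "\<dots> = Y" using Keps_pos by (simp add: Y_def flip: powr_add)
      finally have XY: "X powr (1 - t) * Keps powr t = Y" .
      have "((1 + Kb \<epsilon>) * (P * X ^ j)) powr (1 - t) * (Keps ^ j * B) powr t =
         c * ((X ^ j) powr (1 - t) * (Keps ^ j) powr t)"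
        unfolding c_def mult.assoc[symmetric, of "1 + Kb \<epsilon>"] powr_mult by (simp only: mult_ac)
      also have "(X ^ j) powr (1 - t) * (Keps ^ j) powr t = Y ^ j"
        unfolding pw[OF Xp] pw[OF Keps_pos] by (simp only: power_mult_distrib[symmetric] XY)
      finally show ?thesis .
    qed
    ultimately have "test_bound M x R \<beta> \<epsilon> (iter k \<rho> x \<phi> j) (P * X ^ j + c * Y ^ j)" by simp
    then have "test_bound M x R \<beta> \<gamma> (iter k \<rho> x \<phi> j) (P * X ^ j + c * Y ^ j)"
      by (rule test_bound_weaken[OF R order_refl less_imp_le[OF params(4)]])
    moreover have "smooth (iter k \<rho> x \<phi> j)" by (rule smoothI[OF R b(1)[OF \<epsilon>]])
    ultimately show ?thesis by (intro CL smooth_G0)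
  qed
  have "(\<lambda>j. CL * (P * X ^ j + c * Y ^ j)) \<longlonglongrightarrow> CL * (P * 0 + c * 0)"
    using X X1 Y by (intro tendsto_intros LIMSEQ_power_zero) auto
  then have lim: "(\<lambda>j. CL * (P * X ^ j + c * Y ^ j)) \<longlonglongrightarrow> 0" by simp
  show ?thesis by (rule Lim_null_comparison[OF _ lim]) (use bound in auto)
qed

end

section \<open>The self-improving inequality\<close>

context hardy_params
begin

definition Kgrow :: real where "Kgrow = Kmove \<beta> \<epsilon> * Ck"

text \<open>The losses at step 0: \<open>\<theta> powr (- \<beta>)\<close> and 9 from the size of
  the iterates, \<open>(2 * \<Lambda>) powr \<gamma>\<close> from the ratio of the first radius to
  \<open>R\<close>, the power of \<open>4 * \<Lambda>\<close> from its ratio to the first kernel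
  scale, \<open>Kgrow\<close> from moving the rows, and \<open>Kint \<epsilon>\<close> from
  integrating the bump.\<close>

definition Cmain :: "real \<Rightarrow> real \<Rightarrow> real \<Rightarrow> real" where
  "Cmain q \<theta> \<Lambda> = \<theta> powr (- \<beta>) * (2 * \<Lambda>) powr \<gamma> *
     (4 * \<Lambda>) powr ((n + \<beta>) * (1 - q)) * Kgrow powr (1 - q) * Kint \<epsilon> * 9"

lemma Kgrow_nonneg: "Kgrow \<ge> 0"
  unfolding Kgrow_def using Kmove_pos[of \<beta> \<epsilon>] Ck_nonneg params by auto

text \<open>Hypothesis \<open>c1\<close> makes the main terms summable: the iterates shrink by
  \<open>Kbeta * \<theta> powr \<beta>\<close> per step, against \<open>4 powr \<gamma>\<close> for
  the growing radii and \<open>(4 / \<theta>) powr d\<close> for the norms of the kernel rows at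
  those radii. \<open>c2\<close> gives the limit. \<open>c3\<close> and \<open>c4\<close> allot a
  quarter of \<open>N\<close> each to what is cut off during the iteration and at its start. In
  applications \<Lambda> is chosen after \<theta>, so \<open>c3\<close> may contain a negative power
  of \<theta>.\<close>

lemma improve:
  assumes q: "0 < q" "q < 1" and \<theta>: "\<theta> = (1/2) ^ m" and \<Lambda>: "1 \<le> \<Lambda>"
    and d: "d = (n + \<beta>) * (1 - q)" "d < \<beta>"
    and c1: "Kbeta * 4 powr (\<gamma> + d) * \<theta> powr (\<beta> - d) \<le> 1 / 2"
    and c2: "Keps * \<theta> powr (\<epsilon> - \<beta>) \<le> 1 / 2"
    and c3: "18 * Kfar * Kint \<epsilon> * \<theta> powr (- \<beta>) * \<Lambda> powr (\<gamma> - \<epsilon>) \<le> 1 / 4"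
    and c4: "Ktail * \<Lambda> powr (\<gamma> - \<epsilon>) \<le> 1 / 4"
    and L: "L \<in> dual" and r: "0 < r" "r \<le> R"
    and h: "h \<in> borel_measurable M" "\<And>k z. ennreal (\<bar>L (S k z)\<bar> powr q) \<le> h z"
    and H: "H \<ge> 0" "\<And>t. t > 0 \<Longrightarrow> (\<integral>\<^sup>+z. h z * indicator (ball x t) z \<partial>M) \<le> ennreal (V x t) * ennreal H"
    and N: "N \<ge> 0" "\<And>\<phi> R' B. r \<le> R' \<Longrightarrow> smooth \<phi> \<Longrightarrow> test_bound M x R' \<beta> \<epsilon> \<phi> B \<Longrightarrow> \<bar>L \<phi>\<bar> \<le> (R' / r) powr \<gamma> * N * B"
    and \<phi>: "smooth \<phi>" "test_bound M x R \<beta> \<epsilon> \<phi> 1"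
  shows "\<bar>L \<phi>\<bar> \<le> (R / r) powr \<gamma> * (2 * Cmain q \<theta> \<Lambda> * H * N powr (1 - q) + N / 2)"
proof -
  have R: "R > 0" using r by auto
  have Rr: "1 \<le> R / r" using r by simp
  have \<epsilon>: "\<epsilon> > 0" "\<epsilon> \<le> e1" "\<epsilon> \<le> e2" "\<beta> \<le> 1" "\<epsilon> \<le> 1" using params e1 by auto
  have d0: "0 < d" using d(1) q n_pos params by simp
  have th: "0 < \<theta>" "\<theta> \<le> 1" by (auto simp: \<theta> power_le_one)
  have KI: "Kint \<epsilon> > 0" using Kint_pos \<epsilon> by auto
  obtain k0 where k0: "dk k0 \<le> R" "R < 2 * dk k0" using dk_bracket[OF R] by blast
  define k where "k = (\<lambda>j. k0 + int (m * j))"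
  \<comment> \<open>The initial cutoff is supported in the ball of radius
    \<open>2 * \<Lambda> * R\<close>, and the one producing step \<open>j + 1\<close> in the ball of
    radius \<open>4 * \<rho> j\<close>.\<close>
  define \<rho> where "\<rho> j = 2 * \<Lambda> * R * 4 ^ j" for j :: nat
  have \<Lambda>R: "R \<le> \<Lambda> * R" using \<Lambda> R by simp
  have \<rho>: "R \<le> \<rho> j" "\<Lambda> * R \<le> \<rho> j" for j
  proof -
    have "\<Lambda> * R * 1 \<le> \<Lambda> * R * (2 * 4 ^ j)" using \<Lambda> R by (intro mult_left_mono) (auto intro: mult_ge_one)
    then show "\<Lambda> * R \<le> \<rho> j" by (simp add: \<rho>_def mult_ac)
    then show "R \<le> \<rho> j" using \<Lambda>R by linarith
  qed
  have \<rho>0: "\<rho> j > 0" for j using \<rho>(1)[of j] R by linarith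
  have dkj: "dk (k j) = dk k0 * \<theta> ^ j" for j unfolding k_def \<theta> by (rule dk_shift)
  have dkR: "dk (k j) \<le> R" for j
  proof -
    have "dk k0 * \<theta> ^ j \<le> dk k0" using th dk_pos[of k0] by (simp add: mult_left_le power_le_one)
    then show ?thesis unfolding dkj using k0(1) by (rule order_trans)
  qed
  let ?\<chi> = "cutoff x (\<Lambda> * R)"
  define \<phi>0 where "\<phi>0 y = ?\<chi> y * \<phi> y" for y
  have mult0: "multiplier ?\<chi> x (\<Lambda> * R)" "multiplier (\<lambda>y. 1 - ?\<chi> y) x (\<Lambda> * R)"
    using \<Lambda>R R by (auto intro!: cutoff_multiplier)
  have tb0: "test_bound M x R \<beta> \<epsilon> \<phi>0 9"
    using test_bound_mult[OF R \<Lambda>R \<epsilon>(4) \<phi>(2) mult0(1)] by (simp add: \<phi>0_def[abs_def])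
  obtain B where B: "test_bound M x R \<epsilon> \<epsilon> \<phi> B" using smoothD[OF R \<phi>(1)] by blast
  have tbe: "test_bound M x R \<epsilon> \<epsilon> \<phi>0 (9 * B)"
    using test_bound_mult[OF R \<Lambda>R \<epsilon>(5) B mult0(1)] by (simp add: \<phi>0_def[abs_def])
  define \<psi> where "\<psi> = iter k \<rho> x \<phi>0"
  have psi0: "\<psi> 0 = \<phi>0" by (simp add: \<psi>_def)
  have psiS: "\<psi> (Suc j) = (\<lambda>y. cutoff x (2 * \<rho> j) y * (\<psi> j y - T (k j) (\<psi> j) y))" for j
    by (simp add: \<psi>_def)
  note ib = iter_bounds[where \<rho> = \<rho>, OF R \<theta> k0(1) k_def \<rho>(1)]
  define X where "X = Kbeta * \<theta> powr \<beta>"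
  define a where "a j = \<theta> powr (- \<beta>) * X ^ j * 9" for j :: nat
  have X0: "X \<ge> 0" using Kbeta_pos by (simp add: X_def)
  have a0: "a j \<ge> 0" for j using X0 by (simp add: a_def)
  have size: "\<bar>\<psi> j y\<bar> \<le> a j * bump M x R \<epsilon> y" for j y
    using ib(2)[OF params(1) _ tb0, folded Kbeta_def, where j = j and y = y] params by (simp add: a_def X_def \<psi>_def)
  have tbj: "test_bound M x R \<epsilon> \<epsilon> (\<psi> j) (Keps ^ j * (9 * B))" for j
    using ib(1)[OF \<epsilon>(1) order_refl tbe, folded Keps_def, where j = j] by (simp add: \<psi>_def)
  have sm: "smooth (\<psi> j)" for j by (rule smoothI[OF R tbj])
  have int: "integrable M (\<psi> j)" "(\<integral>z. \<bar>\<psi> j z\<bar> \<partial>M) \<le> a j * Kint \<epsilon>" for j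
  proof -
    show i: "integrable M (\<psi> j)" by (rule test_bound_integrable(1)[OF R \<epsilon>(1) \<epsilon>(1) tbj])
    have "\<bar>\<integral>z. \<bar>\<psi> j z\<bar> \<partial>M\<bar> \<le> (\<integral>z. a j * bump M x R \<epsilon> z \<partial>M)"
      by (rule integral_abs_le(2)) (use bump_integral[OF R \<epsilon>(1)] i size in auto)
    also have "\<dots> \<le> a j * Kint \<epsilon>" using bump_integral[OF R \<epsilon>(1)] a0 by (auto intro: mult_left_mono)
    finally show "(\<integral>z. \<bar>\<psi> j z\<bar> \<partial>M) \<le> a j * Kint \<epsilon>" by simp
  qed
  have supp: "\<psi> j z = 0" if "\<rho> j \<le> dist x z" for j z
  proof (cases j)
    case 0
    have "?\<chi> z = 0" using that \<Lambda>R R by (intro cutoff_eq_0) (auto simp: 0 \<rho>_def)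
    then show ?thesis using 0 by (simp add: psi0 \<phi>0_def)
  next
    case (Suc i)
    have "cutoff x (2 * \<rho> i) z = 0" using that \<rho>0[of i] by (intro cutoff_eq_0) (auto simp: Suc \<rho>_def)
    then show ?thesis using Suc by (simp add: psiS)
  qed
  have smT: "smooth (T (k j) (\<psi> j))" for j
    by (rule smooth_T[OF \<rho>0[of j] int(1), where x = x]) (use supp in auto)
  define t where "t j y = - (1 - cutoff x (2 * \<rho> j) y) * T (k j) (\<psi> j) y" for j y
  \<comment> \<open>The cutoff equals 1 on the support of \<open>\<psi> j\<close>, so only the part
    from \<open>T\<close> is lost.\<close>
  have split: "\<psi> j y - T (k j) (\<psi> j) y = \<psi> (Suc j) y + t j y" for j y
  proof -
    have "(1 - cutoff x (2 * \<rho> j) y) * \<psi> j y = 0"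
      using supp[of j y] cutoff_eq_1[of "2 * \<rho> j" x y] \<rho>0[of j] by (cases "\<rho> j \<le> dist x y") auto
    then show ?thesis by (simp add: psiS t_def algebra_simps)
  qed
  have smt: "smooth (t j)" for j
  proof -
    have "t j = (\<lambda>y. (\<psi> j y - T (k j) (\<psi> j) y) - \<psi> (Suc j) y)" using split[of j] by auto
    then show ?thesis using smooth_diff[OF smooth_diff[OF sm smT] sm] by metis
  qed
  have Lstep: "\<bar>L (\<psi> j)\<bar> \<le> \<bar>L (T (k j) (\<psi> j))\<bar> + \<bar>L (t j)\<bar> + \<bar>L (\<psi> (Suc j))\<bar>" for j
  proof -
    have "L (\<psi> j) - L (T (k j) (\<psi> j)) = L (\<lambda>y. \<psi> j y - T (k j) (\<psi> j) y)"
      by (rule dual_linear(2)[OF L sm smT, symmetric])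
    also have "\<dots> = L (\<psi> (Suc j)) + L (t j)" unfolding split by (rule dual_linear(1)[OF L sm smt])
    finally show ?thesis by linarith
  qed
  have th_d: "\<theta> powr \<beta> \<le> \<theta> powr (\<beta> - d)" using th d0 by (intro powr_mono') auto
  have ge1: "1 \<le> (4::real) powr (\<gamma> + d)" using d0 params by (intro ge_one_powr_ge_zero) auto
  have X2: "X \<le> 1 / 2"
  proof -
    have "X \<le> Kbeta * (4 powr (\<gamma> + d) * \<theta> powr (\<beta> - d))"
      unfolding X_def using Kbeta_pos mult_mono[OF ge1 th_d] by (intro mult_left_mono) auto
    then show ?thesis using c1 by (simp add: mult.assoc)
  qed
  have \<rho>r: "\<rho> j / r = (R / r) * ((2 * \<Lambda>) * 4 ^ j)" for j by (simp add: \<rho>_def)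
  have pw: "((c::real) ^ j) powr u = (c powr u) ^ j" if "c > 0" for c u and j :: nat
    using that by (simp add: powr_realpow[symmetric] powr_powr mult.commute)
  have tail: "\<bar>L (t j)\<bar> \<le> (R / r) powr \<gamma> * N * (9 * Kfar * Kint \<epsilon> * \<theta> powr (- \<beta>) * \<Lambda> powr (\<gamma> - \<epsilon>)) * (1/2) ^ j" for j
  proof -
    have "dk (k j) \<le> \<rho> j" using dkR \<rho>(1) order_trans by blast
    then have "test_bound M x (\<rho> j) \<beta> \<epsilon> (t j) (Kfar * (dk (k j) / \<rho> j) powr \<epsilon> * (\<integral>z. \<bar>\<psi> j z\<bar> \<partial>M))"
      unfolding t_def by (rule far_tail[OF _ int(1)]) (rule supp)
    then have "\<bar>L (t j)\<bar> \<le> (\<rho> j / r) powr \<gamma> * N * (Kfar * (dk (k j) / \<rho> j) powr \<epsilon> * (\<integral>z. \<bar>\<psi> j z\<bar> \<partial>M))"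
      using r \<rho>(1)[of j] by (intro N smt) auto
    also have "\<dots> \<le> (\<rho> j / r) powr \<gamma> * N * (Kfar * (R / \<rho> j) powr \<epsilon> * (a j * Kint \<epsilon>))"
      using N Kfar_nonneg int(2) dkR dk_pos[of "k j"] \<rho>0[of j] \<epsilon>
      by (intro mult_left_mono mult_mono powr_mono2 divide_right_mono mult_nonneg_nonneg) auto
    also have "\<dots> = ((\<rho> j / r) powr \<gamma> * (R / \<rho> j) powr \<epsilon>) * (N * Kfar * (a j * Kint \<epsilon>))" by (simp only: mult_ac)
    \<comment> \<open>The weight of exponent \<gamma> that comes with \<open>N\<close> is beaten by
      the tail gain of exponent \<epsilon>; what remains is at most
      \<open>\<Lambda> powr (\<gamma> - \<epsilon>)\<close>.\<close>
    also have "(\<rho> j / r) powr \<gamma> * (R / \<rho> j) powr \<epsilon> = (R / r) powr \<gamma> * (\<rho> j / R) powr (\<gamma> - \<epsilon>)"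
    proof -
      have "\<rho> j / r = (R / r) * (\<rho> j / R)" using R by simp
      then have 1: "(\<rho> j / r) powr \<gamma> = (R / r) powr \<gamma> * (\<rho> j / R) powr \<gamma>" by (simp only: powr_mult)
      have "(R / \<rho> j) powr \<epsilon> = (\<rho> j / R) powr (- \<epsilon>)" using R \<rho>0[of j] by (simp add: powr_minus powr_divide)
      then show ?thesis unfolding 1 by (simp add: mult.assoc flip: powr_add)
    qed
    also have "(R / r) powr \<gamma> * (\<rho> j / R) powr (\<gamma> - \<epsilon>) * (N * Kfar * (a j * Kint \<epsilon>))
       \<le> (R / r) powr \<gamma> * \<Lambda> powr (\<gamma> - \<epsilon>) * (N * Kfar * ((\<theta> powr (- \<beta>) * (1/2) ^ j * 9) * Kint \<epsilon>))"
    proof (intro mult_mono mult_left_mono)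
      show "(\<rho> j / R) powr (\<gamma> - \<epsilon>) \<le> \<Lambda> powr (\<gamma> - \<epsilon>)"
        using \<rho>(2)[of j] R \<Lambda> params by (intro powr_mono2') (auto simp: field_simps)
      show "a j \<le> \<theta> powr (- \<beta>) * (1/2) ^ j * 9"
        unfolding a_def using X0 X2 by (intro mult_right_mono mult_left_mono power_mono) auto
    qed (use N Kfar_nonneg KI a0 in auto)
    finally show ?thesis by (simp add: mult_ac)
  qed
  have main: "\<bar>L (T (k j) (\<psi> j))\<bar> \<le> (R / r) powr \<gamma> * (Cmain q \<theta> \<Lambda> * H * N powr (1 - q)) * (1/2) ^ j" for j
  proof -
    \<comment> \<open>The bound for \<open>L\<close> on rows: the property of \<open>N\<close> at
      scale \<open>\<rho> j\<close>, to which a row of scale \<open>dk (k j)\<close> is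
      moved.\<close>
    define G where "G = (\<rho> j / r) powr \<gamma> * N * (Kgrow * (\<rho> j / dk (k j)) powr (n + \<beta>))"
    have "\<bar>L (T (k j) (\<psi> j))\<bar> \<le> G powr (1 - q) * a j * Kint \<epsilon> * H"
    proof (rule main_term[OF L q R \<rho>0[of j] int(1) supp a0 size h(1) h(2) H])
      fix z assume z: "dist x z \<le> \<rho> j"
      have "dk (k j) \<le> \<rho> j" using dkR \<rho>(1) order_trans by blast
      then have "test_bound M x (\<rho> j) \<beta> \<epsilon> (S (k j) z) (Kmove \<beta> \<epsilon> * (\<rho> j / dk (k j)) powr (n + \<beta>) * Ck)"
        using z params by (intro test_bound_move[OF dk_pos _ _ _ _ row_weak]) auto
      then have "\<bar>L (S (k j) z)\<bar> \<le> (\<rho> j / r) powr \<gamma> * N * (Kmove \<beta> \<epsilon> * (\<rho> j / dk (k j)) powr (n + \<beta>) * Ck)"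
        using r \<rho>(1)[of j] by (intro N smooth_S) auto
      then show "\<bar>L (S (k j) z)\<bar> \<le> G" by (simp add: G_def Kgrow_def mult_ac)
    qed auto
    also have "G powr (1 - q) = ((\<rho> j / r) powr \<gamma>) powr (1 - q) * N powr (1 - q) * (Kgrow powr (1 - q) * (\<rho> j / dk (k j)) powr d)"
      unfolding G_def powr_mult by (simp add: powr_powr d(1))
    also have "\<dots> * a j * Kint \<epsilon> * H = (((\<rho> j / r) powr \<gamma>) powr (1 - q) * (\<rho> j / dk (k j)) powr d) * (N powr (1 - q) * Kgrow powr (1 - q) * a j * Kint \<epsilon> * H)"
      by (simp only: mult_ac)
    also have "\<dots> \<le> (((R / r) powr \<gamma> * ((2 * \<Lambda>) powr \<gamma> * (4 powr \<gamma>) ^ j)) * ((4 * \<Lambda>) powr d * (4 powr d * \<theta> powr (- d)) ^ j)) * (N powr (1 - q) * Kgrow powr (1 - q) * a j * Kint \<epsilon> * H)"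
    proof (intro mult_right_mono mult_mono)
      \<comment> \<open>Because this ratio is at least 1, the exponent \<open>1 - q\<close> on its
        power can be rounded up to 1, which restores the weight \<open>(R / r) powr \<gamma>\<close>
        of the claim.\<close>
      have "1 \<le> \<rho> j / r" using \<rho>(1)[of j] r by simp
      then have "1 \<le> (\<rho> j / r) powr \<gamma>" using params by (intro ge_one_powr_ge_zero) auto
      then have "((\<rho> j / r) powr \<gamma>) powr (1 - q) \<le> ((\<rho> j / r) powr \<gamma>) powr 1" using q by (intro powr_mono) auto
      also have "\<dots> = (\<rho> j / r) powr \<gamma>" using \<open>1 \<le> (\<rho> j / r) powr \<gamma>\<close> by simp
      also have "\<dots> = (R / r) powr \<gamma> * ((2 * \<Lambda>) powr \<gamma> * (4 powr \<gamma>) ^ j)"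
        unfolding \<rho>r powr_mult by (subst pw) auto
      finally show "((\<rho> j / r) powr \<gamma>) powr (1 - q) \<le> (R / r) powr \<gamma> * ((2 * \<Lambda>) powr \<gamma> * (4 powr \<gamma>) ^ j)" .
      have "\<rho> j / dk (k j) \<le> (4 * \<Lambda>) * (4 * (1 / \<theta>)) ^ j"
      proof -
        have "2 * \<Lambda> * 4 ^ j * R \<le> 2 * \<Lambda> * 4 ^ j * (2 * dk k0)" using k0 \<Lambda> by (intro mult_left_mono) auto
        then show ?thesis using th dk_pos[of k0] by (simp add: \<rho>_def dkj power_mult_distrib power_divide field_simps)
      qed
      then have "(\<rho> j / dk (k j)) powr d \<le> ((4 * \<Lambda>) * (4 * (1 / \<theta>)) ^ j) powr d"
        using \<rho>0[of j] dk_pos[of "k j"] d0 by (intro powr_mono2) auto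
      also have "\<dots> = (4 * \<Lambda>) powr d * ((4 * (1 / \<theta>)) ^ j) powr d" by (rule powr_mult)
      also have "((4 * (1 / \<theta>)) ^ j) powr d = ((4 * (1 / \<theta>)) powr d) ^ j" using th by (intro pw) auto
      also have "(4 * (1 / \<theta>)) powr d = 4 powr d * (1 / \<theta>) powr d" by (rule powr_mult)
      also have "(1 / \<theta>) powr d = \<theta> powr (- d)" using th by (simp add: powr_minus powr_divide inverse_eq_divide)
      finally show "(\<rho> j / dk (k j)) powr d \<le> (4 * \<Lambda>) powr d * (4 powr d * \<theta> powr (- d)) ^ j" .
    qed (use KI H a0 Kgrow_nonneg in auto)
    also have "\<dots> = (R / r) powr \<gamma> * (2 * \<Lambda>) powr \<gamma> * (4 * \<Lambda>) powr d * (N powr (1 - q) * Kgrow powr (1 - q) * Kint \<epsilon> * H)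
        * (\<theta> powr (- \<beta>) * 9) * (4 powr \<gamma> * (4 powr d * \<theta> powr (- d)) * X) ^ j"
      unfolding a_def power_mult_distrib by (simp only: mult_ac)
    also have "4 powr \<gamma> * (4 powr d * \<theta> powr (- d)) * X = Kbeta * 4 powr (\<gamma> + d) * \<theta> powr (\<beta> - d)"
      unfolding X_def by (simp add: powr_add powr_diff powr_minus divide_inverse)
    also have "(R / r) powr \<gamma> * (2 * \<Lambda>) powr \<gamma> * (4 * \<Lambda>) powr d * (N powr (1 - q) * Kgrow powr (1 - q) * Kint \<epsilon> * H)
        * (\<theta> powr (- \<beta>) * 9) * (Kbeta * 4 powr (\<gamma> + d) * \<theta> powr (\<beta> - d)) ^ j
      \<le> (R / r) powr \<gamma> * (2 * \<Lambda>) powr \<gamma> * (4 * \<Lambda>) powr d * (N powr (1 - q) * Kgrow powr (1 - q) * Kint \<epsilon> * H)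
        * (\<theta> powr (- \<beta>) * 9) * (1/2) ^ j"
      using c1 KI H Kbeta_pos by (intro mult_left_mono power_mono) auto
    finally show ?thesis unfolding Cmain_def d(1) by (simp only: mult_ac)
  qed
  define K where "K = (R / r) powr \<gamma> * (Cmain q \<theta> \<Lambda> * H * N powr (1 - q)) +
     (R / r) powr \<gamma> * N * (9 * Kfar * Kint \<epsilon> * \<theta> powr (- \<beta>) * \<Lambda> powr (\<gamma> - \<epsilon>))"
  have "\<bar>L (\<psi> 0)\<bar> \<le> K / (1 - 1/2)"
  proof (rule telescoping_bound)
    fix j show "\<bar>L (\<psi> j)\<bar> \<le> K * (1/2) ^ j + \<bar>L (\<psi> (Suc j))\<bar>"
      using Lstep[of j] main[of j] tail[of j] unfolding K_def distrib_right by linarith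
  next
    show "(\<lambda>j. \<bar>L (\<psi> j)\<bar>) \<longlonglongrightarrow> 0"
      unfolding \<psi>_def by (rule iter_limit[OF R \<theta> k0(1) k_def \<rho>(1) c2 L tbe])
  qed auto
  then have "\<bar>L (\<psi> 0)\<bar> \<le> 2 * K" by simp
  moreover have "2 * K \<le> (R / r) powr \<gamma> * (2 * Cmain q \<theta> \<Lambda> * H * N powr (1 - q)) + (R / r) powr \<gamma> * N * (1/4)"
  proof -
    have "(R / r) powr \<gamma> * N * (18 * Kfar * Kint \<epsilon> * \<theta> powr (- \<beta>) * \<Lambda> powr (\<gamma> - \<epsilon>)) \<le> (R / r) powr \<gamma> * N * (1/4)"
      using N c3 by (intro mult_left_mono) auto
    then show ?thesis unfolding K_def by (simp add: algebra_simps)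
  qed
  ultimately have L0: "\<bar>L \<phi>0\<bar> \<le> (R / r) powr \<gamma> * (2 * Cmain q \<theta> \<Lambda> * H * N powr (1 - q)) + (R / r) powr \<gamma> * N * (1/4)"
    by (simp add: psi0)
  \<comment> \<open>The outer part of \<phi> is not iterated: it is estimated by \<open>N\<close> at
    the scale \<open>\<Lambda> * R\<close>, where its norm is small.\<close>
  define \<phi>1 where "\<phi>1 y = (1 - ?\<chi> y) * \<phi> y" for y
  have tb1: "test_bound M x (\<Lambda> * R) \<beta> \<epsilon> \<phi>1 (Ktail * (R / (\<Lambda> * R)) powr \<epsilon> * 1)"
    unfolding \<phi>1_def Ktail_def using params \<epsilon> \<Lambda>R R
    by (intro test_bound_mult_tail[OF R \<Lambda>R _ _ _ \<phi>(2) mult0(2)]) (auto simp: cutoff_eq_1)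
  have sm0: "smooth \<phi>0" by (rule smoothI[OF R tbe])
  have phi1: "\<phi>1 = (\<lambda>y. \<phi> y - \<phi>0 y)" by (auto simp: \<phi>1_def \<phi>0_def algebra_simps)
  have sm1: "smooth \<phi>1" unfolding phi1 by (rule smooth_diff[OF \<phi>(1) sm0])
  have "\<bar>L \<phi>1\<bar> \<le> (\<Lambda> * R / r) powr \<gamma> * N * (Ktail * (R / (\<Lambda> * R)) powr \<epsilon> * 1)"
    by (rule N(2)[OF order_trans[OF r(2) \<Lambda>R] sm1 tb1])
  also have "(\<Lambda> * R / r) powr \<gamma> = \<Lambda> powr \<gamma> * (R / r) powr \<gamma>"
    using powr_mult[of \<Lambda> "R / r" \<gamma>] by simp
  also have "(R / (\<Lambda> * R)) powr \<epsilon> = \<Lambda> powr (- \<epsilon>)" using \<Lambda> R by (simp add: powr_minus powr_divide inverse_eq_divide)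
  also have "\<Lambda> powr \<gamma> * (R / r) powr \<gamma> * N * (Ktail * \<Lambda> powr (- \<epsilon>) * 1) = (R / r) powr \<gamma> * N * (Ktail * \<Lambda> powr (\<gamma> - \<epsilon>))"
    using \<Lambda> by (simp add: powr_diff powr_minus divide_inverse mult_ac)
  also have "\<dots> \<le> (R / r) powr \<gamma> * N * (1/4)" using N c4 by (intro mult_left_mono) auto
  finally have L1: "\<bar>L \<phi>1\<bar> \<le> (R / r) powr \<gamma> * N * (1/4)" .
  have "L \<phi>1 = L \<phi> - L \<phi>0" unfolding phi1 by (rule dual_linear(2)[OF L \<phi>(1) sm0])
  then have "\<bar>L \<phi>\<bar> \<le> (R / r) powr \<gamma> * (2 * Cmain q \<theta> \<Lambda> * H * N powr (1 - q)) + (R / r) powr \<gamma> * N * (1/4) + (R / r) powr \<gamma> * N * (1/4)"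
    using L0 L1 by linarith
  then show ?thesis by (simp add: algebra_simps)
qed

end

section \<open>Pointwise bounds for functionals\<close>

lemma half_power_powr_tendsto:
  assumes "c > 0" shows "(\<lambda>m. K * ((1/2) ^ m) powr c) \<longlonglongrightarrow> (0::real)"
proof -
  have eq: "((1/2::real) ^ m) powr c = ((1/2) powr c) ^ m" for m
    by (simp add: powr_realpow[symmetric] powr_powr mult.commute)
  have "(1/2::real) powr c < 1" using assms powr_less_mono2[of c "1/2" 1] by simp
  then have "(\<lambda>m. K * ((1/2) powr c) ^ m) \<longlonglongrightarrow> K * 0"
    by (intro tendsto_intros LIMSEQ_power_zero) simp
  then show ?thesis unfolding eq mult_zero_right .
qed

context hardy_params
begin

text \<open>\<open>H\<close> plays the role of a maximal function at the point \<open>x\<close>. No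
  scale of a test function occurs, so the same \<open>H\<close> serves all scales around
  \<open>x\<close>.\<close>

definition controlled :: "real \<Rightarrow> (('a \<Rightarrow> real) \<Rightarrow> real) \<Rightarrow> 'a \<Rightarrow> real \<Rightarrow> bool" where
  "controlled q L x H \<longleftrightarrow> H \<ge> 0 \<and> (\<exists>h. h \<in> borel_measurable M \<and> (\<forall>k z. ennreal (\<bar>L (S k z)\<bar> powr q) \<le> h z) \<and>
     (\<forall>t>0. (\<integral>\<^sup>+z. h z * indicator (ball x t) z \<partial>M) \<le> ennreal (V x t) * ennreal H))"

text \<open>The supremum \<open>N\<close> runs over all scales \<open>R \<ge> r\<close> because the
  tails and rows in \<open>improve\<close> live at larger scales. Its weight is the cost of scaling
  down to \<open>r\<close>, so continuity of \<open>L\<close> makes it finite. From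
  \<open>N \<le> D / 2 * H * N powr (1 - q) + N / 2\<close> follows
  \<open>N powr q \<le> D * H\<close>, with \<open>D\<close> independent of \<open>L\<close>,
  \<open>x\<close> and \<open>r\<close>.\<close>

lemma compact_estimate:
  assumes q: "0 < q" "q < 1" "(n + \<beta>) * (1 - q) < \<beta>"
  shows "\<exists>C\<ge>0. \<forall>L\<in>dual. \<forall>x r H \<phi> B. 0 < r \<longrightarrow> controlled q L x H \<longrightarrow> smooth \<phi> \<longrightarrow>
     test_bound M x r \<beta> \<epsilon> \<phi> B \<longrightarrow> \<bar>L \<phi>\<bar> \<le> C * B * H powr (1 / q)"
proof -
  define d where "d = (n + \<beta>) * (1 - q)"
  have p: "0 < \<beta> - d" "0 < \<epsilon> - \<beta>" "0 < \<epsilon> - \<gamma>" using q params by (auto simp: d_def)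
  have "eventually (\<lambda>m. Kbeta * 4 powr (\<gamma> + d) * ((1/2) ^ m) powr (\<beta> - d) < 1/2) sequentially"
    "eventually (\<lambda>m. Keps * ((1/2) ^ m) powr (\<epsilon> - \<beta>) < 1/2) sequentially"
    by (rule order_tendstoD(2)[OF half_power_powr_tendsto]; use p in simp)+
  then have "eventually (\<lambda>m. Kbeta * 4 powr (\<gamma> + d) * ((1/2) ^ m) powr (\<beta> - d) < 1/2 \<and>
      Keps * ((1/2) ^ m) powr (\<epsilon> - \<beta>) < 1/2) sequentially" by eventually_elim auto
  then obtain m where m: "Kbeta * 4 powr (\<gamma> + d) * ((1/2) ^ m) powr (\<beta> - d) < 1/2"
      "Keps * ((1/2) ^ m) powr (\<epsilon> - \<beta>) < 1/2"
    by (auto simp: eventually_sequentially)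
  define \<theta> :: real where "\<theta> = (1/2) ^ m"
  have "eventually (\<lambda>l. (18 * Kfar * Kint \<epsilon> * \<theta> powr (- \<beta>)) * ((1/2) ^ l) powr (\<epsilon> - \<gamma>) < 1/4) sequentially"
    "eventually (\<lambda>l. Ktail * ((1/2) ^ l) powr (\<epsilon> - \<gamma>) < 1/4) sequentially"
    by (rule order_tendstoD(2)[OF half_power_powr_tendsto]; use p in simp)+
  then have "eventually (\<lambda>l. (18 * Kfar * Kint \<epsilon> * \<theta> powr (- \<beta>)) * ((1/2) ^ l) powr (\<epsilon> - \<gamma>) < 1/4 \<and>
      Ktail * ((1/2) ^ l) powr (\<epsilon> - \<gamma>) < 1/4) sequentially" by eventually_elim auto
  then obtain l where l: "(18 * Kfar * Kint \<epsilon> * \<theta> powr (- \<beta>)) * ((1/2) ^ l) powr (\<epsilon> - \<gamma>) < 1/4"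
      "Ktail * ((1/2) ^ l) powr (\<epsilon> - \<gamma>) < 1/4"
    by (auto simp: eventually_sequentially)
  define \<Lambda> :: real where "\<Lambda> = 2 ^ l"
  have \<Lambda>: "\<Lambda> \<ge> 1" by (simp add: \<Lambda>_def)
  have \<Lambda>p: "\<Lambda> powr (\<gamma> - \<epsilon>) = ((1/2) ^ l) powr (\<epsilon> - \<gamma>)"
    unfolding \<Lambda>_def power_one_over powr_divide using powr_minus_divide[of "2 ^ l :: real" "\<epsilon> - \<gamma>"] by simp
  define D where "D = 4 * Cmain q \<theta> \<Lambda>"
  have D0: "D \<ge> 0" unfolding D_def Cmain_def using Kint_pos[of \<epsilon>] params by auto
  have "\<bar>L \<phi>\<bar> \<le> D powr (1 / q) * B * H powr (1 / q)"
    if L: "L \<in> dual" and r: "0 < r" and c: "controlled q L x H" and \<phi>: "smooth \<phi>" "test_bound M x r \<beta> \<epsilon> \<phi> B" for L x r H \<phi> B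
  proof -
    obtain h where h: "h \<in> borel_measurable M" "\<And>k z. ennreal (\<bar>L (S k z)\<bar> powr q) \<le> h z"
      "\<And>t. t > 0 \<Longrightarrow> (\<integral>\<^sup>+z. h z * indicator (ball x t) z \<partial>M) \<le> ennreal (V x t) * ennreal H" and H: "H \<ge> 0"
      using c unfolding controlled_def by blast
    obtain CL where CL: "CL \<ge> 0" "\<And>\<phi> b. \<phi> \<in> G0 M x1 \<epsilon> \<beta> \<gamma> \<Longrightarrow> test_bound M x r \<beta> \<gamma> \<phi> b \<Longrightarrow> \<bar>L \<phi>\<bar> \<le> CL * b"
      using dual_bounded[OF L r, of x] by auto
    define A where "A = {\<bar>L \<phi>\<bar> / (R / r) powr \<gamma> | R \<phi>. r \<le> R \<and> smooth \<phi> \<and> test_bound M x R \<beta> \<epsilon> \<phi> 1}"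
    have bdd: "bdd_above A"
    proof (rule bdd_aboveI[of _ CL])
      fix a assume "a \<in> A"
      then obtain R \<phi> where a: "a = \<bar>L \<phi>\<bar> / (R / r) powr \<gamma>" and R: "r \<le> R" and \<phi>: "smooth \<phi>" "test_bound M x R \<beta> \<epsilon> \<phi> 1"
        unfolding A_def by blast
      have "test_bound M x r \<beta> \<gamma> \<phi> ((R / r) powr \<gamma> * 1)"
        using params by (intro test_bound_scale_down[OF r R _ _ _ \<phi>(2)]) auto
      from CL(2)[OF smooth_G0[OF \<phi>(1)] this] show "a \<le> CL" using r R by (simp add: a field_simps)
    qed
    have zero: "smooth (\<lambda>y. 0)" "test_bound M x r \<beta> \<epsilon> (\<lambda>y. 0) 1"
      using smooth_diff[OF smooth_S smooth_S, of 0 x 0 x] bump_nonneg[OF r] by (auto simp: test_bound_def)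
    have "\<bar>L (\<lambda>y. 0)\<bar> / (r / r) powr \<gamma> \<in> A"
      unfolding A_def using zero by blast
    then have zA: "0 \<in> A" using dual_zero[OF L] by simp
    define N where "N = Sup A"
    have N0: "N \<ge> 0" unfolding N_def by (rule cSup_upper[OF zA bdd])
    have N1: "\<bar>L \<phi>\<bar> \<le> (R' / r) powr \<gamma> * N * B" if R': "r \<le> R'" and \<phi>: "smooth \<phi>" "test_bound M x R' \<beta> \<epsilon> \<phi> B" for \<phi> R' B
    proof -
      have R0: "R' > 0" using r R' by simp
      note B = test_bound_nonneg[OF R0 \<phi>(2)]
      show ?thesis
      proof (cases "B = 0")
        case True
        then have "\<phi> = (\<lambda>y. 0)" using test_boundD1[OF \<phi>(2)] by auto
        then show ?thesis using dual_zero[OF L] True by simp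
      next
        case False
        then have Bp: "B > 0" using B by simp
        have "test_bound M x R' \<beta> \<epsilon> (\<lambda>y. (1 / B) * \<phi> y) 1"
          using test_bound_scale[OF \<phi>(2), of "1 / B"] Bp by simp
        then have "\<bar>L (\<lambda>y. (1 / B) * \<phi> y)\<bar> / (R' / r) powr \<gamma> \<in> A"
          unfolding A_def using R' smooth_scale[OF \<phi>(1)] by blast
        then have "\<bar>L (\<lambda>y. (1 / B) * \<phi> y)\<bar> / (R' / r) powr \<gamma> \<le> N" unfolding N_def by (rule cSup_upper[OF _ bdd])
        moreover have "L (\<lambda>y. (1 / B) * \<phi> y) = (1 / B) * L \<phi>" by (rule dual_linear(3)[OF L \<phi>(1) \<phi>(1)])
        moreover have "(R' / r) powr \<gamma> > 0" using R0 r by simp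
        ultimately have "(1 / B) * \<bar>L \<phi>\<bar> \<le> N * (R' / r) powr \<gamma>" using Bp by (simp only: abs_mult pos_divide_le_eq) simp
        then show ?thesis using Bp by (simp add: field_simps)
      qed
    qed
    have "N \<le> 2 * Cmain q \<theta> \<Lambda> * H * N powr (1 - q) + N / 2"
      unfolding N_def
    proof (rule cSup_least)
      show "A \<noteq> {}" using zA by blast
      fix a assume "a \<in> A"
      then obtain R \<phi> where a: "a = \<bar>L \<phi>\<bar> / (R / r) powr \<gamma>" and R: "r \<le> R" and \<phi>: "smooth \<phi>" "test_bound M x R \<beta> \<epsilon> \<phi> 1"
        unfolding A_def by blast
      have "\<bar>L \<phi>\<bar> \<le> (R / r) powr \<gamma> * (2 * Cmain q \<theta> \<Lambda> * H * N powr (1 - q) + N / 2)"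
        by (rule improve[OF q(1,2) \<theta>_def \<Lambda> d_def _ _ _ _ _ L r R h(1,2) H h(3) N0 N1 \<phi>])
           (use m l p in \<open>simp_all add: \<theta>_def[symmetric] \<Lambda>p\<close>)
      then show "a \<le> 2 * Cmain q \<theta> \<Lambda> * H * (Sup A) powr (1 - q) + Sup A / 2"
        using r R by (simp add: a field_simps N_def)
    qed
    then have N2: "N \<le> D * H * N powr (1 - q)" by (simp add: D_def)
    have "N \<le> (D * H) powr (1 / q)"
    proof (cases "N = 0")
      case False
      then have Np: "N > 0" using N0 by simp
      have "N powr q * N powr (1 - q) \<le> D * H * N powr (1 - q)" using N2 Np by (simp flip: powr_add)
      then have "N powr q \<le> D * H" using Np by simp
      then have "(N powr q) powr (1 / q) \<le> (D * H) powr (1 / q)" using q by (intro powr_mono2) auto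
      then show ?thesis using Np q by (simp add: powr_powr)
    qed simp
    then have "N \<le> D powr (1 / q) * H powr (1 / q)" by (simp add: powr_mult)
    moreover have "\<bar>L \<phi>\<bar> \<le> N * B" using N1[OF order_refl \<phi>] r by simp
    ultimately show ?thesis using test_bound_nonneg[OF r \<phi>(2)] mult_right_mono[of N "D powr (1 / q) * H powr (1 / q)" B]
      by (simp add: mult_ac)
  qed
  note est = this
  show ?thesis by (intro exI[of _ "D powr (1 / q)"] conjI ballI allI impI powr_ge_zero est; assumption)
qed

text \<open>Lowers the decay from \<epsilon> to \<gamma>. The function is cut into dyadic annular
  pieces. Each has bounded support at its own scale, so its decay can be raised to \<epsilon>, and
  its norm at that scale is of order \<open>X ^ l\<close> with
  \<open>X = 2 powr (- \<gamma>)\<close>. The estimate for decay \<epsilon> applies at every scale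
  with the same \<open>H\<close>, and the sum over the pieces converges.\<close>

lemma smooth_estimate:
  assumes q: "0 < q" "q < 1" "(n + \<beta>) * (1 - q) < \<beta>"
  shows "\<exists>C\<ge>0. \<forall>L\<in>dual. \<forall>x r H \<phi> B. 0 < r \<longrightarrow> controlled q L x H \<longrightarrow> smooth \<phi> \<longrightarrow>
     test_bound M x r \<beta> \<gamma> \<phi> B \<longrightarrow> \<bar>L \<phi>\<bar> \<le> C * B * H powr (1 / q)"
proof -
  obtain C where C: "C \<ge> 0 \<and> (\<forall>L\<in>dual. \<forall>x r H \<phi> B. 0 < r \<longrightarrow> controlled q L x H \<longrightarrow> smooth \<phi> \<longrightarrow>
     test_bound M x r \<beta> \<epsilon> \<phi> B \<longrightarrow> \<bar>L \<phi>\<bar> \<le> C * B * H powr (1 / q))"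
    using compact_estimate[OF q] by (elim exE) (rule that)
  note C = conjunct1[OF C] conjunct2[OF C, rule_format]
  define K1 where "K1 = 10 powr (\<epsilon> - \<gamma>) * 9"
  define K2 where "K2 = 9 * Kb \<gamma> * (4 + 8 * (1 + Kb \<gamma>))"
  define X where "X = 2 powr (- \<gamma>)"
  have X: "0 \<le> X" "X < 1" using params powr_less_mono[of "-\<gamma>" 0 2] by (auto simp: X_def)
  have K: "K1 \<ge> 0" "K2 \<ge> 0" using Kb_ge[of \<gamma>] params by (auto simp: K1_def K2_def)
  define D where "D = C * K1 + C * (K1 * K2) / (1 - X)"
  have \<epsilon>1: "\<epsilon> \<le> 1" "\<beta> \<le> 1" using params e1 by auto
  have "\<bar>L \<phi>\<bar> \<le> D * B * H powr (1 / q)"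
    if L: "L \<in> dual" and r: "0 < r" and c: "controlled q L x H" and \<phi>: "smooth \<phi>" "test_bound M x r \<beta> \<gamma> \<phi> B" for L x r H \<phi> B
  proof -
    define \<rho> where "\<rho> l = 2 ^ l * r" for l :: nat
    have \<rho>: "\<rho> l > 0" "r \<le> \<rho> l" "\<rho> (Suc l) = 2 * \<rho> l" for l using r by (auto simp: \<rho>_def)
    define \<kappa> where "\<kappa> l = cutoff x (\<rho> l)" for l
    have mult: "multiplier (\<kappa> l) x (\<rho> l)" "multiplier (\<lambda>y. 1 - \<kappa> l y) x (\<rho> l)" for l
      unfolding \<kappa>_def using \<rho>(1)[of l] by (auto intro!: cutoff_multiplier)
    have r\<rho>: "(r / \<rho> l) powr u = (2 powr (- u)) ^ l" for l u
    proof -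
      have "(r / \<rho> l) powr u = (2 powr (- real l)) powr u" using r by (simp add: \<rho>_def powr_minus powr_realpow inverse_eq_divide)
      then show ?thesis by (simp add: powr_powr powr_realpow[symmetric] mult.commute)
    qed
    obtain B' where B': "B' \<ge> 0" "test_bound M x r \<epsilon> \<epsilon> \<phi> B'" using smoothD[OF r \<phi>(1)] by blast
    have sm: "smooth (\<lambda>y. \<kappa> l y * \<phi> y)" for l
      by (rule smoothI[OF r test_bound_mult[OF r \<rho>(2) \<epsilon>1(1) B'(2) mult(1)]])
    define f where "f l y = (1 - \<kappa> l y) * \<phi> y" for l y
    have f_eq: "f l = (\<lambda>y. \<phi> y - \<kappa> l y * \<phi> y)" for l by (auto simp: f_def algebra_simps)
    have smf: "smooth (f l)" for l unfolding f_eq by (rule smooth_diff[OF \<phi>(1) sm])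
    \<comment> \<open>Piece number \<open>l\<close> lives where the distance from \<open>x\<close>
      lies between \<open>\<rho> l\<close> and \<open>4 * \<rho> l\<close>.\<close>
    define g where "g l y = \<kappa> (Suc l) y * f l y" for l y
    have g_eq: "g l y = f l y - f (Suc l) y" for l y
    proof -
      have "\<kappa> (Suc l) y * \<kappa> l y = \<kappa> l y"
        using cutoff_eq_1[OF \<rho>(1)[of "Suc l"], of x y] cutoff_eq_0[OF \<rho>(1)[of l], of x y] \<rho>(3)[of l]
        by (cases "dist x y \<le> \<rho> (Suc l)") (auto simp: \<kappa>_def)
      then have "\<kappa> (Suc l) y * (\<kappa> l y * \<phi> y) = \<kappa> l y * \<phi> y" by (simp add: mult.assoc[symmetric])
      then show ?thesis by (simp add: g_def f_def algebra_simps)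
    qed
    have smg: "smooth (g l)" for l using smooth_diff[OF smf smf] by (simp add: g_eq[abs_def])
    have f0: "1 - \<kappa> l y = 0" if "dist x y \<le> \<rho> l" for l y using cutoff_eq_1[OF \<rho>(1) that] by (simp add: \<kappa>_def)
    have tbf: "test_bound M x (\<rho> l) \<beta> \<gamma> (f l) (K2 * X ^ l * B)" for l
      using test_bound_mult_tail[OF r \<rho>(2) _ _ _ \<phi>(2) mult(2)[of l] f0] params \<epsilon>1
      unfolding f_def K2_def X_def by (simp add: r\<rho>)
    have tbg: "test_bound M x (\<rho> l) \<beta> \<epsilon> (g l) (K1 * (K2 * X ^ l * B))" for l
    proof -
      have "test_bound M x (\<rho> l) \<beta> \<gamma> (g l) (9 * (K2 * X ^ l * B))"
        unfolding g_def using \<rho>[of l] by (intro test_bound_mult[OF _ _ \<epsilon>1(2) tbf mult(1)]) auto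
      then have "test_bound M x (\<rho> l) \<beta> \<epsilon> (g l) (10 powr (\<epsilon> - \<gamma>) * (9 * (K2 * X ^ l * B)))"
      proof (rule test_bound_compact[rotated 3])
        fix y assume "4 * \<rho> l < dist x y"
        then have "\<kappa> (Suc l) y = 0" unfolding \<kappa>_def using \<rho>[of l] \<rho>(1)[of "Suc l"] by (intro cutoff_eq_0) auto
        then show "g l y = 0" by (simp add: g_def)
      qed (use \<rho>(1)[of l] params in auto)
      then show ?thesis by (simp add: K1_def mult_ac)
    qed
    have first: "\<bar>L (\<lambda>y. \<kappa> 0 y * \<phi> y)\<bar> \<le> C * (K1 * B) * H powr (1 / q)"
    proof (rule C(2)[OF L r c sm])
      have "test_bound M x r \<beta> \<epsilon> (\<lambda>y. \<kappa> 0 y * \<phi> y) (10 powr (\<epsilon> - \<gamma>) * (9 * B))"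
      proof (rule test_bound_compact[OF r _ _ test_bound_mult[OF r \<rho>(2) \<epsilon>1(2) \<phi>(2) mult(1)]])
        fix y assume "4 * r < dist x y"
        then have "\<kappa> 0 y = 0" unfolding \<kappa>_def using r by (intro cutoff_eq_0) (auto simp: \<rho>_def)
        then show "\<kappa> 0 y * \<phi> y = 0" by simp
      qed (use params in auto)
      then show "test_bound M x r \<beta> \<epsilon> (\<lambda>y. \<kappa> 0 y * \<phi> y) (K1 * B)" by (simp add: K1_def mult_ac)
    qed
    obtain CL where CL: "CL \<ge> 0" "\<And>\<phi> b. \<phi> \<in> G0 M x1 \<epsilon> \<beta> \<gamma> \<Longrightarrow> test_bound M x r \<beta> \<gamma> \<phi> b \<Longrightarrow> \<bar>L \<phi>\<bar> \<le> CL * b"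
      using dual_bounded[OF L r, of x] by auto
    \<comment> \<open>The far parts vanish under \<open>L\<close> in the limit because \<phi> is
      smooth: its own tail gain of exponent \<epsilon> beats the cost of exponent \<gamma> for
      scaling down. The constants \<open>CL\<close> and \<open>B'\<close> disappear with
      them.\<close>
    define E where "E = CL * Ktail * B'"
    have fb: "\<bar>L (f l)\<bar> \<le> E * ((1/2) ^ l) powr (\<epsilon> - \<gamma>)" for l
    proof -
      have "test_bound M x (\<rho> l) \<epsilon> \<epsilon> (f l) (Ktail * (r / \<rho> l) powr \<epsilon> * B')"
        unfolding f_def Ktail_def using params \<epsilon>1 by (intro test_bound_mult_tail[OF r \<rho>(2) _ _ _ B'(2) mult(2) f0]) auto
      then have "test_bound M x (\<rho> l) \<beta> \<epsilon> (f l) (Ktail * (r / \<rho> l) powr \<epsilon> * B')"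
        using params by (intro test_bound_weaken[OF \<rho>(1) _ _ , of \<beta> \<epsilon> \<epsilon> \<epsilon>]) auto
      then have "test_bound M x r \<beta> \<gamma> (f l) ((\<rho> l / r) powr \<gamma> * (Ktail * (r / \<rho> l) powr \<epsilon> * B'))"
        using params by (intro test_bound_scale_down[OF r \<rho>(2), of \<beta> \<gamma> \<epsilon>]) auto
      then have "\<bar>L (f l)\<bar> \<le> CL * ((\<rho> l / r) powr \<gamma> * (Ktail * (r / \<rho> l) powr \<epsilon> * B'))"
        by (intro CL smooth_G0 smf)
      also have "(\<rho> l / r) powr \<gamma> = (r / \<rho> l) powr (- \<gamma>)" using r \<rho>(1)[of l] by (simp add: powr_minus powr_divide)
      also have "CL * ((r / \<rho> l) powr (- \<gamma>) * (Ktail * (r / \<rho> l) powr \<epsilon> * B')) = E * (r / \<rho> l) powr (\<epsilon> - \<gamma>)"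
        unfolding E_def by (simp add: powr_diff powr_minus divide_inverse mult_ac)
      also have "r / \<rho> l = (1/2) ^ l" using r by (simp add: \<rho>_def power_one_over)
      finally show ?thesis .
    qed
    have lim: "(\<lambda>l. \<bar>L (f l)\<bar>) \<longlonglongrightarrow> 0"
      by (rule Lim_null_comparison[OF _ half_power_powr_tendsto[of "\<epsilon> - \<gamma>" E]]) (use fb params in auto)
    have "\<bar>L (f 0)\<bar> \<le> (C * (K1 * K2 * B) * H powr (1 / q)) / (1 - X)"
    proof (rule telescoping_bound[OF _ lim X])
      fix l
      have "L (g l) = L (f l) - L (f (Suc l))" using dual_linear(2)[OF L smf smf] by (simp add: g_eq[abs_def])
      moreover have "\<bar>L (g l)\<bar> \<le> C * (K1 * (K2 * X ^ l * B)) * H powr (1 / q)"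
        by (rule C(2)[OF L \<rho>(1) c smg tbg])
      ultimately have "\<bar>L (f l)\<bar> \<le> C * (K1 * (K2 * X ^ l * B)) * H powr (1 / q) + \<bar>L (f (Suc l))\<bar>" by linarith
      then show "\<bar>L (f l)\<bar> \<le> C * (K1 * K2 * B) * H powr (1 / q) * X ^ l + \<bar>L (f (Suc l))\<bar>" by (simp only: mult_ac)
    qed
    moreover have "L (f 0) = L \<phi> - L (\<lambda>y. \<kappa> 0 y * \<phi> y)" unfolding f_eq by (rule dual_linear(2)[OF L \<phi>(1) sm])
    ultimately have "\<bar>L \<phi>\<bar> \<le> C * (K1 * B) * H powr (1 / q) + (C * (K1 * K2 * B) * H powr (1 / q)) / (1 - X)"
      using first by linarith
    then show ?thesis by (simp add: D_def algebra_simps)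
  qed
  note est = this
  have D0: "D \<ge> 0" unfolding D_def using C(1) K X by auto
  show ?thesis by (intro exI[of _ D] conjI ballI allI impI D0 est; assumption)
qed

lemma G0_approx:
  assumes "\<phi> \<in> G0 M x1 \<epsilon> \<beta> \<gamma>" "\<delta> > 0"
  shows "\<exists>g\<in>G_set M x1 1 \<epsilon> \<epsilon>. G_norm M x1 1 \<beta> \<gamma> (\<lambda>y. \<phi> y - g y) < \<delta>"
  using assms by (simp add: G0_def)

lemma G0_G_set: "\<phi> \<in> G0 M x1 \<epsilon> \<beta> \<gamma> \<Longrightarrow> \<phi> \<in> G_set M x1 1 \<beta> \<gamma>"
  by (simp add: G0_def)

lemma dual_linear_G0:
  assumes "L \<in> dual" "\<phi> \<in> G0 M x1 \<epsilon> \<beta> \<gamma>" "\<psi> \<in> G0 M x1 \<epsilon> \<beta> \<gamma>"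
  shows "L (\<lambda>y. a * \<phi> y + b * \<psi> y) = a * L \<phi> + b * L \<psi>"
proof -
  have "\<forall>\<phi>\<in>G0 M x1 \<epsilon> \<beta> \<gamma>. \<forall>\<psi>\<in>G0 M x1 \<epsilon> \<beta> \<gamma>. \<forall>a b. L (\<lambda>y. a * \<phi> y + b * \<psi> y) = a * L \<phi> + b * L \<psi>"
    using assms(1) unfolding G0_dual_def mem_Collect_eq by (rule conjunct1)
  from this[rule_format, OF assms(2,3)] show ?thesis .
qed

lemma G0_diff_smooth:
  assumes "\<phi> \<in> G0 M x1 \<epsilon> \<beta> \<gamma>" "smooth g"
  shows "(\<lambda>y. \<phi> y - g y) \<in> G0 M x1 \<epsilon> \<beta> \<gamma>"
proof -
  obtain B where "test_bound M x1 1 \<beta> \<gamma> \<phi> B"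
    using assms(1) G_bound_test_bound[of 1 x1 \<beta> \<gamma> \<phi>] unfolding G0_def G_set_def by auto
  moreover obtain B' where "test_bound M x1 1 \<beta> \<gamma> g B'" using smooth_test_bound[OF _ assms(2), of 1 x1] by auto
  ultimately have "G_bound M x1 1 \<beta> \<gamma> (\<lambda>y. \<phi> y - g y) (2 * (B + B'))"
    by (intro test_bound_G_bound test_bound_diff) auto
  then have "(\<lambda>y. \<phi> y - g y) \<in> G_set M x1 1 \<beta> \<gamma>" by (auto simp: G_set_def)
  moreover have "\<exists>g'\<in>G_set M x1 1 \<epsilon> \<epsilon>. G_norm M x1 1 \<beta> \<gamma> (\<lambda>y. \<phi> y - g y - g' y) < \<delta>" if \<delta>: "\<delta> > 0" for \<delta>
  proof -
    obtain g' where g': "g' \<in> G_set M x1 1 \<epsilon> \<epsilon>" "G_norm M x1 1 \<beta> \<gamma> (\<lambda>y. \<phi> y - g' y) < \<delta>"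
      using G0_approx[OF assms(1) \<delta>] by blast
    have "(\<lambda>y. g' y - g y) \<in> G_set M x1 1 \<epsilon> \<epsilon>"
      by (rule smooth_G_set[OF smooth_diff[OF G_set_smooth[OF g'(1)] assms(2)]])
    moreover have "(\<lambda>y. \<phi> y - g y - (g' y - g y)) = (\<lambda>y. \<phi> y - g' y)" by auto
    ultimately show ?thesis using g'(2) by (intro bexI[of _ "\<lambda>y. g' y - g y"]) auto
  qed
  ultimately show ?thesis by (simp add: G0_def)
qed

text \<open>A smooth approximant satisfies the test bound of \<phi> up to an error proportional to
  \<delta>. Moving that error from the centre \<open>x1\<close> to \<open>x\<close> and
  \<open>r\<close> costs a constant depending on both, whose contribution vanishes with
  \<delta>.\<close>

lemma G0_estimate:
  assumes q: "0 < q" "q < 1" "(n + \<beta>) * (1 - q) < \<beta>"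
  shows "\<exists>C\<ge>0. \<forall>L\<in>dual. \<forall>x r H. \<forall>\<phi>\<in>G0 M x1 \<epsilon> \<beta> \<gamma>. \<forall>B. 0 < r \<longrightarrow> controlled q L x H \<longrightarrow>
     test_bound M x r \<beta> \<gamma> \<phi> B \<longrightarrow> \<bar>L \<phi>\<bar> \<le> C * B * H powr (1 / q)"
proof -
  obtain C where C: "C \<ge> 0 \<and> (\<forall>L\<in>dual. \<forall>x r H \<phi> B. 0 < r \<longrightarrow> controlled q L x H \<longrightarrow> smooth \<phi> \<longrightarrow>
     test_bound M x r \<beta> \<gamma> \<phi> B \<longrightarrow> \<bar>L \<phi>\<bar> \<le> C * B * H powr (1 / q))"
    using smooth_estimate[OF q] by (elim exE) (rule that)
  note C = conjunct1[OF C] conjunct2[OF C, rule_format]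
  have "\<bar>L \<phi>\<bar> \<le> C * B * H powr (1 / q)"
    if L: "L \<in> dual" and r: "0 < r" and c: "controlled q L x H" and \<phi>: "\<phi> \<in> G0 M x1 \<epsilon> \<beta> \<gamma>" "test_bound M x r \<beta> \<gamma> \<phi> B" for L x r H \<phi> B
  proof -
    obtain CL where CL: "CL \<ge> 0" "\<And>\<phi> b. \<phi> \<in> G0 M x1 \<epsilon> \<beta> \<gamma> \<Longrightarrow> test_bound M x r \<beta> \<gamma> \<phi> b \<Longrightarrow> \<bar>L \<phi>\<bar> \<le> CL * b"
      using dual_bounded[OF L r, of x] by auto
    obtain C' where C': "C' > 0" "\<And>f B. test_bound M x1 1 \<beta> \<gamma> f B \<Longrightarrow> test_bound M x r \<beta> \<gamma> f (C' * B)"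
      using test_bound_change[of r 1 \<beta> \<gamma> x1 x] r params by auto
    define E where "E = (C * H powr (1 / q) + CL) * (C' * (C1 * 2 powr n))"
    have E: "E \<ge> 0" unfolding E_def using C(1) CL(1) C'(1) C1_ge by auto
    have step: "\<bar>L \<phi>\<bar> \<le> C * B * H powr (1 / q) + E * \<delta>" if \<delta>: "\<delta> > 0" for \<delta>
    proof -
      obtain g where g: "g \<in> G_set M x1 1 \<epsilon> \<epsilon>" "G_norm M x1 1 \<beta> \<gamma> (\<lambda>y. \<phi> y - g y) < \<delta>"
        using G0_approx[OF \<phi>(1) \<delta>] by blast
      have smg: "smooth g" by (rule G_set_smooth[OF g(1)])
      have d0: "(\<lambda>y. \<phi> y - g y) \<in> G0 M x1 \<epsilon> \<beta> \<gamma>" by (rule G0_diff_smooth[OF \<phi>(1) smg])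
      then obtain c' where c': "c' < \<delta>" "G_bound M x1 1 \<beta> \<gamma> (\<lambda>y. \<phi> y - g y) c'"
        using G_norm_less[OF G0_G_set[OF d0] g(2)] by blast
      define w where "w = C' * (C1 * 2 powr n * c')"
      have tb: "test_bound M x r \<beta> \<gamma> (\<lambda>y. \<phi> y - g y) w"
        unfolding w_def by (intro C' G_bound_test_bound c') simp
      have w: "w \<le> C' * (C1 * 2 powr n) * \<delta>" unfolding w_def mult.assoc using C' c' C1_ge by (intro mult_left_mono) auto
      have "test_bound M x r \<beta> \<gamma> g (B + w)" using test_bound_diff[OF \<phi>(2) tb] by simp
      then have 1: "\<bar>L g\<bar> \<le> C * (B + w) * H powr (1 / q)" by (rule C(2)[OF L r c smg])
      have 2: "\<bar>L (\<lambda>y. \<phi> y - g y)\<bar> \<le> CL * w" by (rule CL(2)[OF d0 tb])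
      have "L (\<lambda>y. 1 * \<phi> y + (-1) * g y) = 1 * L \<phi> + (-1) * L g"
        by (rule dual_linear_G0[OF L \<phi>(1) smooth_G0[OF smg]])
      then have "L \<phi> = L g + L (\<lambda>y. \<phi> y - g y)" by simp
      then have "\<bar>L \<phi>\<bar> \<le> C * B * H powr (1 / q) + (C * H powr (1 / q) + CL) * w"
        using 1 2 by (simp add: algebra_simps)
      also have "\<dots> \<le> C * B * H powr (1 / q) + (C * H powr (1 / q) + CL) * (C' * (C1 * 2 powr n) * \<delta>)"
        using C(1) CL(1) w by (intro add_left_mono mult_left_mono) auto
      finally show ?thesis by (simp add: E_def mult.assoc)
    qed
    show ?thesis
    proof (rule field_le_epsilon)
      fix e :: real assume e: "e > 0"
      have "E * (e / (E + 1)) \<le> e" using E e by (simp add: field_simps)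
      then show "\<bar>L \<phi>\<bar> \<le> C * B * H powr (1 / q) + e" using step[of "e / (E + 1)"] e E by simp
    qed
  qed
  note est = this
  show ?thesis by (intro exI[of _ C] conjI ballI allI impI C(1) est; assumption)
qed

end

section \<open>The Hardy--Littlewood maximal function\<close>

text \<open>Greedy selection: take a ball of largest radius and discard every ball that meets it.
  The discarded ones lie in the ball of three times that radius, and induction handles the
  others.\<close>

lemma finite_vitali:
  fixes F :: "('a::metric_space \<times> real) set"
  assumes "finite F" "\<forall>p\<in>F. snd p > 0"
  shows "\<exists>G\<subseteq>F. (\<forall>p\<in>G. \<forall>p'\<in>G. p \<noteq> p' \<longrightarrow> ball (fst p) (snd p) \<inter> ball (fst p') (snd p') = {}) \<and>
     (\<Union>p\<in>F. ball (fst p) (snd p)) \<subseteq> (\<Union>p\<in>G. ball (fst p) (3 * snd p))"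
  using assms
proof (induction F rule: finite_psubset_induct)
  case (psubset F)
  show ?case
  proof (cases "F = {}")
    case False
    then have "Max (snd ` F) \<in> snd ` F" using psubset.hyps by (intro Max_in) auto
    then obtain m where m1: "m \<in> F" "Max (snd ` F) = snd m" by blast
    have m: "m \<in> F" "\<And>p. p \<in> F \<Longrightarrow> snd p \<le> snd m"
      using psubset.hyps m1 by (auto simp flip: m1(2))
    define F' where "F' = {p \<in> F. ball (fst p) (snd p) \<inter> ball (fst m) (snd m) = {}}"
    have "fst m \<in> ball (fst m) (snd m)" using psubset.prems m by auto
    then have "m \<notin> F'" by (auto simp: F'_def)
    moreover have "F' \<subseteq> F" by (auto simp: F'_def)
    ultimately have "F' \<subset> F" using m(1) by blast
    have pos: "\<forall>p\<in>F'. snd p > 0" using psubset.prems by (simp add: F'_def)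
    obtain G where G0: "G \<subseteq> F' \<and> (\<forall>p\<in>G. \<forall>p'\<in>G. p \<noteq> p' \<longrightarrow> ball (fst p) (snd p) \<inter> ball (fst p') (snd p') = {}) \<and>
       (\<Union>p\<in>F'. ball (fst p) (snd p)) \<subseteq> (\<Union>p\<in>G. ball (fst p) (3 * snd p))"
      using psubset.IH[OF \<open>F' \<subset> F\<close> pos] by (elim exE) (rule that)
    note G = conjunct1[OF G0] conjunct1[OF conjunct2[OF G0], rule_format] conjunct2[OF conjunct2[OF G0]]
    have sub: "ball (fst p) (snd p) \<subseteq> ball (fst m) (3 * snd m)" if p: "p \<in> F" "p \<notin> F'" for p
    proof
      fix z assume z: "z \<in> ball (fst p) (snd p)"
      obtain w where w: "dist (fst p) w < snd p" "dist (fst m) w < snd m" using p by (auto simp: F'_def)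
      have "dist (fst m) z \<le> dist (fst m) w + dist w z" by (rule dist_triangle)
      also have "dist w z \<le> dist (fst p) w + dist (fst p) z" using dist_triangle[of w z "fst p"] by (simp add: dist_commute)
      finally show "z \<in> ball (fst m) (3 * snd m)" using w z m(2)[OF p(1)] by simp
    qed
    show ?thesis
    proof (intro exI[of _ "insert m G"] conjI ballI impI)
      show "insert m G \<subseteq> F" using G(1) m(1) by (auto simp: F'_def)
      show "(\<Union>p\<in>F. ball (fst p) (snd p)) \<subseteq> (\<Union>p\<in>insert m G. ball (fst p) (3 * snd p))"
      proof
        fix z assume "z \<in> (\<Union>p\<in>F. ball (fst p) (snd p))"
        then obtain p where p: "p \<in> F" "z \<in> ball (fst p) (snd p)" by blast
        show "z \<in> (\<Union>p\<in>insert m G. ball (fst p) (3 * snd p))"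
        proof (cases "p \<in> F'")
          case True then show ?thesis using G(3) p(2) by blast
        next
          case False then show ?thesis using sub[OF p(1)] p(2) by blast
        qed
      qed
      fix p p' assume "p \<in> insert m G" "p' \<in> insert m G" "p \<noteq> p'"
      then show "ball (fst p) (snd p) \<inter> ball (fst p') (snd p') = {}"
        using G(1,2) unfolding F'_def by blast
    qed
  qed auto
qed

section \<open>Powers of extended nonnegative numbers and the layer-cake bound\<close>

lemma enn_powr_mono: "a \<le> b \<Longrightarrow> 0 \<le> q \<Longrightarrow> enn_powr a q \<le> enn_powr b q"
  unfolding enn_powr_def by (auto simp: top_unique less_top intro!: ennreal_leI powr_mono2 enn2real_mono)

lemma enn_powr_ennreal: "c \<ge> 0 \<Longrightarrow> enn_powr (ennreal c) q = ennreal (c powr q)"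
  by (simp add: enn_powr_def)

lemma enn_powr_top[simp]: "enn_powr \<infinity> q = \<infinity>" "enn_powr top q = \<infinity>"
  by (simp_all add: enn_powr_def)

lemma enn_powr_mult:
  assumes "c > 0" shows "enn_powr (ennreal c * y) q = ennreal (c powr q) * enn_powr y q"
proof (cases y)
  case (real r)
  then show ?thesis using assms by (simp add: enn_powr_ennreal powr_mult ennreal_mult' flip: ennreal_mult')
next
  case top then show ?thesis using assms by (simp add: ennreal_mult_top)
qed

lemma enn_powr_powr: "enn_powr (enn_powr y q) s = enn_powr y (q * s)"
  by (cases y) (auto simp: enn_powr_ennreal powr_powr)

lemma enn_powr_measurable[measurable]: "(\<lambda>a. enn_powr a q) \<in> borel_measurable borel"
  unfolding enn_powr_def by measurable

lemma nn_integral_powr: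
  assumes "a > -1" "c \<ge> 0"
  shows "(\<integral>\<^sup>+t. ennreal (t powr a) * indicator {0..c} t \<partial>lborel) = ennreal (c powr (a + 1) / (a + 1))"
  by (rule nn_integral_has_integral_lebesgue'[OF _ has_integral_powr_from_0[OF assms]]) auto

text \<open>For finite \<open>y\<close> this is the integral of a power function up to
  \<open>y\<close>. For infinite \<open>y\<close> the finite case bounds the right side below by
  every real number; against a supposed value \<open>b\<close> it is used at
  \<open>(b + 1) powr (1 / q)\<close>.\<close>

lemma layer_cake:
  assumes q: "q > 1"
  shows "enn_powr y q \<le> (\<integral>\<^sup>+t. ennreal (q * t powr (q - 1)) * indicator {t. 0 < t \<and> ennreal t \<le> y} t \<partial>lborel)"
proof -
  have fin: "enn_powr (ennreal c) q \<le> (\<integral>\<^sup>+t. ennreal (q * t powr (q - 1)) * indicator {t. 0 < t \<and> ennreal t \<le> y} t \<partial>lborel)"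
    if c: "c \<ge> 0" "ennreal c \<le> y" for c
  proof -
    have "enn_powr (ennreal c) q = ennreal q * ennreal (c powr (q - 1 + 1) / (q - 1 + 1))"
      using c q by (simp add: enn_powr_ennreal flip: ennreal_mult')
    also have "\<dots> = ennreal q * (\<integral>\<^sup>+t. ennreal (t powr (q - 1)) * indicator {0..c} t \<partial>lborel)"
      using q c by (subst nn_integral_powr) auto
    also have "\<dots> = (\<integral>\<^sup>+t. ennreal q * (ennreal (t powr (q - 1)) * indicator {0..c} t) \<partial>lborel)"
      by (rule nn_integral_cmult[symmetric]) measurable
    also have "\<dots> \<le> (\<integral>\<^sup>+t. ennreal (q * t powr (q - 1)) * indicator {t. 0 < t \<and> ennreal t \<le> y} t \<partial>lborel)"
    proof (rule nn_integral_mono)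
      fix t :: real
      show "ennreal q * (ennreal (t powr (q - 1)) * indicator {0..c} t) \<le> ennreal (q * t powr (q - 1)) * indicator {t. 0 < t \<and> ennreal t \<le> y} t"
      proof (cases "0 < t \<and> t \<le> c")
        case True
        then have "ennreal t \<le> y" using c(2) ennreal_leI order_trans by blast
        then show ?thesis using True q by (simp add: ennreal_mult')
      next
        case False
        then have z: "ennreal (t powr (q - 1)) * indicator {0..c} t = 0" by (cases "t = 0") (auto simp: indicator_def)
        show ?thesis unfolding z by simp
      qed
    qed
    finally show ?thesis .
  qed
  show ?thesis
  proof (cases y)
    case (real c) then show ?thesis using fin[of c] by simp
  next
    case top
    let ?I = "\<integral>\<^sup>+t. ennreal (q * t powr (q - 1)) * indicator {t. 0 < t \<and> ennreal t \<le> y} t \<partial>lborel"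
    have "?I = \<infinity>"
    proof (rule ccontr)
      assume "?I \<noteq> \<infinity>"
      then obtain b where b: "?I = ennreal b" "b \<ge> 0" by (cases ?I) auto
      have "enn_powr (ennreal ((b + 1) powr (1 / q))) q \<le> ennreal b"
        using fin[of "(b + 1) powr (1 / q)"] b top by simp
      then show False using b q by (simp add: enn_powr_ennreal powr_powr)
    qed
    then show ?thesis by simp
  qed
qed

section \<open>The maximal operator over countably many balls\<close>

context doubling_measure
begin

text \<open>Balls of integer radius have finite covers of every mesh \<open>1 / Suc j\<close>; the
  centres of all these covers form the dense set.\<close>

lemma separable: "\<exists>D::'a set. countable D \<and> (\<forall>x. \<forall>\<delta>>0. \<exists>c\<in>D. dist c x < \<delta>)"
proof -
  obtain x0 :: 'a where True by simp
  have "\<exists>F. finite F \<and> ball x0 (real i) \<subseteq> (\<Union>c\<in>F. ball c (1 / real (Suc j)))" for i j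
    by (rule totally_bounded_ball) simp
  then obtain F where F: "\<And>i j. finite (F i j)" "\<And>i j. ball x0 (real i) \<subseteq> (\<Union>c\<in>F i j. ball c (1 / real (Suc j)))"
    by metis
  define D where "D = (\<Union>i. \<Union>j. F i j)"
  have "countable D" unfolding D_def using F(1) by (intro countable_UN) (auto intro: countable_finite)
  moreover have "\<exists>c\<in>D. dist c x < \<delta>" if "\<delta> > 0" for x \<delta>
  proof -
    obtain i where "dist x0 x < real i" using reals_Archimedean2 by blast
    moreover obtain j where "1 / real (Suc j) < \<delta>" using nat_approx_posE[OF \<open>\<delta> > 0\<close>] by (auto simp: inverse_eq_divide)
    moreover obtain c where "c \<in> F i j" "x \<in> ball c (1 / real (Suc j))"
      using F(2)[of i j] \<open>dist x0 x < real i\<close> by (blast intro: mem_ball[THEN iffD2])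
    ultimately have "c \<in> D" "dist c x < \<delta>" unfolding D_def by auto
    then show ?thesis by blast
  qed
  ultimately show ?thesis by blast
qed

definition centers :: "'a set" where
  "centers = (SOME D. countable D \<and> (\<forall>x. \<forall>\<delta>>0. \<exists>c\<in>D. dist c x < \<delta>))"

lemma centers: "countable centers" "\<delta> > 0 \<Longrightarrow> \<exists>c\<in>centers. dist c x < \<delta>"
  using someI_ex[OF separable] unfolding centers_def by auto

definition avg :: "('a \<Rightarrow> ennreal) \<Rightarrow> 'a \<Rightarrow> real \<Rightarrow> ennreal" where
  "avg h c r = ennreal (1 / V c r) * (\<integral>\<^sup>+z. h z * indicator (ball c r) z \<partial>M)"

text \<open>Only countably many balls are used, which makes measurability and the passage to finite
  subfamilies immediate.\<close>

definition HM :: "('a \<Rightarrow> ennreal) \<Rightarrow> 'a \<Rightarrow> ennreal" where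
  "HM h x = (SUP p\<in>centers \<times> (UNIV :: int set). avg h (fst p) (dk (snd p)) * indicator (ball (fst p) (dk (snd p))) x)"

lemma HM_measurable[measurable]: "HM h \<in> borel_measurable M"
  unfolding HM_def by (intro borel_measurable_SUP) (auto simp: centers)

lemma avg_times: "r > 0 \<Longrightarrow> ennreal (V c r) * avg h c r = (\<integral>\<^sup>+z. h z * indicator (ball c r) z \<partial>M)"
  using V_pos[of r c] unfolding avg_def by (simp add: mult.assoc[symmetric] flip: ennreal_mult')

definition Kd :: real where "Kd = C1 * 5 powr n"

lemma Kd_pos: "Kd > 0" unfolding Kd_def using C1_ge by simp

text \<open>A radius \<open>dk i\<close> between \<open>2 * t\<close> and \<open>4 * t\<close> and a
  centre within \<open>t\<close> of \<open>x\<close> give a ball that contains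
  \<open>ball x t\<close> and lies in the ball of radius \<open>5 * t\<close> around
  \<open>x\<close>; this is the 5 in \<open>Kd\<close>.\<close>

lemma integral_ball_le_HM:
  assumes t: "t > 0"
  shows "(\<integral>\<^sup>+z. h z * indicator (ball x t) z \<partial>M) \<le> ennreal (V x t) * (ennreal Kd * HM h x)"
proof -
  obtain i where i: "dk i \<le> 4 * t" "4 * t < 2 * dk i" using dk_bracket[of "4 * t"] t by auto
  obtain c where c: "c \<in> centers" "dist c x < t" using centers(2)[OF t] by blast
  have sub: "ball x t \<subseteq> ball c (dk i)"
  proof
    fix z assume "z \<in> ball x t"
    then show "z \<in> ball c (dk i)" using c i dist_triangle[of c z x] by simp
  qed
  have "(\<integral>\<^sup>+z. h z * indicator (ball x t) z \<partial>M) \<le> (\<integral>\<^sup>+z. h z * indicator (ball c (dk i)) z \<partial>M)"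
    using sub by (intro nn_integral_mono mult_left_mono) (auto simp: indicator_def)
  also have "\<dots> = ennreal (V c (dk i)) * avg h c (dk i)" using avg_times[OF dk_pos] by simp
  also have "\<dots> \<le> ennreal (Kd * V x t) * HM h x"
  proof (intro mult_mono ennreal_leI)
    show "V c (dk i) \<le> Kd * V x t" unfolding Kd_def using t c i by (intro V_change) auto
    have "x \<in> ball c (dk i)" using c i t by simp
    then have "avg h c (dk i) = avg h (fst (c, i)) (dk (snd (c, i))) * indicator (ball (fst (c, i)) (dk (snd (c, i)))) x" by simp
    also have "\<dots> \<le> HM h x" unfolding HM_def using c by (intro SUP_upper) auto
    finally show "avg h c (dk i) \<le> HM h x" .
  qed auto
  also have "\<dots> = ennreal (V x t) * (ennreal Kd * HM h x)"
    using Kd_pos by (simp add: ennreal_mult' mult_ac)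
  finally show ?thesis .
qed

definition Kw :: real where "Kw = C1 * 3 powr n"

lemma Kw_pos: "Kw > 0" unfolding Kw_def using C1_ge by simp

text \<open>After the Vitali selection the balls are disjoint, so the integrals over them add up to
  at most the total, while the tripled balls still cover at the cost
  \<open>3 powr n\<close>.\<close>

lemma weak_type_finite:
  assumes [measurable]: "g \<in> borel_measurable M" and a: "a > 0" and F: "finite F"
    and avg: "\<And>p. p \<in> F \<Longrightarrow> snd p > 0 \<and> ennreal a \<le> avg g (fst p) (snd p)"
  shows "emeasure M (\<Union>p\<in>F. ball (fst p) (snd p)) \<le> ennreal (Kw / a) * (\<integral>\<^sup>+z. g z \<partial>M)"
proof -
  have pos: "\<forall>p\<in>F. snd p > 0" using avg by blast
  obtain G where G0: "G \<subseteq> F \<and> (\<forall>p\<in>G. \<forall>p'\<in>G. p \<noteq> p' \<longrightarrow> ball (fst p) (snd p) \<inter> ball (fst p') (snd p') = {}) \<and>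
       (\<Union>p\<in>F. ball (fst p) (snd p)) \<subseteq> (\<Union>p\<in>G. ball (fst p) (3 * snd p))"
    using finite_vitali[OF F pos] by (elim exE) (rule that)
  note G = conjunct1[OF G0] conjunct1[OF conjunct2[OF G0], rule_format] conjunct2[OF conjunct2[OF G0]]
  have fG: "finite G" using F G(1) finite_subset by blast
  have one: "emeasure M (ball (fst p) (3 * snd p)) \<le> ennreal (Kw / a) * (\<integral>\<^sup>+z. g z * indicator (ball (fst p) (snd p)) z \<partial>M)"
    if "p \<in> G" for p
  proof -
    have p: "snd p > 0" "ennreal a \<le> avg g (fst p) (snd p)" using avg[of p] G(1) that by blast+
    have "V (fst p) (3 * snd p) \<le> Kw * V (fst p) (snd p)" unfolding Kw_def using p by (intro V_change) auto
    then have "emeasure M (ball (fst p) (3 * snd p)) \<le> ennreal ((Kw / a) * (V (fst p) (snd p) * a))"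
      using a by (simp add: emeasure_ball ennreal_leI)
    also have "\<dots> = ennreal (Kw / a) * (ennreal (V (fst p) (snd p)) * ennreal a)"
      using a Kw_pos by (simp add: ennreal_mult' flip: ennreal_mult')
    also have "\<dots> \<le> ennreal (Kw / a) * (ennreal (V (fst p) (snd p)) * avg g (fst p) (snd p))"
      by (intro mult_left_mono p) auto
    finally show ?thesis using avg_times[OF p(1)] by simp
  qed
  have "emeasure M (\<Union>p\<in>F. ball (fst p) (snd p)) \<le> emeasure M (\<Union>p\<in>G. ball (fst p) (3 * snd p))"
    using fG by (intro emeasure_mono G(3)) auto
  also have "\<dots> \<le> (\<Sum>p\<in>G. emeasure M (ball (fst p) (3 * snd p)))"
    using fG by (intro emeasure_subadditive_finite) auto
  also have "\<dots> \<le> (\<Sum>p\<in>G. ennreal (Kw / a) * (\<integral>\<^sup>+z. g z * indicator (ball (fst p) (snd p)) z \<partial>M))"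
    by (intro sum_mono one)
  also have "\<dots> = ennreal (Kw / a) * (\<integral>\<^sup>+z. (\<Sum>p\<in>G. g z * indicator (ball (fst p) (snd p)) z) \<partial>M)"
    by (subst nn_integral_sum) (auto simp: sum_distrib_left)
  also have "\<dots> \<le> ennreal (Kw / a) * (\<integral>\<^sup>+z. g z \<partial>M)"
  proof (intro mult_left_mono nn_integral_mono)
    fix z
    have "(\<Sum>p\<in>G. g z * indicator (ball (fst p) (snd p)) z) = g z * (\<Sum>p\<in>G. indicator (ball (fst p) (snd p)) z)"
      by (simp add: sum_distrib_left)
    also have "(\<Sum>p\<in>G. indicator (ball (fst p) (snd p)) z :: ennreal) = indicator (\<Union>p\<in>G. ball (fst p) (snd p)) z"
      using fG G(2) by (intro indicator_UN_disjoint[symmetric]) (auto simp: disjoint_family_on_def)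
    also have "g z * \<dots> \<le> g z" by (simp add: indicator_def)
    finally show "(\<Sum>p\<in>G. g z * indicator (ball (fst p) (snd p)) z) \<le> g z" .
  qed auto
  finally show ?thesis .
qed

text \<open>Where \<open>HM\<close> exceeds the level, a ball of the countable family witnesses it.
  The level set is thus inside a countable union whose measure is the limit over finite unions, and
  the finite bound is uniform.\<close>

lemma weak_type:
  assumes g: "g \<in> borel_measurable M" and a: "a > 0"
  shows "emeasure M {x. ennreal a < HM g x} \<le> ennreal (Kw / a) * (\<integral>\<^sup>+z. g z \<partial>M)"
proof -
  define J where "J = {p \<in> centers \<times> (UNIV :: int set). ennreal a < avg g (fst p) (dk (snd p))}"
  define B where "B p = ball (fst p) (dk (snd p))" for p :: "'a \<times> int"
  have cJ: "countable J" unfolding J_def by (rule countable_subset[of _ "centers \<times> UNIV"]) (auto simp: centers)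
  have eq: "{x. ennreal a < HM g x} \<subseteq> (\<Union>p\<in>J. B p)"
  proof
    fix x assume "x \<in> {x. ennreal a < HM g x}"
    then obtain p where p: "p \<in> centers \<times> UNIV"
        "ennreal a < avg g (fst p) (dk (snd p)) * indicator (ball (fst p) (dk (snd p))) x"
      unfolding HM_def mem_Collect_eq less_SUP_iff by blast
    then have "x \<in> B p" unfolding B_def by (cases "x \<in> ball (fst p) (dk (snd p))") simp_all
    moreover have "p \<in> J" using p \<open>x \<in> B p\<close> by (simp add: J_def B_def)
    ultimately show "x \<in> (\<Union>p\<in>J. B p)" by blast
  qed
  have fin: "emeasure M (\<Union>p\<in>F. B p) \<le> ennreal (Kw / a) * (\<integral>\<^sup>+z. g z \<partial>M)" if "finite F" "F \<subseteq> J" for F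
  proof -
    have "(\<Union>p\<in>F. B p) = (\<Union>p\<in>(\<lambda>p. (fst p, dk (snd p))) ` F. ball (fst p) (snd p))" by (simp add: B_def)
    also have "emeasure M \<dots> \<le> ennreal (Kw / a) * (\<integral>\<^sup>+z. g z \<partial>M)"
      using that dk_pos by (intro weak_type_finite g a) (auto simp: J_def less_imp_le)
    finally show ?thesis .
  qed
  have "emeasure M (\<Union>p\<in>J. B p) \<le> ennreal (Kw / a) * (\<integral>\<^sup>+z. g z \<partial>M)"
  proof (cases "J = {}")
    case False
    define A where "A k = (\<Union>j<k. B (from_nat_into J j))" for k :: nat
    have "(\<Union>p\<in>J. B p) = (\<Union>k. A k)"
    proof -
      have "(\<Union>p\<in>J. B p) = (\<Union>j. B (from_nat_into J j))"
        by (subst (1) range_from_nat_into[OF False cJ, symmetric]) simp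
      also have "\<dots> = (\<Union>k. A k)" unfolding A_def by blast
      finally show ?thesis .
    qed
    moreover have "(SUP k. emeasure M (A k)) = emeasure M (\<Union>k. A k)"
    proof (rule SUP_emeasure_incseq)
      show "incseq A" unfolding incseq_def A_def by (intro allI impI UN_mono) auto
    qed (auto simp: A_def B_def)
    moreover have "emeasure M (A k) \<le> ennreal (Kw / a) * (\<integral>\<^sup>+z. g z \<partial>M)" for k
    proof -
      have "A k = (\<Union>p\<in>from_nat_into J ` {..<k}. B p)" by (simp add: A_def)
      then show ?thesis using fin[of "from_nat_into J ` {..<k}"] from_nat_into[OF False] by auto
    qed
    ultimately show ?thesis by (simp add: SUP_le_iff flip: \<open>(SUP k. emeasure M (A k)) = emeasure M (\<Union>k. A k)\<close>)
  qed simp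
  moreover have "emeasure M {x. ennreal a < HM g x} \<le> emeasure M (\<Union>p\<in>J. B p)"
    using cJ by (intro emeasure_mono eq) (auto simp: B_def)
  ultimately show ?thesis by (rule order_trans[rotated])
qed

text \<open>The part of \<open>h\<close> that is at most \<open>b\<close> has averages at most
  \<open>b\<close> over every ball.\<close>

lemma HM_truncate:
  assumes [measurable]: "h \<in> borel_measurable M"
  shows "HM h x \<le> HM (\<lambda>z. h z * indicator {z. b < h z} z) x + b"
  unfolding HM_def[of h]
proof (rule SUP_least)
  fix p :: "'a \<times> int" assume p: "p \<in> centers \<times> UNIV"
  define c r where "c = fst p" and "r = dk (snd p)"
  have r: "r > 0" using dk_pos by (simp add: r_def)
  let ?h1 = "\<lambda>z. h z * indicator {z. b < h z} z"
  have "(\<integral>\<^sup>+z. h z * indicator (ball c r) z \<partial>M) \<le> (\<integral>\<^sup>+z. ?h1 z * indicator (ball c r) z + b * indicator (ball c r) z \<partial>M)"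
    by (intro nn_integral_mono) (auto simp: indicator_def not_less)
  also have "\<dots> = (\<integral>\<^sup>+z. ?h1 z * indicator (ball c r) z \<partial>M) + b * emeasure M (ball c r)"
    by (subst nn_integral_add) (auto simp: nn_integral_cmult)
  finally have "avg h c r \<le> avg ?h1 c r + ennreal (1 / V c r) * (b * emeasure M (ball c r))"
    unfolding avg_def distrib_left[symmetric] by (intro mult_left_mono) auto
  also have "ennreal (1 / V c r) * (b * emeasure M (ball c r)) = b * (ennreal (1 / V c r) * ennreal (V c r))"
    by (simp add: emeasure_ball mult_ac)
  also have "\<dots> = b" using V_pos[OF r, of c] by (simp flip: ennreal_mult')
  finally have a: "avg h c r \<le> avg ?h1 c r + b" .
  have "avg ?h1 c r * indicator (ball c r) x \<le> HM ?h1 x"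
    unfolding HM_def c_def r_def by (rule SUP_upper[OF p])
  then have "avg h c r * indicator (ball c r) x \<le> HM ?h1 x + b"
    using a by (auto simp: indicator_def intro: order_trans add_right_mono)
  then show "avg h (fst p) (dk (snd p)) * indicator (ball (fst p) (dk (snd p))) x \<le> HM ?h1 x + b"
    by (simp add: c_def r_def)
qed

lemma sigma_finite_M: "sigma_finite_measure M"
proof
  obtain x0 :: 'a where True by simp
  show "\<exists>A. countable A \<and> A \<subseteq> sets M \<and> \<Union> A = space M \<and> (\<forall>a\<in>A. emeasure M a \<noteq> \<infinity>)"
  proof (rule exI[of _ "range (\<lambda>i::nat. ball x0 (real i))"], intro conjI ballI)
    have "x \<in> \<Union> (range (\<lambda>i::nat. ball x0 (real i)))" for x
      using reals_Archimedean2[of "dist x0 x"] by auto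
    then show "\<Union> (range (\<lambda>i::nat. ball x0 (real i))) = space M" by auto
    show "range (\<lambda>i::nat. ball x0 (real i)) \<subseteq> sets M" by auto
    fix a assume "a \<in> range (\<lambda>i::nat. ball x0 (real i))"
    then show "emeasure M a \<noteq> \<infinity>" using ball_finite[of x0] by (auto simp: less_top)
  qed simp
qed

definition Ks :: "real \<Rightarrow> real" where "Ks q = q * (4 * Kw) * (4 powr (q - 1) / (q - 1))"

lemma Ks_pos: "q > 1 \<Longrightarrow> Ks q > 0" unfolding Ks_def using Kw_pos by simp

text \<open>Marcinkiewicz interpolation between the weak-type bound and the trivial one: at level
  \<open>t\<close> the weak-type bound is applied to the part of \<open>h\<close> above
  \<open>t / 4\<close>. After exchanging the integrals, the integral of
  \<open>t powr (q - 2)\<close> up to \<open>4 * h x\<close> remains, which converges because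
  \<open>q > 1\<close>.\<close>

theorem maximal_strong_type:
  assumes [measurable]: "h \<in> borel_measurable M" and q: "q > 1"
  shows "(\<integral>\<^sup>+x. enn_powr (HM h x) q \<partial>M) \<le> ennreal (Ks q) * (\<integral>\<^sup>+x. enn_powr (h x) q \<partial>M)"
proof -
  interpret M: sigma_finite_measure M by (rule sigma_finite_M)
  interpret P: pair_sigma_finite M lborel ..
  define w where "w t = ennreal (q * t powr (q - 1))" for t :: real
  have [measurable]: "w \<in> borel_measurable borel" unfolding w_def by measurable
  have "(\<integral>\<^sup>+x. enn_powr (HM h x) q \<partial>M) \<le> (\<integral>\<^sup>+x. \<integral>\<^sup>+t. w t * indicator {t. 0 < t \<and> ennreal t \<le> HM h x} t \<partial>lborel \<partial>M)"
    unfolding w_def by (intro nn_integral_mono layer_cake q)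
  also have "\<dots> = (\<integral>\<^sup>+x. \<integral>\<^sup>+t. (case (x, t) of (x, t) \<Rightarrow> if 0 < t \<and> ennreal t \<le> HM h x then w t else 0) \<partial>lborel \<partial>M)"
    by (intro nn_integral_cong) (auto simp: indicator_def)
  also have "\<dots> = (\<integral>\<^sup>+t. \<integral>\<^sup>+x. (case (x, t) of (x, t) \<Rightarrow> if 0 < t \<and> ennreal t \<le> HM h x then w t else 0) \<partial>M \<partial>lborel)"
    by (rule P.Fubini[symmetric]) measurable
  also have "\<dots> \<le> (\<integral>\<^sup>+t. \<integral>\<^sup>+x. (case (x, t) of (x, t) \<Rightarrow> if 0 < t \<and> ennreal (t / 4) < h x then w t * ennreal (4 * Kw / t) * h x else 0) \<partial>M \<partial>lborel)"
  proof (rule nn_integral_mono)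
    fix t :: real
    show "(\<integral>\<^sup>+x. (case (x, t) of (x, t) \<Rightarrow> if 0 < t \<and> ennreal t \<le> HM h x then w t else 0) \<partial>M)
       \<le> (\<integral>\<^sup>+x. (case (x, t) of (x, t) \<Rightarrow> if 0 < t \<and> ennreal (t / 4) < h x then w t * ennreal (4 * Kw / t) * h x else 0) \<partial>M)"
    proof (cases "t > 0")
      case True
      \<comment> \<open>Truncation at \<open>t / 4\<close> and level \<open>t / 4\<close> for the
        rest add up to \<open>t / 2\<close>, strictly below \<open>t\<close>. This slack passes from
        the weak inequality of the layer cake to the strict one of \<open>weak_type\<close>.\<close>
      define h1 where "h1 z = h z * indicator {z. ennreal (t / 4) < h z} z" for z
      have [measurable]: "h1 \<in> borel_measurable M" unfolding h1_def by measurable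
      have level_sets: "{x. ennreal t \<le> HM h x} \<in> sets M"
        using borel_measurable_le[of "\<lambda>_. ennreal t" M "HM h"] by simp
      have level_sets': "{x. ennreal (t / 4) < HM h1 x} \<in> sets M"
        using borel_measurable_less[of "\<lambda>_. ennreal (t / 4)" M "HM h1"] by simp
      have sub: "{x. ennreal t \<le> HM h x} \<subseteq> {x. ennreal (t / 4) < HM h1 x}"
      proof (rule subsetI, rule CollectI, rule ccontr)
        fix x assume x: "x \<in> {x. ennreal t \<le> HM h x}" and "\<not> ennreal (t / 4) < HM h1 x"
        then have "HM h1 x \<le> ennreal (t / 4)" by simp
        then have "HM h x \<le> ennreal (t / 4) + ennreal (t / 4)"
          using HM_truncate[of h x "ennreal (t / 4)"] unfolding h1_def[abs_def]
          by (blast intro: order_trans add_right_mono assms(1))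
        also have "\<dots> = ennreal (t / 2)" using True by (simp flip: ennreal_plus)
        finally have "ennreal t \<le> ennreal (t / 2)" using x by simp
        then show False using True by simp
      qed
      have "(\<integral>\<^sup>+x. (case (x, t) of (x, t) \<Rightarrow> if 0 < t \<and> ennreal t \<le> HM h x then w t else 0) \<partial>M)
          = (\<integral>\<^sup>+x. w t * indicator {x. ennreal t \<le> HM h x} x \<partial>M)"
        using True by (intro nn_integral_cong) (auto simp: indicator_def)
      also have "\<dots> = w t * emeasure M {x. ennreal t \<le> HM h x}"
        by (rule nn_integral_cmult_indicator) (rule level_sets)
      also have "\<dots> \<le> w t * emeasure M {x. ennreal (t / 4) < HM h1 x}"
        by (intro mult_left_mono emeasure_mono sub level_sets') simp
      also have "\<dots> \<le> w t * (ennreal (Kw / (t / 4)) * (\<integral>\<^sup>+z. h1 z \<partial>M))"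
        using True by (intro mult_left_mono weak_type) auto
      also have "\<dots> = (\<integral>\<^sup>+z. w t * ennreal (4 * Kw / t) * h1 z \<partial>M)"
        by (subst nn_integral_cmult) (auto simp: mult_ac)
      also have "\<dots> = (\<integral>\<^sup>+x. (case (x, t) of (x, t) \<Rightarrow> if 0 < t \<and> ennreal (t / 4) < h x then w t * ennreal (4 * Kw / t) * h x else 0) \<partial>M)"
        using True by (intro nn_integral_cong) (auto simp: h1_def indicator_def)
      finally show ?thesis .
    qed simp
  qed
  also have "\<dots> = (\<integral>\<^sup>+x. \<integral>\<^sup>+t. (case (x, t) of (x, t) \<Rightarrow> if 0 < t \<and> ennreal (t / 4) < h x then w t * ennreal (4 * Kw / t) * h x else 0) \<partial>lborel \<partial>M)"
    by (rule P.Fubini) measurable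
  also have "\<dots> \<le> (\<integral>\<^sup>+x. ennreal (Ks q) * enn_powr (h x) q \<partial>M)"
  proof (rule nn_integral_mono)
    fix x
    show "(\<integral>\<^sup>+t. (case (x, t) of (x, t) \<Rightarrow> if 0 < t \<and> ennreal (t / 4) < h x then w t * ennreal (4 * Kw / t) * h x else 0) \<partial>lborel)
       \<le> ennreal (Ks q) * enn_powr (h x) q"
    proof (cases "h x")
      case top then show ?thesis using Ks_pos[OF q] by (simp add: ennreal_mult_top)
    next
      case (real c)
      have "(\<integral>\<^sup>+t. (case (x, t) of (x, t) \<Rightarrow> if 0 < t \<and> ennreal (t / 4) < h x then w t * ennreal (4 * Kw / t) * h x else 0) \<partial>lborel)
        \<le> (\<integral>\<^sup>+t. ennreal (q * (4 * Kw) * c) * (ennreal (t powr (q - 2)) * indicator {0..4 * c} t) \<partial>lborel)"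
      proof (rule nn_integral_mono)
        fix t :: real
        show "(case (x, t) of (x, t) \<Rightarrow> if 0 < t \<and> ennreal (t / 4) < h x then w t * ennreal (4 * Kw / t) * h x else 0)
           \<le> ennreal (q * (4 * Kw) * c) * (ennreal (t powr (q - 2)) * indicator {0..4 * c} t)"
        proof (cases "0 < t \<and> ennreal (t / 4) < h x")
          case True
          then have "t / 4 < c" using True real ennreal_less_iff[of "t / 4" c] by simp
          then have t: "t \<in> {0..4 * c}" using True by auto
          have "t powr (q - 1) / t = t powr (q - 2)" using True powr_diff[of t "q - 1" 1] by simp
          then have "q * t powr (q - 1) * (4 * Kw / t) * c = q * (4 * Kw) * c * t powr (q - 2)"
            by (simp only: times_divide_eq_left times_divide_eq_right mult_ac flip: \<open>t powr (q - 1) / t = t powr (q - 2)\<close>)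
          then have "w t * ennreal (4 * Kw / t) * h x = ennreal (q * (4 * Kw) * c) * ennreal (t powr (q - 2))"
            unfolding w_def real using q Kw_pos True real by (simp flip: ennreal_mult')
          then show ?thesis using True t by simp
        qed auto
      qed
      also have "\<dots> = ennreal (q * (4 * Kw) * c) * ennreal ((4 * c) powr (q - 2 + 1) / (q - 2 + 1))"
        using q real by (subst nn_integral_cmult) (auto simp: nn_integral_powr)
      also have "\<dots> = ennreal (Ks q * c powr q)"
      proof -
        have "c * (4 * c) powr (q - 1) = 4 powr (q - 1) * c powr q"
        proof (cases "c = 0")
          case False
          then have "c powr q = c * c powr (q - 1)" using real powr_add[of c 1 "q - 1"] by simp
          then show ?thesis by (simp add: powr_mult)
        qed simp
        then have "q * (4 * Kw) * c * ((4 * c) powr (q - 1) / (q - 1)) = Ks q * c powr q"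
          unfolding Ks_def by (simp add: mult_ac)
        then show ?thesis using q Kw_pos real by (simp flip: ennreal_mult')
      qed
      also have "\<dots> = ennreal (Ks q) * enn_powr (h x) q"
        using real Ks_pos[OF q] by (simp add: enn_powr_ennreal ennreal_mult')
      finally show ?thesis .
    qed
  qed
  also have "\<dots> = ennreal (Ks q) * (\<integral>\<^sup>+x. enn_powr (h x) q \<partial>M)" by (rule nn_integral_cmult) measurable
  finally show ?thesis .
qed

end

section \<open>Comparison of the maximal functions\<close>

lemma Lp_enn_le:
  assumes "p > 0" "c > 0" "(\<integral>\<^sup>+x. enn_powr (u x) p \<partial>M) \<le> ennreal c * (\<integral>\<^sup>+x. enn_powr (v x) p \<partial>M)"
  shows "Lp_enn M p u \<le> ennreal (c powr (1 / p)) * Lp_enn M p v"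
  unfolding Lp_enn_def enn_powr_mult[OF assms(2), symmetric]
  using assms by (intro enn_powr_mono) auto

context hardy_params
begin

lemma radial_max_measurable:
  assumes "f \<in> dual" shows "radial_max S f \<in> borel_measurable M"
proof -
  have [measurable]: "(\<lambda>x. f (S k x)) \<in> borel_measurable M" for k
    by (intro cont_measurable continuous_dual_S assms)
  show ?thesis unfolding radial_max_def by (intro borel_measurable_SUP) auto
qed

text \<open>Where the maximal function of the power \<open>q\<close> of the radial one is finite,
  \<open>Kd\<close> times it is an admissible \<open>H\<close> in \<open>controlled\<close>; where
  it is infinite, so is the right side.\<close>

lemma grand_max_le:
  assumes q: "0 < q" "q < 1" "(n + \<beta>) * (1 - q) < \<beta>"
  shows "\<exists>C>0. \<forall>f\<in>dual. \<forall>x. grand_max M x1 \<epsilon> \<beta> \<gamma> f x \<le>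
     ennreal C * enn_powr (HM (\<lambda>z. enn_powr (radial_max S f z) q) x) (1 / q)"
proof -
  obtain C where C: "C \<ge> 0 \<and> (\<forall>L\<in>dual. \<forall>x r H. \<forall>\<phi>\<in>G0 M x1 \<epsilon> \<beta> \<gamma>. \<forall>B. 0 < r \<longrightarrow> controlled q L x H \<longrightarrow>
     test_bound M x r \<beta> \<gamma> \<phi> B \<longrightarrow> \<bar>L \<phi>\<bar> \<le> C * B * H powr (1 / q))"
    using G0_estimate[OF q] by (elim exE) (rule that)
  note C = conjunct1[OF C] conjunct2[OF C, rule_format]
  define D where "D = (C + 1) * (C1 * 2 powr n * 2) * Kd powr (1 / q)"
  have D: "D > 0" unfolding D_def using C(1) C1_ge Kd_pos by (auto intro!: mult_pos_pos)
  have "grand_max M x1 \<epsilon> \<beta> \<gamma> f x \<le> ennreal D * enn_powr (HM (\<lambda>z. enn_powr (radial_max S f z) q) x) (1 / q)"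
    if f: "f \<in> dual" for f x
  proof -
    define h where "h z = enn_powr (radial_max S f z) q" for z
    have mh: "h \<in> borel_measurable M"
      unfolding h_def by (rule measurable_compose[OF radial_max_measurable[OF f] enn_powr_measurable])
    show ?thesis
    proof (cases "HM h x")
      case top
      then show ?thesis using D by (simp add: h_def[abs_def] ennreal_mult_top)
    next
      case (real c)
      have ctrl: "controlled q f x (Kd * c)"
        unfolding controlled_def
      proof (intro conjI exI[of _ h] allI impI mh)
        show "0 \<le> Kd * c" using real Kd_pos by simp
        fix k z
        have "ennreal \<bar>f (S k z)\<bar> \<le> radial_max S f z" unfolding radial_max_def by (rule SUP_upper) simp
        from enn_powr_mono[OF this, of q] show "ennreal (\<bar>f (S k z)\<bar> powr q) \<le> h z"
          using q by (simp add: h_def enn_powr_ennreal)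
      next
        fix t :: real assume "t > 0"
        from integral_ball_le_HM[OF this, of h x] show "(\<integral>\<^sup>+z. h z * indicator (ball x t) z \<partial>M) \<le> ennreal (V x t) * ennreal (Kd * c)"
          using real Kd_pos by (simp add: ennreal_mult')
      qed
      have "grand_max M x1 \<epsilon> \<beta> \<gamma> f x \<le> ennreal (D * c powr (1 / q))"
        unfolding grand_max_def
      proof (rule SUP_least)
        fix \<phi> assume "\<phi> \<in> {\<phi> \<in> G0 M x1 \<epsilon> \<beta> \<gamma>. \<exists>r>0. \<phi> \<in> G_set M x r \<beta> \<gamma> \<and> G_norm M x r \<beta> \<gamma> \<phi> \<le> 1}"
        then obtain r where r: "\<phi> \<in> G0 M x1 \<epsilon> \<beta> \<gamma>" "r > 0" "\<phi> \<in> G_set M x r \<beta> \<gamma>" "G_norm M x r \<beta> \<gamma> \<phi> \<le> 1"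
          by blast
        \<comment> \<open>The norm is an infimum of bounds, so norm at most 1 provides a bound below
          2.\<close>
        then obtain c' where c': "c' < 2" "G_bound M x r \<beta> \<gamma> \<phi> c'"
          using G_norm_less[OF r(3), of 2] by auto
        have "test_bound M x r \<beta> \<gamma> \<phi> (C1 * 2 powr n * c')" by (rule G_bound_test_bound[OF r(2) c'(2)])
        then have "test_bound M x r \<beta> \<gamma> \<phi> (C1 * 2 powr n * 2)"
          by (rule test_bound_mono[OF r(2)]) (use c' C1_ge in auto)
        from C(2)[OF f r(1,2) ctrl this]
        have "\<bar>f \<phi>\<bar> \<le> C * (C1 * 2 powr n * 2) * (Kd powr (1 / q) * c powr (1 / q))" by (simp only: powr_mult)
        also have "\<dots> \<le> (C + 1) * (C1 * 2 powr n * 2) * (Kd powr (1 / q) * c powr (1 / q))"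
          using C1_ge by (intro mult_right_mono) auto
        finally show "ennreal \<bar>f \<phi>\<bar> \<le> ennreal (D * c powr (1 / q))" by (intro ennreal_leI) (simp add: D_def mult_ac)
      qed
      also have "\<dots> = ennreal D * enn_powr (HM h x) (1 / q)"
        using real D by (simp add: enn_powr_ennreal ennreal_mult')
      finally show ?thesis by (simp only: h_def[abs_def])
    qed
  qed
  note est = this
  show ?thesis by (rule exI[of _ D], intro conjI ballI allI D est)
qed

text \<open>The row \<open>S k x\<close>, divided by \<open>2 * Ck + 1\<close>, competes in the
  grand maximal function at scale \<open>dk k\<close>. The 2 comes from passing to the norm of the
  statement, the 1 keeps the divisor positive.\<close>

lemma radial_max_le:
  assumes f: "f \<in> dual"
  shows "radial_max S f x \<le> ennreal (2 * Ck + 1) * grand_max M x1 \<epsilon> \<beta> \<gamma> f x"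
  unfolding radial_max_def
proof (rule SUP_least)
  fix k :: int
  define c where "c = 2 * Ck + 1"
  have c: "c > 0" using Ck_nonneg by (simp add: c_def)
  define \<phi> where "\<phi> y = (1 / c) * S k x y" for y
  have sm: "smooth \<phi>" unfolding \<phi>_def by (intro smooth_scale smooth_S)
  have "test_bound M x (dk k) \<beta> \<gamma> (S k x) Ck" by (rule row_weak) (use params in auto)
  from test_bound_scale[OF this, of "1 / c"] have "test_bound M x (dk k) \<beta> \<gamma> \<phi> (1 / c * Ck)"
    using c by (simp add: \<phi>_def[abs_def])
  from test_bound_G_bound[OF dk_pos this] have gb: "G_bound M x (dk k) \<beta> \<gamma> \<phi> (2 * (1 / c * Ck))" .
  have "2 * (1 / c * Ck) \<le> 1" using c by (simp add: c_def field_simps)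
  then have "G_norm M x (dk k) \<beta> \<gamma> \<phi> \<le> 1" using G_norm_le[OF gb] by linarith
  moreover have "\<phi> \<in> G_set M x (dk k) \<beta> \<gamma>" using gb by (auto simp: G_set_def)
  ultimately have "ennreal \<bar>f \<phi>\<bar> \<le> grand_max M x1 \<epsilon> \<beta> \<gamma> f x"
    unfolding grand_max_def using smooth_G0[OF sm] dk_pos[of k] by (intro SUP_upper) blast
  moreover have "f \<phi> = (1 / c) * f (S k x)" unfolding \<phi>_def by (rule dual_linear(3)[OF f smooth_S smooth_S])
  then have "\<bar>f (S k x)\<bar> = c * \<bar>f \<phi>\<bar>" using c by (simp add: abs_mult)
  then have "ennreal \<bar>f (S k x)\<bar> = ennreal c * ennreal \<bar>f \<phi>\<bar>" using c by (simp add: ennreal_mult')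
  ultimately show "ennreal \<bar>f (S k x)\<bar> \<le> ennreal (2 * Ck + 1) * grand_max M x1 \<epsilon> \<beta> \<gamma> f x"
    unfolding c_def[symmetric] by (simp add: mult_left_mono)
qed

text \<open>\<open>q\<close> is the midpoint of \<open>n / (n + \<beta>)\<close> and
  \<open>p\<close>. Being above the former is the exponent condition of the pointwise estimate;
  being below \<open>p\<close> makes the maximal operator bounded with exponent
  \<open>p / q > 1\<close>.\<close>

lemma grand_norm_le:
  assumes p: "0 < p" "p \<le> 1" "n * (1 / p - 1) < \<beta>"
  shows "\<exists>C>0. \<forall>f\<in>dual. Lp_enn M p (grand_max M x1 \<epsilon> \<beta> \<gamma> f) \<le> ennreal C * Lp_enn M p (radial_max S f)"
proof -
  have nb: "n + \<beta> > 0" using n_pos params by simp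
  define u where "u = n / (n + \<beta>)"
  define q where "q = (u + p) / 2"
  have "n < p * (n + \<beta>)" using p by (simp add: field_simps)
  then have u: "0 < u" "u < p" using nb n_pos by (auto simp: u_def field_simps)
  have q: "0 < q" "q < p" "q < 1" "u < q" using u p by (auto simp: q_def)
  have "n < q * (n + \<beta>)" using q(4) nb by (simp add: u_def field_simps)
  then have q': "(n + \<beta>) * (1 - q) < \<beta>" by (simp add: algebra_simps)
  obtain C where C: "C > 0 \<and> (\<forall>f\<in>dual. \<forall>x. grand_max M x1 \<epsilon> \<beta> \<gamma> f x \<le>
     ennreal C * enn_powr (HM (\<lambda>z. enn_powr (radial_max S f z) q) x) (1 / q))"
    using grand_max_le[OF q(1,3) q'] by (elim exE) (rule that)
  note C = conjunct1[OF C] conjunct2[OF C, rule_format]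
  have s: "p / q > 1" using q by simp
  define D where "D = C powr p * Ks (p / q)"
  have D: "D > 0" unfolding D_def using C(1) Ks_pos[OF s] by simp
  have "Lp_enn M p (grand_max M x1 \<epsilon> \<beta> \<gamma> f) \<le> ennreal (D powr (1 / p)) * Lp_enn M p (radial_max S f)" if f: "f \<in> dual" for f
  proof (rule Lp_enn_le[OF p(1) D])
    define h where "h z = enn_powr (radial_max S f z) q" for z
    have mh[measurable]: "h \<in> borel_measurable M"
      unfolding h_def by (rule measurable_compose[OF radial_max_measurable[OF f] enn_powr_measurable])
    have "(\<integral>\<^sup>+x. enn_powr (grand_max M x1 \<epsilon> \<beta> \<gamma> f x) p \<partial>M) \<le> (\<integral>\<^sup>+x. enn_powr (ennreal C * enn_powr (HM h x) (1 / q)) p \<partial>M)"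
      unfolding h_def using p by (intro nn_integral_mono enn_powr_mono C f) auto
    also have "\<dots> = (\<integral>\<^sup>+x. ennreal (C powr p) * enn_powr (HM h x) (p / q) \<partial>M)"
      unfolding enn_powr_mult[OF C(1)] enn_powr_powr by simp
    also have "\<dots> = ennreal (C powr p) * (\<integral>\<^sup>+x. enn_powr (HM h x) (p / q) \<partial>M)"
      by (rule nn_integral_cmult) measurable
    also have "\<dots> \<le> ennreal (C powr p) * (ennreal (Ks (p / q)) * (\<integral>\<^sup>+x. enn_powr (h x) (p / q) \<partial>M))"
      by (intro mult_left_mono maximal_strong_type mh s) auto
    also have "\<dots> = ennreal D * (\<integral>\<^sup>+x. enn_powr (radial_max S f x) p \<partial>M)"
      using q Ks_pos[OF s] by (simp add: h_def enn_powr_powr D_def ennreal_mult' mult.assoc)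
    finally show "(\<integral>\<^sup>+x. enn_powr (grand_max M x1 \<epsilon> \<beta> \<gamma> f x) p \<partial>M) \<le> ennreal D * (\<integral>\<^sup>+x. enn_powr (radial_max S f x) p \<partial>M)" .
  qed
  moreover have "D powr (1 / p) > 0" using D by simp
  ultimately show ?thesis by blast
qed

text \<open>The integral of the grand maximal function is only a lower integral, as it need not be
  measurable, so the constant is kept on the side of the radial one.\<close>

lemma radial_norm_le:
  assumes p: "0 < p" and f: "f \<in> dual"
  shows "Lp_enn M p (radial_max S f) \<le> ennreal (2 * Ck + 1) * Lp_enn M p (grand_max M x1 \<epsilon> \<beta> \<gamma> f)"
proof -
  define c where "c = 2 * Ck + 1"
  have c: "c > 0" using Ck_nonneg by (simp add: c_def)
  note [measurable] = radial_max_measurable[OF f]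
  have one: "ennreal c * ennreal (1 / c) = 1" using c by (simp flip: ennreal_mult')
  have one': "ennreal (c powr p) * ennreal ((1 / c) powr p) = 1"
    using c powr_mult[of c "1 / c" p] by (simp flip: ennreal_mult')
  have pt: "ennreal (1 / c) * radial_max S f x \<le> grand_max M x1 \<epsilon> \<beta> \<gamma> f x" for x
  proof -
    have "ennreal (1 / c) * radial_max S f x \<le> ennreal (1 / c) * (ennreal c * grand_max M x1 \<epsilon> \<beta> \<gamma> f x)"
      unfolding c_def by (intro mult_left_mono radial_max_le f) auto
    also have "\<dots> = (ennreal c * ennreal (1 / c)) * grand_max M x1 \<epsilon> \<beta> \<gamma> f x" by (simp only: mult_ac)
    finally show ?thesis by (simp add: one)
  qed
  have "(\<integral>\<^sup>+x. enn_powr (radial_max S f x) p \<partial>M)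
     = ennreal (c powr p) * (ennreal ((1 / c) powr p) * (\<integral>\<^sup>+x. enn_powr (radial_max S f x) p \<partial>M))"
    by (simp add: mult.assoc[symmetric] one' del: powr_one_eq_one)
  also have "ennreal ((1 / c) powr p) * (\<integral>\<^sup>+x. enn_powr (radial_max S f x) p \<partial>M)
     = (\<integral>\<^sup>+x. enn_powr (ennreal (1 / c) * radial_max S f x) p \<partial>M)"
    using c by (subst nn_integral_cmult[symmetric]) (auto simp: enn_powr_mult)
  also have "\<dots> \<le> (\<integral>\<^sup>+x. enn_powr (grand_max M x1 \<epsilon> \<beta> \<gamma> f x) p \<partial>M)"
    using p by (intro nn_integral_mono enn_powr_mono pt) auto
  finally have "(\<integral>\<^sup>+x. enn_powr (radial_max S f x) p \<partial>M) \<le> ennreal (c powr p) * (\<integral>\<^sup>+x. enn_powr (grand_max M x1 \<epsilon> \<beta> \<gamma> f x) p \<partial>M)"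
    by (simp add: mult_left_mono)
  from Lp_enn_le[OF p _ this] show ?thesis using c p by (simp add: powr_powr c_def)
qed

end

section \<open>From the axioms of the kernels to the two-sided comparison of norms\<close>

lemma (in doubling_measure) AOTI_approx_identity:
  assumes e: "0 < e1" "e1 \<le> 1" "0 < e2" and S: "AOTI M e1 e2 e3 S"
  shows "\<exists>Ck. approx_identity M C1 n S e1 e2 Ck"
proof -
  obtain C4 where C4: "C4 > 0" and
    size: "\<And>k x y. \<bar>S k x y\<bar> \<le> C4 * (1 / (Vr M (dk k) x + Vxy M x y)) * (dk k / (dk k + dist x y)) powr e2" and
    regx: "\<And>k x x' y. dist x x' \<le> (dk k + dist x y) / 2 \<Longrightarrow>
          \<bar>S k x y - S k x' y\<bar> \<le> C4 * (dist x x' / (dk k + dist x y)) powr e1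
             * (1 / (Vr M (dk k) x + Vxy M x y)) * (dk k / (dk k + dist x y)) powr e2" and
    regy: "\<And>k x y y'. dist y y' \<le> (dk k + dist x y) / 2 \<Longrightarrow>
          \<bar>S k x y - S k x y'\<bar> \<le> C4 * (dist y y' / (dk k + dist y x)) powr e1
             * (1 / (Vr M (dk k) y + Vxy M y x)) * (dk k / (dk k + dist y x)) powr e2"
    using S unfolding AOTI_def by blast
  have norm: "\<And>k y. (\<integral>z. S k z y \<partial>M) = 1" using S by (simp add: AOTI_def)
  define K where "K = C4 * (C1 * 2 powr n)"
  define Ck where "Ck = K * Kb e2"
  have K: "K > 0" using C4 C1_ge by (simp add: K_def)
  have Kb: "Kb e2 \<ge> 1" using Kb_ge e by simp
  have CkK: "K \<le> Ck" unfolding Ck_def using K Kb mult_left_mono[of 1 "Kb e2" K] by simp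
  have le: "c * (1 / (Vr M (dk k) x + Vxy M x y)) * (dk k / (dk k + dist x y)) powr e2 \<le> c * (C1 * 2 powr n) * bump M x (dk k) e2 y"
    if "c \<ge> 0" for c k x y
    using mult_left_mono[OF bump_G(1)[OF dk_pos[of k], of x y e2] that] by (simp add: mult.assoc)
  have up: "c * K * bump M x (dk k) e2 y \<le> c * Ck * bump M x (dk k) e2 y" if "c \<ge> 0" for c k x y
    using CkK that bump_nonneg[OF dk_pos] by (intro mult_right_mono mult_left_mono) auto
  show ?thesis
  proof (rule exI[of _ Ck], unfold_locales)
    fix z k
    show "test_bound M z (dk k) e1 e2 (S k z) Ck"
    proof (rule test_boundI)
      fix y show "\<bar>S k z y\<bar> \<le> Ck * bump M z (dk k) e2 y"
        using size[of k z y] le[of C4 k z y] up[of 1 z k y] C4 by (simp add: K_def)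
    next
      fix y y' :: 'a assume d: "dist y y' \<le> (dk k + dist z y) / 2"
      let ?q = "(dist y y' / (dk k + dist y z)) powr e1"
      have "\<bar>S k z y - S k z y'\<bar> \<le> C4 * ?q * (C1 * 2 powr n) * bump M y (dk k) e2 z"
        using regy[OF d] le[of "C4 * ?q" k y z] C4 by simp
      \<comment> \<open>The axiom in the second variable is centred at \<open>y\<close>; recentring
        it at \<open>z\<close> accounts for \<open>Kb e2\<close> in the constant.\<close>
      also have "\<dots> \<le> C4 * ?q * (C1 * 2 powr n) * (Kb e2 * bump M z (dk k) e2 y)"
        using C4 C1_ge e by (intro mult_left_mono bump_swap dk_pos) auto
      finally show "\<bar>S k z y - S k z y'\<bar> \<le> Ck * (dist y y' / (dk k + dist z y)) powr e1 * bump M z (dk k) e2 y"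
        by (simp add: Ck_def K_def dist_commute mult_ac)
    qed
  next
    fix z z' y :: 'a and k assume d: "dist z z' \<le> (dk k + dist z y) / 2"
    let ?q = "(dist z z' / (dk k + dist z y)) powr e1"
    show "\<bar>S k z y - S k z' y\<bar> \<le> Ck * ?q * bump M z (dk k) e2 y"
      using regx[OF d] le[of "C4 * ?q" k z y] up[of ?q z k y] C4 by (simp add: K_def mult_ac)
  qed (use e norm in auto)
qed

theorem theorem3p1:
  fixes M :: "'a::metric_space measure"
    and n e1 e2 e3 \<epsilon> p \<beta> \<gamma> :: real
    and S :: "int \<Rightarrow> 'a \<Rightarrow> 'a \<Rightarrow> real"
    and x1 :: 'a
  assumes rd: "rd_space M n"
    and inf_meas: "emeasure M (space M) = \<infinity>"
    and e1: "0 < e1" "e1 \<le> 1" and e2: "0 < e2" and e3: "0 < e3"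
    and eps: "0 < \<epsilon>" "\<epsilon> < min e1 e2"
    and aoti: "AOTI M e1 e2 e3 S"
    and p: "n / (n + \<epsilon>) < p" "p \<le> 1"
    and beta: "n * (1 / p - 1) < \<beta>" "\<beta> < \<epsilon>"
    and gamma: "n * (1 / p - 1) < \<gamma>" "\<gamma> < \<epsilon>"
  shows "\<exists>C\<ge>1. \<forall>f \<in> G0_dual M x1 \<epsilon> \<beta> \<gamma>.
           (f \<in> hardy_space M x1 \<epsilon> \<beta> \<gamma> p \<longleftrightarrow> Lp_enn M p (radial_max S f) < \<infinity>) \<and>
           (f \<in> hardy_space M x1 \<epsilon> \<beta> \<gamma> p \<longrightarrow>
              ennreal (1 / C) * Lp_enn M p (radial_max S f) \<le> hardy_norm M x1 \<epsilon> \<beta> \<gamma> p f \<and>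
              hardy_norm M x1 \<epsilon> \<beta> \<gamma> p f \<le> ennreal C * Lp_enn M p (radial_max S f))"
proof -
  obtain C1 where C1: "hom_measure M" "doubling_with M C1 n"
    using rd unfolding rd_space_def homogeneous_type_def by blast
  interpret D: doubling_measure M C1 n by unfold_locales (rule C1)+
  obtain Ck where "approx_identity M C1 n S e1 e2 Ck"
    using D.AOTI_approx_identity[OF e1 e2 aoti] by blast
  then interpret A: approx_identity M C1 n S e1 e2 Ck .
  have p0: "0 < p" using p(1) D.n_pos eps(1) by (smt (verit) divide_pos_pos)
  \<comment> \<open>This makes \<beta> and \<gamma> positive, as the locale demands.\<close>
  have "0 \<le> n * (1 / p - 1)" using p p0 D.n_pos by (intro mult_nonneg_nonneg) auto
  then interpret H: hardy_params M C1 n S e1 e2 Ck x1 \<epsilon> \<beta> \<gamma>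
    by unfold_locales (use beta gamma eps in auto)
  obtain A where A: "A > 0" "\<And>f. f \<in> G0_dual M x1 \<epsilon> \<beta> \<gamma> \<Longrightarrow>
      hardy_norm M x1 \<epsilon> \<beta> \<gamma> p f \<le> ennreal A * Lp_enn M p (radial_max S f)"
    using H.grand_norm_le[OF p0 p(2) beta(1)] unfolding hardy_norm_def by blast
  define B where "B = 2 * Ck + 1"
  have B: "B > 0" using A.Ck_nonneg by (simp add: B_def)
  have Bf: "Lp_enn M p (radial_max S f) \<le> ennreal B * hardy_norm M x1 \<epsilon> \<beta> \<gamma> p f" if "f \<in> G0_dual M x1 \<epsilon> \<beta> \<gamma>" for f
    unfolding hardy_norm_def B_def by (rule H.radial_norm_le[OF p0 that])
  define C where "C = max 1 (max A B)"
  have C: "C \<ge> 1" "A \<le> C" "B \<le> C" by (auto simp: C_def)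
  show ?thesis
  proof (rule exI[of _ C], intro conjI ballI impI C(1))
    fix f assume f: "f \<in> G0_dual M x1 \<epsilon> \<beta> \<gamma>"
    let ?R = "Lp_enn M p (radial_max S f)" and ?G = "hardy_norm M x1 \<epsilon> \<beta> \<gamma> p f"
    have up: "?G \<le> ennreal C * ?R"
      using A(2)[OF f] by (rule order_trans) (intro mult_right_mono ennreal_leI C, auto)
    show "?G \<le> ennreal C * ?R" by (rule up)
    have lo: "?R \<le> ennreal C * ?G"
      using Bf[OF f] by (rule order_trans) (intro mult_right_mono ennreal_leI C, auto)
    have "ennreal (1 / C) * ?R \<le> ennreal (1 / C) * (ennreal C * ?G)" by (intro mult_left_mono lo) auto
    also have "\<dots> = ?G" using C(1) by (simp add: mult.assoc[symmetric] flip: ennreal_mult')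
    finally show "ennreal (1 / C) * ?R \<le> ?G" .
    show "f \<in> hardy_space M x1 \<epsilon> \<beta> \<gamma> p \<longleftrightarrow> ?R < \<infinity>"
    proof
      assume "f \<in> hardy_space M x1 \<epsilon> \<beta> \<gamma> p"
      then have "?G < \<infinity>" by (simp add: hardy_space_def)
      then have "ennreal C * ?G < \<infinity>" by (simp add: ennreal_mult_less_top)
      then show "?R < \<infinity>" using lo by (rule le_less_trans[rotated])
    next
      assume "?R < \<infinity>"
      then have "ennreal C * ?R < \<infinity>" by (simp add: ennreal_mult_less_top)
      then have "?G < \<infinity>" using up by (rule le_less_trans[rotated])
      then show "f \<in> hardy_space M x1 \<epsilon> \<beta> \<gamma> p" using f by (simp add: hardy_space_def)
    qed
  qed
qed

end
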